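(* Let $\mathcal M=[\mathcal I]$ be a submodule of an analytic Hilbert module over $\mathbb C[\underline z]$ on $\Omega$, where $[\mathcal I]$ is the closure of an ideal $\mathcal I$ in the polynomial ring $\mathbb C[\underline z]$, and let $w_0\in\Omega$. Then the number of elements of a minimal set of generators of the stalk $\mathcal S^{\mathcal M}_{w_0}$ (as an $\mathcal O_{w_0}$-module) equals $\dim\bigcap_{j=1}^m\ker(M_j-w_{0j})^*$.
   Context: $\Omega\subset\mathbb C^m$ is a bounded domain, $\mathbb C[\underline z]=\mathbb C[z_1,\dots,z_m]$. A Hilbert module over $\mathbb C[\underline z]$ is a Hilbert space with a $\mathbb C[\underline z]$-module structure in which every polynomial acts as a bounded operator. An analytic Hilbert module on $\Omega$ is a Hilbert module over $\mathbb C[\underline z]$ (with action by pointwise multiplication) which consists of holomorphic functions on $\Omega$ and has a reproducing kernel, in which $\mathbb C[\underline z]$ is dense, and for which the set of virtual points $\{w\in\mathbb C^m:p\mapsto p(w),\ p\in\mathbb C[\underline z],\text{ extends continuously to the module}\}$ equals $\Omega$. $M_j$ is multiplication by $z_j$ on $\mathcal M$ and $(M_j-w_{0j})^*$ is the adjoint of $M_j-w_{0j}$ on $\mathcal M$. $\mathcal O_{w_0}$ is the ring of germs of holomorphic functions at $w_0$ and $\mathcal S^{\mathcal M}_{w_0}$ is the ideal of $\mathcal O_{w_0}$ generated by the germs at $w_0$ of all $f\in\mathcal M$. *)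

theory Defs
  imports
    "HOL-Analysis.Analysis"
    "HOL-Algebra.Ideal"
    "HOL-Library.Poly_Mapping"
    "HOL-Library.Function_Algebras"
begin

section \<open>Polynomials in \<open>m = CARD('n)\<close> variables\<close>

text \<open>
  A polynomial is a finitely supported map from monomials to coefficients, a monomial being
  a map from variables to exponents; the product on \<^typ>\<open>'a \<Rightarrow>\<^sub>0 'b\<close> is the convolution product.
\<close>

type_synonym 'n cpoly = "('n \<Rightarrow>\<^sub>0 nat) \<Rightarrow>\<^sub>0 complex"

definition poly_eval :: "('n::finite) cpoly \<Rightarrow> complex^'n \<Rightarrow> complex" where
  "poly_eval p z = (\<Sum>a\<in>Poly_Mapping.keys p. Poly_Mapping.lookup p a * (\<Prod>j\<in>UNIV. (z $ j) ^ Poly_Mapping.lookup a j))"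

definition const_poly :: "complex \<Rightarrow> ('n::finite) cpoly" where
  "const_poly c = Poly_Mapping.single 0 c"

text \<open>The submodules of a commutative ring, regarded as a module over itself, are its ideals.\<close>

definition poly_ideal :: "('n::finite) cpoly set \<Rightarrow> bool" where
  "poly_ideal I \<longleftrightarrow> module.subspace (*) I"


section \<open>Holomorphic functions of several variables and their germs\<close>

definition holomorphic_several_on :: "(complex^'n \<Rightarrow> complex) \<Rightarrow> (complex^('n::finite)) set \<Rightarrow> bool" where
  "holomorphic_several_on f S \<longleftrightarrow>
     (\<forall>z\<in>S. \<exists>D. (f has_derivative D) (at z) \<and> (\<forall>c v. D (c *s v) = c * D v))"

definition germ :: "complex^'n \<Rightarrow> (complex^'n \<Rightarrow> complex) \<Rightarrow> (complex^('n::finite) \<Rightarrow> complex) set" where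
  "germ w f = {g. eventually (\<lambda>z. g z = f z) (nhds w)}"

definition holomorphic_germs :: "complex^'n \<Rightarrow> (complex^('n::finite) \<Rightarrow> complex) set set" where
  "holomorphic_germs w = {germ w f | f. \<exists>S. open S \<and> w \<in> S \<and> holomorphic_several_on f S}"

definition germ_ring :: "complex^'n \<Rightarrow> (complex^('n::finite) \<Rightarrow> complex) set ring" where
  "germ_ring w =
     \<lparr> carrier = holomorphic_germs w,
       mult = (\<lambda>A B. \<Union>f\<in>A. \<Union>g\<in>B. germ w (\<lambda>z. f z * g z)),
       one = germ w (\<lambda>z. 1),
       zero = germ w (\<lambda>z. 0),
       add = (\<lambda>A B. \<Union>f\<in>A. \<Union>g\<in>B. germ w (\<lambda>z. f z + g z)) \<rparr>"

definition stalk :: "(complex^'n \<Rightarrow> complex) set \<Rightarrow> complex^'n \<Rightarrow> (complex^('n::finite) \<Rightarrow> complex) set set" where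
  "stalk M w = genideal (germ_ring w) (germ w ` M)"

text \<open>
  For a subset of a commutative ring, the submodule it generates is the ideal it generates.
  Minimality is with respect to inclusion.
\<close>

definition minimal_generators :: "('a, 'b) ring_scheme \<Rightarrow> 'a set \<Rightarrow> 'a set \<Rightarrow> bool" where
  "minimal_generators R J G \<longleftrightarrow>
     G \<subseteq> carrier R \<and> genideal R G = J \<and> (\<forall>G'. G' \<subset> G \<longrightarrow> genideal R G' \<noteq> J)"


section \<open>Hilbert spaces and Hilbert modules\<close>

text \<open>
  A Hilbert space is given by a subspace \<open>H\<close> of a complex vector space together with an
  inner product on \<open>H\<close>, linear in its first argument.  The values of \<open>ip\<close> outside \<open>H\<close> are
  irrelevant; the distance is set to 0 there because \<^locale>\<open>Metric_space\<close> wants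
  nonnegativity and symmetry on the whole type.
\<close>

definition hilbert_norm :: "('v \<Rightarrow> 'v \<Rightarrow> complex) \<Rightarrow> 'v \<Rightarrow> real" where
  "hilbert_norm ip f = sqrt (Re (ip f f))"

definition hilbert_dist :: "'v::ab_group_add set \<Rightarrow> ('v \<Rightarrow> 'v \<Rightarrow> complex) \<Rightarrow> 'v \<Rightarrow> 'v \<Rightarrow> real" where
  "hilbert_dist H ip f g = (if f \<in> H \<and> g \<in> H then hilbert_norm ip (f - g) else 0)"

definition hilbert_topology :: "'v::ab_group_add set \<Rightarrow> ('v \<Rightarrow> 'v \<Rightarrow> complex) \<Rightarrow> 'v topology" where
  "hilbert_topology H ip = Metric_space.mtopology H (hilbert_dist H ip)"

locale complex_hilbert_space = vector_space scale
  for scale :: "complex \<Rightarrow> 'v::ab_group_add \<Rightarrow> 'v" +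
  fixes H :: "'v set" and ip :: "'v \<Rightarrow> 'v \<Rightarrow> complex"
  assumes subspace_H: "subspace H"
    and ip_add: "\<And>f g h. f \<in> H \<Longrightarrow> g \<in> H \<Longrightarrow> h \<in> H \<Longrightarrow> ip (f + g) h = ip f h + ip g h"
    and ip_scale: "\<And>c f g. f \<in> H \<Longrightarrow> g \<in> H \<Longrightarrow> ip (scale c f) g = c * ip f g"
    and ip_cnj: "\<And>f g. f \<in> H \<Longrightarrow> g \<in> H \<Longrightarrow> ip g f = cnj (ip f g)"
    and ip_nonneg: "\<And>f. f \<in> H \<Longrightarrow> 0 \<le> Re (ip f f)"
    and ip_definite: "\<And>f. f \<in> H \<Longrightarrow> ip f f = 0 \<Longrightarrow> f = 0"
    and complete: "Metric_space.mcomplete H (hilbert_dist H ip)"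

locale hilbert_module = complex_hilbert_space scale H ip
  for scale :: "complex \<Rightarrow> 'v::ab_group_add \<Rightarrow> 'v" and H and ip +
  fixes act :: "('n::finite) cpoly \<Rightarrow> 'v \<Rightarrow> 'v"
  assumes act_closed: "\<And>p f. f \<in> H \<Longrightarrow> act p f \<in> H"
    and act_add_right: "\<And>p f g. f \<in> H \<Longrightarrow> g \<in> H \<Longrightarrow> act p (f + g) = act p f + act p g"
    and act_add_left: "\<And>p q f. f \<in> H \<Longrightarrow> act (p + q) f = act p f + act q f"
    and act_mult: "\<And>p q f. f \<in> H \<Longrightarrow> act (p * q) f = act p (act q f)"
    and act_const: "\<And>c f. f \<in> H \<Longrightarrow> act (const_poly c) f = scale c f"
    and act_bounded: "\<And>p. \<exists>B. \<forall>f\<in>H. hilbert_norm ip (act p f) \<le> B * hilbert_norm ip f"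

text \<open>
  The adjoint on \<open>M\<close> of an operator \<open>T\<close> on \<open>M\<close>; for bounded \<open>T\<close> on a Hilbert space \<open>M\<close> the
  vector below exists and is unique for every \<open>f \<in> M\<close>.
\<close>

definition adjoint_on :: "'v set \<Rightarrow> ('v \<Rightarrow> 'v \<Rightarrow> complex) \<Rightarrow> ('v \<Rightarrow> 'v) \<Rightarrow> 'v \<Rightarrow> 'v" where
  "adjoint_on M ip T f = (THE h. h \<in> M \<and> (\<forall>g\<in>M. ip (T g) f = ip g h))"


section \<open>Analytic Hilbert modules\<close>

text \<open>
  A function on \<open>\<Omega>\<close> is represented by its extension by 0 to \<open>\<complex>\<^sup>m\<close>, so that equality of
  representatives is equality on \<open>\<Omega>\<close>.
\<close>

definition fun_scale :: "complex \<Rightarrow> ('a \<Rightarrow> complex) \<Rightarrow> 'a \<Rightarrow> complex" where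
  "fun_scale c f = (\<lambda>z. c * f z)"

definition poly_act :: "('n::finite) cpoly \<Rightarrow> (complex^'n \<Rightarrow> complex) \<Rightarrow> complex^'n \<Rightarrow> complex" where
  "poly_act p f = (\<lambda>z. poly_eval p z * f z)"

definition poly_fun :: "(complex^'n) set \<Rightarrow> ('n::finite) cpoly \<Rightarrow> complex^'n \<Rightarrow> complex" where
  "poly_fun \<Omega> p = (\<lambda>z. if z \<in> \<Omega> then poly_eval p z else 0)"

definition virtual_points ::
  "(complex^'n) set \<Rightarrow> (complex^('n::finite) \<Rightarrow> complex) set \<Rightarrow>
   ((complex^'n \<Rightarrow> complex) \<Rightarrow> (complex^'n \<Rightarrow> complex) \<Rightarrow> complex) \<Rightarrow> (complex^'n) set" where
  "virtual_points \<Omega> H ip =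
     {w. \<exists>L. continuous_map (hilbert_topology H ip) euclidean L \<and>
             (\<forall>p. L (poly_fun \<Omega> p) = poly_eval p w)}"

locale analytic_hilbert_module =
  hilbert_module fun_scale H ip poly_act
  for \<Omega> :: "(complex^('n::finite)) set" and H ip +
  assumes holomorphic: "\<And>f. f \<in> H \<Longrightarrow> holomorphic_several_on f \<Omega>"
    and zero_outside: "\<And>f z. f \<in> H \<Longrightarrow> z \<notin> \<Omega> \<Longrightarrow> f z = 0"
    and reproducing_kernel: "\<exists>K. \<forall>w\<in>\<Omega>. K w \<in> H \<and> (\<forall>f\<in>H. ip f (K w) = f w)"
    and poly_in: "range (poly_fun \<Omega>) \<subseteq> H"
    and poly_dense: "hilbert_topology H ip closure_of range (poly_fun \<Omega>) = H"
    and virtual_points_eq: "virtual_points \<Omega> H ip = \<Omega>"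

definition ideal_closure ::
  "(complex^'n) set \<Rightarrow> (complex^'n \<Rightarrow> complex) set \<Rightarrow>
   ((complex^'n \<Rightarrow> complex) \<Rightarrow> (complex^'n \<Rightarrow> complex) \<Rightarrow> complex) \<Rightarrow>
   ('n::finite) cpoly set \<Rightarrow> (complex^'n \<Rightarrow> complex) set" where
  "ideal_closure \<Omega> H ip I = hilbert_topology H ip closure_of (poly_fun \<Omega> ` I)"

definition coord_mult :: "'n \<Rightarrow> (complex^('n::finite) \<Rightarrow> complex) \<Rightarrow> complex^'n \<Rightarrow> complex" where
  "coord_mult j f = (\<lambda>z. z $ j * f z)"

definition joint_kernel ::
  "(complex^'n \<Rightarrow> complex) set \<Rightarrow>
   ((complex^'n \<Rightarrow> complex) \<Rightarrow> (complex^'n \<Rightarrow> complex) \<Rightarrow> complex) \<Rightarrow>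
   complex^('n::finite) \<Rightarrow> (complex^'n \<Rightarrow> complex) set" where
  "joint_kernel M ip w =
     (\<Inter>j\<in>UNIV. {f \<in> M. adjoint_on M ip (\<lambda>g. coord_mult j g - fun_scale (w $ j) g) f = 0})"

text \<open>\<^const>\<open>vector_space.dim\<close> is 0 on infinite-dimensional spaces, so finiteness is stated apart.\<close>

definition has_complex_dim :: "('a \<Rightarrow> complex) set \<Rightarrow> nat \<Rightarrow> bool" where
  "has_complex_dim V d \<longleftrightarrow>
     (\<exists>B. finite B \<and> V \<subseteq> module.span fun_scale B) \<and> vector_space.dim fun_scale V = d"

end

theory Submission
  imports Defs "HOL-Complex_Analysis.Complex_Analysis" "HOL-Computational_Algebra.Primes"
begin

text \<open>
  Move \<open>w\<^sub>0\<close> to the origin, let \<open>J\<close> be the translated ideal and \<open>\<mm>\<close> the maximal ideal at 0.  Both numbers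
  equal \<open>d = dim J / \<mm> J\<close>.

  Stalk.  Dividing \<open>p \<in> J\<close> by polynomials in \<open>J\<close> whose lowest terms generate all lowest terms of \<open>J\<close>
  gives holomorphic quotients whose size on a fixed polydisc is controlled by a weighted \<open>\<ell>\<^sup>1\<close>-norm of the
  coefficients of \<open>p\<close>, and hence by the norm of the Hilbert module.  So limits of elements of \<open>J\<close> still
  lie in the ideal of germs generated by \<open>J\<close>, which is therefore the stalk.  By Nakayama's lemma its
  minimal generating sets have as many elements as the dimension of the stalk modulo its product with the
  maximal ideal of germs.  That dimension is \<open>d\<close>: a relation with holomorphic coefficients becomes
  polynomial after replacing the coefficients by Taylor polynomials, up to an element of \<open>J\<close> of high order,
  and such elements lie in \<open>\<mm> J\<close> by a lemma of Artin--Rees type.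

  Joint kernel.  It is the orthogonal complement of \<open>\<mm> M\<close> in \<open>M\<close>.  The coordinate functionals of
  \<open>J / \<mm> J\<close> depend, by the same lemma, on finitely many coefficients, so they are bounded; their Riesz
  vectors form a basis of the joint kernel.
\<close>

section \<open>Monomials and polynomials\<close>

text \<open>The obstacle is that \<open>M\<close> is a completion of the image of \<open>J\<close>
  and has no algebraic description, so neither number can be read off from \<open>M\<close>. Both
  are therefore computed from \<open>J\<close>: the stalk because an ideal of germs is closed under
  suitable limits, the joint kernel because \<open>J\<close> is dense in \<open>M\<close>.
  Closedness requires quotients bounded by the dividend. This is why division cancels lowest and not
  highest terms: near the point high powers are small, so the process converges although it need not
  stop. One function, the prime code of a monomial, supplies both the term order and the weights.
  The radii \<open>1 / p ^ s\<close> for distinct primes \<open>p\<close> shrink at different rates,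
  and a large \<open>s\<close> makes each lowest term dominate the rest of its polynomial. The
  Artin-Rees type lemma makes the class of an element of \<open>J\<close> modulo the product with
  the maximal ideal depend on finitely many coefficients. Hence this class survives truncation of
  power series and is continuous.\<close>

abbreviation "lookup \<equiv> Poly_Mapping.lookup"
abbreviation "keys \<equiv> Poly_Mapping.keys"
abbreviation "single \<equiv> Poly_Mapping.single"

lemma ex_inj_primes: "\<exists>p::'n::finite \<Rightarrow> nat. inj p \<and> range p \<subseteq> {q. prime q}"
proof -
  obtain P where P: "P \<subseteq> {q::nat. prime q}" "finite P" "card P = CARD('n)"
    using infinite_arbitrarily_large[OF primes_infinite] by metis
  then obtain p where "bij_betw p (UNIV :: 'n set) P"
    using finite_same_card_bij[of "UNIV :: 'n set" P] by auto
  then show ?thesis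
    using P(1) unfolding bij_betw_def by metis
qed

section \<open>Prime codes of monomials\<close>

definition var_prime :: "'n::finite \<Rightarrow> nat" where
  "var_prime = (SOME p. inj p \<and> range p \<subseteq> {q. prime q})"

lemma inj_var_prime: "inj var_prime" and prime_var_prime: "prime (var_prime j)"
  using someI_ex[OF ex_inj_primes] unfolding var_prime_def by auto

text \<open>
  Coding monomials by products of prime powers gives a multiplicative, injective map to the natural
  numbers, hence at once a well-founded monomial order and the weights \<open>1 / mon_code a ^ s\<close>.
\<close>

definition mon_code :: "('n::finite \<Rightarrow>\<^sub>0 nat) \<Rightarrow> nat" where
  "mon_code a = (\<Prod>j\<in>UNIV. var_prime j ^ lookup a j)"

lemma mon_code_0 [simp]: "mon_code 0 = 1"
  by (simp add: mon_code_def)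

lemma mon_code_add: "mon_code (a + b) = mon_code a * mon_code b"
  by (simp add: mon_code_def lookup_add power_add prod.distrib)

lemma mon_code_pos: "0 < mon_code a"
  unfolding mon_code_def by (rule prod_pos) (simp add: prime_gt_0_nat prime_var_prime)

lemma inj_mon_code: "inj mon_code"
proof (rule injI)
  fix a b :: "'a \<Rightarrow>\<^sub>0 nat"
  assume eq: "mon_code a = mon_code b"
  have "multiplicity (var_prime i) (mon_code c) = lookup c i" for c :: "'a \<Rightarrow>\<^sub>0 nat" and i
  proof -
    have "multiplicity (var_prime i) (mon_code c) =
        (\<Sum>j\<in>UNIV. multiplicity (var_prime i) (var_prime j ^ lookup c j))"
      unfolding mon_code_def
      by (subst prime_elem_multiplicity_prod_distrib) (auto simp: prime_var_prime, metis not_prime_0 prime_var_prime)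
    also have "\<dots> = (\<Sum>j\<in>UNIV. if j = i then lookup c i else 0)"
      by (intro sum.cong refl)
        (auto simp: multiplicity_distinct_prime_power prime_var_prime inj_eq[OF inj_var_prime]
          not_prime_unit)
    finally show ?thesis by simp
  qed
  then show "a = b"
    using eq by (intro poly_mapping_eqI) metis
qed

lemma mon_code_eq_iff [simp]: "mon_code a = mon_code b \<longleftrightarrow> a = b"
  by (meson inj_mon_code injD)

lemma finite_mon_code_le: "finite {a. mon_code a \<le> n}"
  using finite_vimageI[OF finite_atMost[of n] inj_mon_code] by (simp add: vimage_def)

section \<open>Degree and evaluation\<close>

definition mon_degree :: "('n::finite \<Rightarrow>\<^sub>0 nat) \<Rightarrow> nat" where
  "mon_degree a = (\<Sum>j\<in>UNIV. lookup a j)"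

definition mon_eval :: "('n::finite \<Rightarrow>\<^sub>0 nat) \<Rightarrow> complex^'n \<Rightarrow> complex" where
  "mon_eval a z = (\<Prod>j\<in>UNIV. (z $ j) ^ lookup a j)"

lemma mon_eval_0 [simp]: "mon_eval 0 z = 1"
  by (simp add: mon_eval_def)

lemma mon_eval_add: "mon_eval (a + b) z = mon_eval a z * mon_eval b z"
  by (simp add: mon_eval_def lookup_add power_add prod.distrib)

lemma poly_eval_superset:
  assumes "finite S" "keys p \<subseteq> S"
  shows "poly_eval p z = (\<Sum>a\<in>S. lookup p a * mon_eval a z)"
  unfolding poly_eval_def mon_eval_def[symmetric]
  using assms by (intro sum.mono_neutral_left) (auto simp: in_keys_iff)

lemma poly_eval_0 [simp]: "poly_eval 0 z = 0"
  by (simp add: poly_eval_def)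

lemma poly_eval_single [simp]: "poly_eval (single a c) z = c * mon_eval a z"
  by (subst poly_eval_superset[of "{a}"]) auto

lemma poly_eval_add [simp]: "poly_eval (p + q) z = poly_eval p z + poly_eval q z"
proof -
  let ?S = "keys p \<union> keys q"
  have "keys (p + q) \<subseteq> ?S" by (rule keys_add)
  then show ?thesis
    by (subst (1 2 3) poly_eval_superset[of ?S]) (auto simp: lookup_add algebra_simps sum.distrib)
qed

lemma poly_eval_uminus [simp]: "poly_eval (- p) z = - poly_eval p z"
  using poly_eval_add[of p "- p" z] by (simp add: eq_neg_iff_add_eq_0 add.commute)

lemma poly_eval_diff [simp]: "poly_eval (p - q) z = poly_eval p z - poly_eval q z"
  using poly_eval_add[of p "- q" z] by simp

lemma poly_eval_sum [simp]: "poly_eval (\<Sum>i\<in>I. f i) z = (\<Sum>i\<in>I. poly_eval (f i) z)"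
  by (induction I rule: infinite_finite_induct) auto

lemma poly_mapping_sum_single:
  "p = (\<Sum>a\<in>keys p. single a (lookup p a))"
proof (rule poly_mapping_eqI)
  fix b
  show "lookup p b =
    lookup (\<Sum>a\<in>keys p. single a (lookup p a)) b"
    by (auto simp: lookup_sum lookup_single when_def in_keys_iff sum.delta')
qed

lemma poly_eval_mult [simp]: "poly_eval (p * q) z = poly_eval p z * poly_eval q z"
proof -
  let ?s = "\<lambda>p. (\<Sum>a\<in>keys p. single a (lookup p a))"
  have "poly_eval (?s p * ?s q) z = poly_eval (?s p) z * poly_eval (?s q) z"
    by (simp add: sum_product mult_single mon_eval_add mult_ac)
  then show ?thesis
    by (simp flip: poly_mapping_sum_single)
qed

lemma poly_eval_1 [simp]: "poly_eval 1 z = 1"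
  by (simp flip: single_one)

lemma poly_eval_const [simp]: "poly_eval (const_poly c) z = c"
  by (simp add: const_poly_def)

lemma poly_eval_power [simp]: "poly_eval (p ^ k) z = poly_eval p z ^ k"
  by (induction k) auto

lemma poly_eval_prod [simp]: "poly_eval (\<Prod>i\<in>I. f i) z = (\<Prod>i\<in>I. poly_eval (f i) z)"
  by (induction I rule: infinite_finite_induct) auto

lemma const_poly_0 [simp]: "const_poly 0 = 0" and const_poly_1 [simp]: "const_poly 1 = 1"
  by (simp_all add: const_poly_def)

definition var_poly :: "'n \<Rightarrow> ('n::finite) cpoly" where
  "var_poly j = single (single j 1) 1"

lemma poly_eval_var [simp]: "poly_eval (var_poly j) z = z $ j"
proof -
  have "mon_eval (single j 1) z = (\<Prod>i\<in>UNIV. if i = j then z $ j else 1)"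
    unfolding mon_eval_def by (intro prod.cong) (auto simp: lookup_single when_def)
  then show ?thesis by (simp add: var_poly_def)
qed

lemma mon_eval_poly: "mon_eval a z = poly_eval (\<Prod>j\<in>UNIV. var_poly j ^ lookup a j) z"
  by (simp add: mon_eval_def)

lemma poly_compose_translate: "\<exists>q. \<forall>z. poly_eval q z = poly_eval p (z + w)"
proof -
  define q where "q = (\<Sum>a\<in>keys p. const_poly (lookup p a) *
    (\<Prod>j\<in>UNIV. (var_poly j + const_poly (w $ j)) ^ lookup a j))"
  have "poly_eval q z = poly_eval p (z + w)" for z
    by (simp add: q_def) (simp add: poly_eval_def)
  then show ?thesis by blast
qed

section \<open>Coefficient estimates\<close>

text \<open>Orthogonality of characters of a cyclic group; it plays the part of integration over a
  circle in the coefficient estimate below.\<close>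

lemma sum_root_of_unity_powers:
  assumes "0 < N"
  shows "(\<Sum>k<N. cis (2 * pi / N) ^ (m * k)) = (if N dvd m then of_nat N else 0)"
proof -
  define w where "w = cis (2 * pi / N) ^ m"
  have w1: "w = 1 \<longleftrightarrow> N dvd m"
  proof
    assume "w = 1"
    then have "cis (m * (2 * pi / N)) = 1" by (simp only: w_def Complex.DeMoivre)
    then have "cos (m * (2 * pi / N)) = 1" by (metis cis.sel(1) one_complex.sel(1))
    then obtain x :: int where "real m * (2 * pi / N) = of_int x * 2 * pi"
      using cos_one_2pi_int by auto
    then have "real m = of_int x * N"
      using assms by (simp add: field_simps)
    then have "int m = x * int N"
      by (metis of_int_eq_iff of_int_mult of_int_of_nat_eq)
    then show "N dvd m"
      by (metis dvd_triv_right int_dvd_int_iff)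
  next
    assume "N dvd m"
    then obtain q where "m = N * q" by blast
    moreover have "cis (2 * pi / N) ^ N = 1"
      using assms by (simp add: Complex.DeMoivre)
    ultimately show "w = 1"
      by (simp add: w_def power_mult)
  qed
  have "w ^ N = (cis (2 * pi / N) ^ N) ^ m"
    by (simp add: w_def mult.commute flip: power_mult)
  also have "\<dots> = 1"
    using assms by (simp add: Complex.DeMoivre)
  finally have wN: "w ^ N = 1" .
  have "(\<Sum>k<N. cis (2 * pi / N) ^ (m * k)) = (\<Sum>k<N. w ^ k)"
    by (simp add: w_def power_mult)
  also have "\<dots> = (if N dvd m then of_nat N else 0)"
    using w1 wN by (auto simp: sum_gp_strict)
  finally show ?thesis .
qed

text \<open>Cauchy's estimate on a torus. The mean over a grid of roots of unity isolates a
  coefficient exactly once the grid is finer than all exponents.\<close>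

lemma poly_coeff_bound:
  fixes p :: "('n::finite) cpoly"
  assumes r: "0 < r"
    and B: "\<And>z. (\<And>j. cmod (z $ j) = r) \<Longrightarrow> cmod (poly_eval p z) \<le> B"
  shows "cmod (lookup p a) * r ^ mon_degree a \<le> B"
proof -
  define S where "S = insert a (keys p)"
  have fS: "finite S" by (simp add: S_def)
  \<comment> \<open>\<open>N\<close> exceeds every exponent in \<open>p\<close> and in
    \<open>a\<close>, so exponents that agree modulo \<open>N\<close> are equal.\<close>
  define N where "N = Suc (\<Sum>b\<in>S. mon_degree b)"
  have N0: "0 < N" by (simp add: N_def)
  have lt: "lookup b j < N" if "b \<in> S" for b j
  proof -
    have "lookup b j \<le> mon_degree b"
      unfolding mon_degree_def by (rule member_le_sum) auto
    also have "\<dots> \<le> (\<Sum>b\<in>S. mon_degree b)"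
      using that fS by (intro member_le_sum) auto
    finally show ?thesis by (simp add: N_def)
  qed
  define w where "w = cis (2 * pi / N)"
  have nw: "cmod w = 1" by (simp add: w_def)
  define K where "K = (PiE UNIV (\<lambda>_. {..<N}) :: ('n \<Rightarrow> nat) set)"
  have fK: "finite K" unfolding K_def by (intro finite_PiE) auto
  have cK: "card K = N ^ CARD('n)"
    unfolding K_def by (simp add: card_PiE)
  define pt where "pt k = (\<chi> j. of_real r * w ^ k j)" for k :: "'n \<Rightarrow> nat"
  \<comment> \<open>The conjugate character of \<open>a\<close>: \<open>N - lookup a j\<close>
    stands for the negative exponent, as \<open>w ^ N = 1\<close>.\<close>
  define e where "e k = (\<Prod>j\<in>UNIV. w ^ ((N - lookup a j) * k j))" for k :: "'n \<Rightarrow> nat"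
  have orth: "(\<Sum>k\<in>K. mon_eval b (pt k) * e k) = (if b = a then of_nat (N ^ CARD('n)) * of_real r ^ mon_degree a else 0)"
    if b: "b \<in> S" for b
  proof -
    have "(\<Sum>k\<in>K. mon_eval b (pt k) * e k) =
      (\<Sum>k\<in>K. of_real r ^ mon_degree b * (\<Prod>j\<in>UNIV. w ^ ((lookup b j + (N - lookup a j)) * k j)))"
    proof (rule sum.cong[OF refl])
      fix k
      have "mon_eval b (pt k) = of_real r ^ mon_degree b * (\<Prod>j\<in>UNIV. w ^ (lookup b j * k j))"
        by (simp add: mon_eval_def pt_def power_mult_distrib prod.distrib mon_degree_def power_sum
            mult.commute flip: power_mult)
      then show "mon_eval b (pt k) * e k = of_real r ^ mon_degree b *
          (\<Prod>j\<in>UNIV. w ^ ((lookup b j + (N - lookup a j)) * k j))"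
        by (simp add: e_def add_mult_distrib power_add mult.assoc flip: prod.distrib)
    qed
    also have "\<dots> = of_real r ^ mon_degree b *
        (\<Prod>j\<in>UNIV. \<Sum>k<N. w ^ ((lookup b j + (N - lookup a j)) * k))"
      unfolding K_def sum_distrib_left[symmetric]
      by (subst prod_sum_PiE[of "UNIV :: 'n set" "\<lambda>_. {..<N}"]) auto
    also have "\<dots> = of_real r ^ mon_degree b *
        (\<Prod>j\<in>UNIV. if N dvd (lookup b j + (N - lookup a j)) then of_nat N else 0)"
      unfolding w_def by (simp add: sum_root_of_unity_powers[OF N0])
    also have "\<dots> = of_real r ^ mon_degree b *
        (\<Prod>j\<in>UNIV. if lookup b j = lookup a j then of_nat N else 0)"
    proof -
      have "N dvd (lookup b j + (N - lookup a j)) \<longleftrightarrow>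
          lookup b j = lookup a j" for j
      proof
        assume "N dvd (lookup b j + (N - lookup a j))"
        then obtain q where q: "lookup b j + (N - lookup a j) = N * q" by blast
        have l: "lookup b j < N" "lookup a j < N"
          using lt b by (auto simp: S_def)
        then have "0 < N * q" "N * q < N * 2"
          using q by linarith+
        then have "q = 1" by (simp add: nat_mult_less_cancel_disj)
        then show "lookup b j = lookup a j"
          using q l by simp
      next
        assume "lookup b j = lookup a j"
        then show "N dvd (lookup b j + (N - lookup a j))"
          using lt[of a j] by (simp add: S_def)
      qed
      then show ?thesis by simp
    qed
    also have "\<dots> = (if b = a then of_nat (N ^ CARD('n)) * of_real r ^ mon_degree a else 0)"
    proof (cases "b = a")
      case False
      then obtain j where "lookup b j \<noteq> lookup a j"
        by (meson poly_mapping_eqI)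
      then have "(\<Prod>j\<in>UNIV. if lookup b j = lookup a j then of_nat N else 0) = (0::complex)"
        by (intro prod_zero) auto
      then show ?thesis using False by simp
    qed simp
    finally show ?thesis .
  qed
  have "(\<Sum>k\<in>K. poly_eval p (pt k) * e k) = (\<Sum>k\<in>K. \<Sum>b\<in>S. lookup p b * (mon_eval b (pt k) * e k))"
    by (subst poly_eval_superset[OF fS]) (auto simp: S_def sum_distrib_right mult.assoc)
  also have "\<dots> = (\<Sum>b\<in>S. lookup p b * (\<Sum>k\<in>K. mon_eval b (pt k) * e k))"
    by (subst sum.swap) (simp add: sum_distrib_left)
  also have "\<dots> = (\<Sum>b\<in>S. if b = a then lookup p a * (of_nat (N ^ CARD('n)) * of_real r ^ mon_degree a) else 0)"
    by (intro sum.cong refl) (auto simp: orth)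
  also have "\<dots> = lookup p a * (of_nat (N ^ CARD('n)) * of_real r ^ mon_degree a)"
    using fS by (simp add: S_def)
  finally have eq: "(\<Sum>k\<in>K. poly_eval p (pt k) * e k) = \<dots>" .
  have "cmod (\<Sum>k\<in>K. poly_eval p (pt k) * e k) \<le> (\<Sum>k\<in>K. B)"
  proof (rule sum_norm_le)
    fix k
    have "cmod (e k) = 1"
      by (simp add: e_def norm_power nw flip: prod_norm)
    moreover have "cmod (poly_eval p (pt k)) \<le> B"
      using r by (intro B) (simp add: pt_def norm_mult norm_power nw)
    ultimately show "cmod (poly_eval p (pt k) * e k) \<le> B"
      by (simp add: norm_mult)
  qed
  then have "real (N ^ CARD('n)) * (cmod (lookup p a) * r ^ mon_degree a) \<le> real (N ^ CARD('n)) * B"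
    unfolding eq using r by (simp add: norm_mult norm_power cK mult_ac)
  then show ?thesis
    using N0 by simp
qed

text \<open>As the code is multiplicative, this is the sum of the absolute values of the terms of
  \<open>p\<close> at the point with coordinates \<open>1 / var_prime j ^ s\<close>. Larger
  \<open>s\<close> means a smaller polydisc.\<close>

definition coeff_norm :: "nat \<Rightarrow> ('n::finite) cpoly \<Rightarrow> real" where
  "coeff_norm s p = (\<Sum>a\<in>keys p. cmod (lookup p a) / real (mon_code a) ^ s)"

lemma coeff_norm_superset:
  assumes "finite S" "keys p \<subseteq> S"
  shows "coeff_norm s p = (\<Sum>a\<in>S. cmod (lookup p a) / real (mon_code a) ^ s)"
  unfolding coeff_norm_def using assms by (intro sum.mono_neutral_left) (auto simp: in_keys_iff)

lemma coeff_norm_nonneg: "0 \<le> coeff_norm s p"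
  unfolding coeff_norm_def by (intro sum_nonneg) auto

lemma coeff_norm_0 [simp]: "coeff_norm s 0 = 0"
  by (simp add: coeff_norm_def)

lemma coeff_norm_single [simp]: "coeff_norm s (single a c) = cmod c / real (mon_code a) ^ s"
  by (subst coeff_norm_superset[of "{a}"]) auto

lemma coeff_norm_add: "coeff_norm s (p + q) \<le> coeff_norm s p + coeff_norm s q"
proof -
  let ?S = "keys p \<union> keys q"
  have "keys (p + q) \<subseteq> ?S" by (rule keys_add)
  then show ?thesis
    by (subst (1 2 3) coeff_norm_superset[of ?S])
      (auto simp: lookup_add divide_right_mono norm_triangle_ineq intro!: sum_mono
        simp flip: sum.distrib add_divide_distrib)
qed

lemma coeff_norm_uminus [simp]: "coeff_norm s (- p) = coeff_norm s p"
  by (simp add: coeff_norm_def keys.rep_eq uminus_poly_mapping.rep_eq)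

lemma coeff_norm_sum: "coeff_norm s (\<Sum>i\<in>I. f i) \<le> (\<Sum>i\<in>I. coeff_norm s (f i))"
proof (induction I rule: infinite_finite_induct)
  case (insert i I)
  then show ?case
    using coeff_norm_add[of s "f i" "sum f I"] by simp
qed auto

lemma coeff_norm_single_mult:
  "coeff_norm s (single b c * p) \<le> cmod c / real (mon_code b) ^ s * coeff_norm s p"
proof -
  have "single b c * p =
    (\<Sum>a\<in>keys p. single (b + a) (c * lookup p a))"
    by (subst (1) poly_mapping_sum_single[of p]) (simp add: sum_distrib_left mult_single)
  also have "coeff_norm s \<dots> \<le> (\<Sum>a\<in>keys p.
      cmod (c * lookup p a) / real (mon_code (b + a)) ^ s)"
    by (rule order_trans[OF coeff_norm_sum]) simp
  also have "\<dots> = cmod c / real (mon_code b) ^ s * coeff_norm s p"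
    by (simp add: coeff_norm_def sum_distrib_left norm_mult mon_code_add power_mult_distrib)
  finally show ?thesis .
qed

text \<open>The norm is additive over disjoint supports, hence the equality; each division step
  spends this gain on its correction.\<close>

lemma coeff_norm_minus_term:
  "coeff_norm s (p - single a (lookup p a)) =
    coeff_norm s p - cmod (lookup p a) / real (mon_code a) ^ s"
proof -
  let ?q = "p - single a (lookup p a)" and ?S = "insert a (keys p)"
  have "keys ?q \<subseteq> ?S"
    by (auto simp: in_keys_iff lookup_minus lookup_single when_def split: if_splits)
  moreover have "lookup ?q x = (if x = a then 0 else lookup p x)" for x
    by (simp add: lookup_minus lookup_single when_def)
  ultimately show ?thesis
    by (subst (1 2) coeff_norm_superset[of ?S]) (auto simp: sum.insert_remove)
qed

lemma mon_eval_bound: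
  assumes "\<And>j. cmod (z $ j) \<le> 1 / real (var_prime j) ^ s"
  shows "cmod (mon_eval a z) \<le> 1 / real (mon_code a) ^ s"
proof -
  have "cmod (mon_eval a z) = (\<Prod>j\<in>UNIV. cmod (z $ j) ^ lookup a j)"
    by (simp add: mon_eval_def norm_power flip: prod_norm)
  also have "\<dots> \<le> (\<Prod>j\<in>UNIV. (1 / real (var_prime j) ^ s) ^ lookup a j)"
    using assms by (intro prod_mono) (auto intro: power_mono)
  also have "\<dots> = 1 / real (mon_code a) ^ s"
    by (simp add: mon_code_def power_divide prod_dividef prod_power_distrib mult.commute flip: power_mult)
  finally show ?thesis .
qed

lemma poly_eval_bound:
  assumes "\<And>j. cmod (z $ j) \<le> 1 / real (var_prime j) ^ s"
  shows "cmod (poly_eval p z) \<le> coeff_norm s p"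
  unfolding coeff_norm_def poly_eval_superset[OF finite_keys subset_refl]
  using mon_eval_bound[OF assms] by (intro sum_norm_le) (simp add: norm_mult mult_left_mono divide_inverse)

text \<open>Injectivity of the code bounds the sum of \<open>1 / mon_code a ^ 2\<close> by \<open>\<zeta>(2)\<close>.\<close>

lemma coeff_norm_le_sup:
  fixes p :: "('n::finite) cpoly"
  assumes r: "0 < r" "1 / 2 ^ s \<le> r"
    and B: "\<And>z. (\<And>j. cmod (z $ j) = r) \<Longrightarrow> cmod (poly_eval p z) \<le> B"
  shows "coeff_norm (s + 2) p \<le> suminf (\<lambda>n. 1 / real (Suc n) ^ 2) * B"
proof -
  have "cmod (poly_eval p (\<chi> j. of_real r)) \<le> B"
    using r by (intro B) simp
  then have B0: "0 \<le> B" by (rule order_trans[rotated]) simp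
  have trm: "cmod (lookup p a) / real (mon_code a) ^ (s + 2) \<le> B * (1 / real (mon_code a) ^ 2)" for a
  proof -
    have "1 / real (mon_code a) ^ s = (\<Prod>j\<in>UNIV. (1 / real (var_prime j) ^ s) ^ lookup a j)"
      by (simp add: mon_code_def power_divide prod_dividef prod_power_distrib mult.commute flip: power_mult)
    also have "\<dots> \<le> (\<Prod>j\<in>UNIV. r ^ lookup a j)"
    proof (intro prod_mono conjI power_mono)
      fix j :: 'n
      have "1 / real (var_prime j) ^ s \<le> 1 / 2 ^ s"
        using prime_ge_2_nat[OF prime_var_prime[of j]] by (intro divide_left_mono power_mono) auto
      then show "1 / real (var_prime j) ^ s \<le> r"
        using r by linarith
    qed auto
    also have "\<dots> = r ^ mon_degree a"
      by (simp add: mon_degree_def power_sum)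
    finally have "cmod (lookup p a) * (1 / real (mon_code a) ^ s) \<le> B"
      using poly_coeff_bound[OF r(1) B, of a] mult_left_mono[of _ _ "cmod (lookup p a)"]
      by (meson norm_ge_zero order_trans)
    then have "cmod (lookup p a) * (1 / real (mon_code a) ^ s) * (1 / real (mon_code a) ^ 2) \<le> B * (1 / real (mon_code a) ^ 2)"
      by (rule mult_right_mono) simp
    then show ?thesis
      by (simp only: power_add) (simp add: mult.commute)
  qed
  have summ: "summable (\<lambda>n. 1 / real (Suc n) ^ 2)"
    using inverse_power_summable[of 2, where 'a=real] by (subst summable_Suc_iff) (simp add: divide_inverse)
  have "coeff_norm (s + 2) p \<le> (\<Sum>a\<in>keys p. B * (1 / real (mon_code a) ^ 2))"
    unfolding coeff_norm_def by (intro sum_mono trm)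
  \<comment> \<open>Codes start at 1 while the series is indexed from 0, hence the shift.\<close>
  also have "\<dots> = B * (\<Sum>a\<in>keys p. 1 / real (Suc (mon_code a - 1)) ^ 2)"
    by (simp add: sum_distrib_left mon_code_pos Suc_diff_1 del: of_nat_Suc)
  also have "(\<Sum>a\<in>keys p. 1 / real (Suc (mon_code a - 1)) ^ 2) =
      (\<Sum>n\<in>(\<lambda>a. mon_code a - 1) ` keys p. 1 / real (Suc n) ^ 2)"
  proof (subst sum.reindex)
    show "inj_on (\<lambda>a. mon_code a - 1) (keys p)"
      by (rule inj_onI) (metis Suc_diff_1 mon_code_eq_iff mon_code_pos)
  qed simp
  also have "B * \<dots> \<le> B * suminf (\<lambda>n. 1 / real (Suc n) ^ 2)"
    by (intro mult_left_mono sum_le_suminf summ B0) auto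
  finally show ?thesis
    by (simp only: mult.commute)
qed

section \<open>Polynomial ideals\<close>

interpretation ring_module: module "(*) :: 'a::comm_ring_1 \<Rightarrow> 'a \<Rightarrow> 'a"
  by unfold_locales (simp_all add: algebra_simps)

text \<open>As a simplification rule this would loop with \<open>mult.assoc\<close>.\<close>

declare ring_module.scale_scale [simp del]

section \<open>Dickson's lemma\<close>

lemma incseq_subseq_nat:
  fixes s :: "nat \<Rightarrow> nat"
  shows "\<exists>r. strict_mono r \<and> incseq (\<lambda>k. s (r k))"
proof -
  obtain r where r: "strict_mono r" "monoseq (\<lambda>k. s (r k))"
    using seq_monosub[of s] by blast
  show ?thesis
  proof (cases "incseq (\<lambda>k. s (r k))")
    case False
    then have dec: "s (r m) \<ge> s (r n)" if "m \<le> n" for m n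
      using r(2) that unfolding monoseq_def incseq_def by blast
    obtain m where m: "\<And>k. s (r m) \<le> s (r k)"
      using ex_has_least_nat[of "\<lambda>_. True" 0 "\<lambda>k. s (r k)"] by auto
    have "s (r (m + k)) = s (r m)" for k
      using m dec[of m "m + k"] by (simp add: order_antisym)
    then have "incseq (\<lambda>k. s (r (m + k)))"
      by (simp add: incseq_def)
    moreover have "strict_mono (\<lambda>k. r (m + k))"
      using r(1) by (simp add: strict_mono_def)
    ultimately show ?thesis by (intro exI[of _ "\<lambda>k. r (m + k)"]) simp
  qed (use r in blast)
qed

lemma incseq_subseq_exponents:
  fixes f :: "nat \<Rightarrow> 'n::finite \<Rightarrow>\<^sub>0 nat"
  shows "\<exists>r. strict_mono r \<and> (\<forall>j\<in>S. incseq (\<lambda>k. lookup (f (r k)) j))"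
proof -
  have "finite S" by simp
  then show ?thesis
  proof (induction S)
    case empty
    show ?case by (intro exI[of _ id]) (simp add: strict_mono_def)
  next
    case (insert i S)
    then obtain r where r: "strict_mono r" "\<And>j. j \<in> S \<Longrightarrow> incseq (\<lambda>k. lookup (f (r k)) j)"
      by blast
    obtain t where t: "strict_mono t" "incseq (\<lambda>k. lookup (f (r (t k))) i)"
      using incseq_subseq_nat[of "\<lambda>k. lookup (f (r k)) i"] by blast
    have "incseq (\<lambda>k. lookup (f (r (t k))) j)" if "j \<in> S" for j
      using r(2)[OF that] strict_mono_mono[OF t(1)] by (simp add: mono_def)
    moreover have "strict_mono (r \<circ> t)"
      using r(1) t(1) by (rule strict_mono_o)
    ultimately show ?case
      using t(2) by (intro exI[of _ "r \<circ> t"]) (auto simp: o_def)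
  qed
qed

text \<open>\<open>F\<close> consists of the elements of \<open>U\<close> minimal for divisibility.
  An infinite \<open>F\<close> would contain, along a subsequence monotone in every exponent, one
  element dividing another.\<close>

lemma dickson:
  fixes U :: "('n::finite \<Rightarrow>\<^sub>0 nat) set"
  shows "\<exists>F. finite F \<and> F \<subseteq> U \<and> (\<forall>u\<in>U. \<exists>a\<in>F. \<exists>c. u = c + a)"
proof -
  define F where "F = {u\<in>U. \<forall>v\<in>U. \<forall>c. u = c + v \<longrightarrow> v = u}"
  have "finite F"
  proof (rule ccontr)
    assume "infinite F"
    then obtain f :: "nat \<Rightarrow> 'n \<Rightarrow>\<^sub>0 nat" where f: "inj f" "range f \<subseteq> F"
      by (meson infinite_countable_subset)
    obtain r where r: "strict_mono r" "\<And>j. incseq (\<lambda>k. lookup (f (r k)) j)"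
      using incseq_subseq_exponents[of UNIV f] by blast
    have "f (r 1) = (f (r 1) - f (r 0)) + f (r 0)"
      using r(2) by (intro poly_mapping_eqI) (simp add: lookup_add lookup_minus incseq_def)
    then have "f (r 0) = f (r 1)"
      using f(2) unfolding F_def by blast
    then have "r 0 = r 1" using f(1) by (simp add: inj_eq)
    then show False using strict_monoD[OF r(1), of 0 1] by simp
  qed
  \<comment> \<open>Descent on the code terminates because a proper divisor has a strictly smaller
    code.\<close>
  moreover have "\<exists>a\<in>F. \<exists>c. u = c + a" if "u \<in> U" for u
    using that
  proof (induction "mon_code u" arbitrary: u rule: less_induct)
    case less
    show ?case
    proof (cases "u \<in> F")
      case True
      then show ?thesis by (intro bexI[of _ u] exI[of _ 0]) auto
    next
      case False
      then obtain v c where v: "v \<in> U" "u = c + v" "v \<noteq> u"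
        using less.prems unfolding F_def by blast
      have "mon_code u = mon_code c * mon_code v" using v(2) by (simp add: mon_code_add)
      moreover have "mon_code v \<noteq> mon_code u" using v(3) by simp
      ultimately have "mon_code v < mon_code u"
        using mon_code_pos[of c] mon_code_pos[of v] by (cases "mon_code c") (auto simp del: mon_code_eq_iff)
      then obtain a d where "a \<in> F" "v = d + a"
        using less.hyps v(1) by blast
      then show ?thesis
        using v(2) by (metis add.assoc)
    qed
  qed
  moreover have "F \<subseteq> U" by (auto simp: F_def)
  ultimately show ?thesis by blast
qed

section \<open>Hilbert's basis theorem\<close>

lemma lookup_single_mult_add:
  fixes p :: "('n::finite) cpoly"
  shows "lookup (single d c * p) (d + b) = c * lookup p b"
proof -
  have "single d c * p =
      (\<Sum>a\<in>keys p. single (d + a) (c * lookup p a))"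
    by (subst (1) poly_mapping_sum_single[of p]) (simp add: sum_distrib_left mult_single)
  then have "lookup (single d c * p) (d + b) =
      (\<Sum>a\<in>keys p. if a = b then c * lookup p b else 0)"
    by (auto simp: lookup_sum lookup_single when_def intro!: sum.cong)
  then show ?thesis by (auto simp: in_keys_iff)
qed

lemma keys_single_mult:
  fixes p :: "('n::finite) cpoly"
  assumes "b \<in> keys (single d c * p)"
  shows "\<exists>a\<in>keys p. b = d + a"
  using assms keys_mult[of "single d c" p] by (auto split: if_splits)

lemma poly_ideal_0: "poly_ideal J \<Longrightarrow> 0 \<in> J"
  and poly_ideal_add: "poly_ideal J \<Longrightarrow> p \<in> J \<Longrightarrow> q \<in> J \<Longrightarrow> p + q \<in> J"
  and poly_ideal_mult: "poly_ideal J \<Longrightarrow> q \<in> J \<Longrightarrow> p * q \<in> J"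
  and poly_ideal_diff: "poly_ideal J \<Longrightarrow> p \<in> J \<Longrightarrow> q \<in> J \<Longrightarrow> p - q \<in> J"
  and poly_ideal_sum: "poly_ideal J \<Longrightarrow> (\<And>i. i \<in> S \<Longrightarrow> f i \<in> J) \<Longrightarrow> sum f S \<in> J"
  unfolding poly_ideal_def
  by (auto intro: ring_module.subspace_0 ring_module.subspace_add ring_module.subspace_scale
      ring_module.subspace_diff ring_module.subspace_sum)

lemma poly_idealI:
  assumes "0 \<in> J" "\<And>p q. p \<in> J \<Longrightarrow> q \<in> J \<Longrightarrow> p + q \<in> J" "\<And>p q. q \<in> J \<Longrightarrow> p * q \<in> J"
  shows "poly_ideal J"
  unfolding poly_ideal_def using assms by (intro ring_module.subspaceI) auto

text \<open>Dickson's lemma gives finitely many leading monomials, here those of greatest code.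
  Cancelling leading terms lowers the greatest code, so this division stops, in contrast to the
  later division by lowest terms.\<close>

lemma hilbert_basis:
  fixes J :: "('n::finite) cpoly set"
  assumes J: "poly_ideal J"
  shows "\<exists>G. finite G \<and> G \<subseteq> J \<and> ring_module.span G = J"
proof -
  define U where "U = {a. \<exists>p\<in>J. a \<in> keys p \<and> (\<forall>b\<in>keys p. mon_code b \<le> mon_code a)}"
  obtain F where F: "finite F" "F \<subseteq> U" "\<And>u. u \<in> U \<Longrightarrow> \<exists>a\<in>F. \<exists>c. u = c + a"
    using dickson[of U] by blast
  have "\<forall>a\<in>F. \<exists>p\<in>J. a \<in> keys p \<and> (\<forall>b\<in>keys p. mon_code b \<le> mon_code a)"
    using F(2) unfolding U_def by blast
  then obtain P where P: "\<And>a. a \<in> F \<Longrightarrow> P a \<in> J" "\<And>a. a \<in> F \<Longrightarrow> a \<in> keys (P a)"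
    "\<And>a b. a \<in> F \<Longrightarrow> b \<in> keys (P a) \<Longrightarrow> mon_code b \<le> mon_code a"
    by metis
  have sub: "ring_module.span (P ` F) \<subseteq> J"
    using P(1) J by (intro ring_module.span_minimal) (auto simp: poly_ideal_def)
  have span: "p \<in> ring_module.span (P ` F)" if "p \<in> J" "\<forall>b\<in>keys p. mon_code b < n" for p n
    using that
  proof (induction n arbitrary: p)
    case 0
    then have "keys p = {}" by blast
    then show ?case by (simp add: ring_module.span_zero)
  next
    case (Suc n)
    show ?case
    proof (cases "\<forall>b\<in>keys p. mon_code b < n")
      case True
      then show ?thesis using Suc by blast
    next
      case False
      then obtain a where a: "a \<in> keys p" "mon_code a = n"
        using Suc.prems(2) by (metis less_antisym)
      then have "a \<in> U"
        using Suc.prems unfolding U_def by (auto simp: less_Suc_eq_le)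
      then obtain c d where cd: "c \<in> F" "a = d + c" using F(3) by blast
      let ?k = "lookup p a / lookup (P c) c"
      let ?q = "single d ?k * P c"
      have "mon_code b < n" if b: "b \<in> keys (p - ?q)" for b
      proof -
        have "mon_code b \<le> n"
        proof (cases "b \<in> keys p")
          case True
          then show ?thesis using Suc.prems(2) by (simp add: less_Suc_eq_le)
        next
          case False
          then have "b \<in> keys ?q"
            using b by (simp add: in_keys_iff lookup_minus)
          then obtain e where "e \<in> keys (P c)" "b = d + e"
            using keys_single_mult by blast
          then show ?thesis
            using P(3)[OF cd(1)] a(2) cd(2) by (auto simp: mon_code_add)
        qed
        moreover have "lookup (p - ?q) a = 0"
          using P(2)[OF cd(1)] by (simp add: lookup_minus cd(2) lookup_single_mult_add in_keys_iff)
        then have "b \<noteq> a" using b by (auto simp: in_keys_iff)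
        then have "mon_code b \<noteq> n" using a(2) by auto
        ultimately show ?thesis by simp
      qed
      moreover have "p - ?q \<in> J"
        using J P(1) cd(1) Suc.prems(1) by (intro poly_ideal_diff poly_ideal_mult)
      ultimately have "p - ?q \<in> ring_module.span (P ` F)"
        using Suc.IH by blast
      moreover have "?q \<in> ring_module.span (P ` F)"
        using cd(1) by (intro ring_module.span_scale ring_module.span_base) auto
      ultimately show ?thesis
        using ring_module.span_add[of "p - ?q" _ ?q] by simp
    qed
  qed
  have "J \<subseteq> ring_module.span (P ` F)"
  proof
    fix p assume "p \<in> J"
    moreover have "\<forall>b\<in>keys p. mon_code b < Suc (\<Sum>b\<in>keys p. mon_code b)"
      by (simp add: less_Suc_eq_le member_le_sum)
    ultimately show "p \<in> ring_module.span (P ` F)" using span by blast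
  qed
  then show ?thesis
    using F(1) P(1) sub by (intro exI[of _ "P ` F"]) auto
qed

section \<open>A lemma of Artin-Rees type\<close>

lemma single_var_power: "single (single j n) 1 = var_poly j ^ n"
proof (induction n)
  case (Suc n)
  have "single j (Suc n) = single j 1 + single j n"
    by (simp flip: single_add)
  then show ?case
    by (simp add: mult_single flip: Suc) (simp add: var_poly_def mult_single)
qed simp

text \<open>
  An ideal \<open>L\<close> that is maximal with \<open>L \<inter> J = W\<close> contains a power of each variable, because the
  ideal quotients of \<open>L\<close> by the powers of a variable stabilise.
\<close>

lemma artin_rees:
  fixes J W :: "('n::finite) cpoly set"
  assumes J: "poly_ideal J" and W: "poly_ideal W" "W \<subseteq> J"
    and JW: "\<And>j q. q \<in> J \<Longrightarrow> var_poly j * q \<in> W"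
  shows "\<exists>k. \<forall>p\<in>J. (\<forall>a\<in>keys p. k \<le> mon_degree a) \<longrightarrow> p \<in> W"
proof -
  define A where "A = {L. poly_ideal L \<and> L \<inter> J = W}"
  have "A \<noteq> {}" using W by (auto simp: A_def)
  moreover have "\<Union>C \<in> A" if "C \<noteq> {}" "subset.chain A C" for C
  proof -
    have C: "\<And>L. L \<in> C \<Longrightarrow> poly_ideal L" "\<And>L. L \<in> C \<Longrightarrow> L \<inter> J = W"
      "\<And>L L'. L \<in> C \<Longrightarrow> L' \<in> C \<Longrightarrow> L \<subseteq> L' \<or> L' \<subseteq> L"
      using that(2) unfolding A_def subset_chain_def by blast+
    have "poly_ideal (\<Union>C)"
    proof (rule poly_idealI)
      show "0 \<in> \<Union>C" using that(1) C(1) poly_ideal_0 by blast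
    next
      fix p q assume "p \<in> \<Union>C" "q \<in> \<Union>C"
      then obtain L where "L \<in> C" "p \<in> L" "q \<in> L" using C(3) by blast
      then show "p + q \<in> \<Union>C" using C(1) poly_ideal_add by blast
    next
      fix p q assume "q \<in> \<Union>C"
      then show "p * q \<in> \<Union>C" using C(1) poly_ideal_mult by blast
    qed
    moreover have "\<Union>C \<inter> J = W" using that(1) C(2) by blast
    ultimately show ?thesis by (simp add: A_def)
  qed
  ultimately obtain L where L: "L \<in> A" "\<And>X. X \<in> A \<Longrightarrow> L \<subseteq> X \<Longrightarrow> X = L"
    using subset_Zorn_nonempty[of A] by blast
  then have Lid: "poly_ideal L" and LJ: "L \<inter> J = W" by (auto simp: A_def)
  have "\<exists>n. var_poly j ^ n \<in> L" for j
  proof -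
    define Q where "Q n = {p. var_poly j ^ n * p \<in> L}" for n
    have Qid: "poly_ideal (Q n)" for n
      unfolding Q_def
    proof (rule poly_idealI)
      fix p q assume "q \<in> {p. var_poly j ^ n * p \<in> L}"
      then show "p * q \<in> {p. var_poly j ^ n * p \<in> L}"
        using poly_ideal_mult[OF Lid, of "var_poly j ^ n * q" p] by (simp only: mem_Collect_eq mult.left_commute)
    qed (simp_all add: poly_ideal_0[OF Lid] distrib_left poly_ideal_add[OF Lid])
    have Qmono: "Q n \<subseteq> Q m" if "n \<le> m" for n m
    proof
      fix p assume "p \<in> Q n"
      then have "var_poly j ^ n * p \<in> L" by (simp add: Q_def)
      then have "var_poly j ^ (m - n) * (var_poly j ^ n * p) \<in> L"
        by (rule poly_ideal_mult[OF Lid])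
      also have "var_poly j ^ (m - n) * (var_poly j ^ n * p) = var_poly j ^ m * p"
        using that by (metis le_add_diff_inverse2 mult.assoc power_add)
      finally show "p \<in> Q m" by (simp add: Q_def)
    qed
    have "poly_ideal (\<Union>n. Q n)"
    proof (rule poly_idealI)
      show "0 \<in> (\<Union>n. Q n)" using Qid poly_ideal_0 by blast
    next
      fix p q assume "p \<in> (\<Union>n. Q n)" "q \<in> (\<Union>n. Q n)"
      then obtain n m where "p \<in> Q n" "q \<in> Q m" by blast
      then have "p \<in> Q (max n m)" "q \<in> Q (max n m)"
        using Qmono[of n "max n m"] Qmono[of m "max n m"] by auto
      then show "p + q \<in> (\<Union>n. Q n)" using Qid poly_ideal_add by blast
    next
      fix p q assume "q \<in> (\<Union>n. Q n)"
      then show "p * q \<in> (\<Union>n. Q n)" using Qid poly_ideal_mult by blast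
    qed
    \<comment> \<open>Finite generation of the union gives the ascending chain condition: all
      generators lie in one \<open>Q n\<close>.\<close>
    from hilbert_basis[OF this] obtain G
      where G: "finite G" "G \<subseteq> (\<Union>n. Q n)" "ring_module.span G = (\<Union>n. Q n)" by blast
    have "\<exists>n. G \<subseteq> Q n"
      using G(1,2)
    proof (induction G)
      case (insert g G)
      then obtain n m where "g \<in> Q n" "G \<subseteq> Q m" by blast
      then have "insert g G \<subseteq> Q (max n m)"
        using Qmono[of n "max n m"] Qmono[of m "max n m"] by auto
      then show ?case by blast
    qed auto
    then obtain n where "G \<subseteq> Q n" by blast
    then have Qn: "Q m \<subseteq> Q n" for m
      using ring_module.span_minimal[of G "Q n"] Qid[of n] G(3) by (auto simp: poly_ideal_def)
    \<comment> \<open>The ideal generated by \<open>L\<close> and \<open>var_poly j ^ n\<close>.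
      Maximality gives \<open>L' = L\<close> once \<open>L'\<close> is known to meet
      \<open>J\<close> in \<open>W\<close>.\<close>
    define L' where "L' = {l + var_poly j ^ n * r | l r. l \<in> L}"
    have LL': "L \<subseteq> L'"
    proof
      fix l assume "l \<in> L"
      then have "l + var_poly j ^ n * 0 \<in> L'" unfolding L'_def by blast
      then show "l \<in> L'" by simp
    qed
    have "poly_ideal L'"
    proof (rule poly_idealI)
      show "0 \<in> L'" using LL' poly_ideal_0[OF Lid] by blast
    next
      fix p q assume "p \<in> L'" "q \<in> L'"
      then obtain l r l' r' where "l \<in> L" "l' \<in> L" "p = l + var_poly j ^ n * r" "q = l' + var_poly j ^ n * r'"
        unfolding L'_def by blast
      then have "p + q = (l + l') + var_poly j ^ n * (r + r')" "l + l' \<in> L"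
        by (simp_all only: distrib_left add_ac poly_ideal_add[OF Lid])
      then show "p + q \<in> L'" unfolding L'_def by blast
    next
      fix p q assume "q \<in> L'"
      then obtain l r where "l \<in> L" "q = l + var_poly j ^ n * r"
        unfolding L'_def by blast
      then have "p * q = p * l + var_poly j ^ n * (p * r)" "p * l \<in> L"
        by (simp_all only: distrib_left mult.left_commute poly_ideal_mult[OF Lid])
      then show "p * q \<in> L'" unfolding L'_def by blast
    qed
    moreover have "L' \<inter> J = W"
    proof
      show "L' \<inter> J \<subseteq> W"
      proof
        fix y assume y: "y \<in> L' \<inter> J"
        then obtain l r where lr: "l \<in> L" "y = l + var_poly j ^ n * r"
          unfolding L'_def by blast
        \<comment> \<open>The variable moves \<open>y\<close> from \<open>J\<close> into
          \<open>W\<close>, hence into \<open>L\<close>. This raises the power in front of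
          \<open>r\<close> by one, and stability of \<open>Q\<close> lowers it again.\<close>
        have "var_poly j * y \<in> L" using JW y LJ by blast
        then have "var_poly j * y - var_poly j * l \<in> L"
          by (rule poly_ideal_diff[OF Lid _ poly_ideal_mult[OF Lid lr(1)]])
        moreover have "var_poly j * y - var_poly j * l = var_poly j ^ Suc n * r"
          unfolding lr(2) distrib_left power_Suc mult.assoc by (rule add_diff_cancel_left')
        ultimately have "r \<in> Q (Suc n)" unfolding Q_def by (metis mem_Collect_eq)
        then have "r \<in> Q n" using Qn by blast
        then have "y \<in> L" using lr by (simp add: Q_def poly_ideal_add[OF Lid])
        then show "y \<in> W" using y LJ by blast
      qed
      show "W \<subseteq> L' \<inter> J" using LL' LJ by blast
    qed
    ultimately have "L' = L" using L(2) LL' by (simp add: A_def)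
    moreover have "0 + var_poly j ^ n * 1 \<in> L'"
      unfolding L'_def using poly_ideal_0[OF Lid] by blast
    ultimately show ?thesis by auto
  qed
  then obtain n where n: "\<And>j. var_poly j ^ n j \<in> L" by metis
  \<comment> \<open>A monomial of degree above the sum of the \<open>n j\<close> has some exponent
    at least \<open>n j\<close> and so lies in \<open>L\<close>.\<close>
  have "p \<in> W" if p: "p \<in> J" "\<forall>a\<in>keys p. Suc (\<Sum>j\<in>UNIV. n j) \<le> mon_degree a" for p
  proof -
    have "single a c \<in> L" if a: "a \<in> keys p" for a c
    proof -
      have "\<exists>j. n j \<le> lookup a j"
      proof (rule ccontr)
        assume "\<not> ?thesis"
        then have "mon_degree a \<le> (\<Sum>j\<in>UNIV. n j)"
          unfolding mon_degree_def by (intro sum_mono) (simp add: not_le less_imp_le)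
        then show False using p(2) a by fastforce
      qed
      then obtain j where j: "n j \<le> lookup a j" ..
      have "a = (a - single j (n j)) + single j (n j)"
        using j by (intro poly_mapping_eqI) (auto simp: lookup_add lookup_minus lookup_single when_def)
      then have "single a c = single (a - single j (n j)) c * var_poly j ^ n j"
        by (metis mult.right_neutral mult_single single_var_power)
      then show ?thesis using poly_ideal_mult[OF Lid n] by simp
    qed
    then have "p \<in> L"
      by (subst poly_mapping_sum_single) (intro poly_ideal_sum[OF Lid])
    then show ?thesis using p(1) LJ by blast
  qed
  then show ?thesis by blast
qed

section \<open>Holomorphic functions of several variables\<close>

lemma holomorphic_several_on_subset:
  "holomorphic_several_on f S \<Longrightarrow> T \<subseteq> S \<Longrightarrow> holomorphic_several_on f T"
  unfolding holomorphic_several_on_def by blast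

lemma holomorphic_several_on_cong:
  assumes "holomorphic_several_on f S" "open S" "\<And>z. z \<in> S \<Longrightarrow> f z = g z"
  shows "holomorphic_several_on g S"
  unfolding holomorphic_several_on_def
proof
  fix z assume z: "z \<in> S"
  then obtain D where D: "(f has_derivative D) (at z)" "\<forall>c v. D (c *s v) = c * D v"
    using assms(1) unfolding holomorphic_several_on_def by blast
  have "(g has_derivative D) (at z)"
    by (rule has_derivative_transform_within_open[OF D(1) assms(2) z assms(3)])
  with D(2) show "\<exists>D. (g has_derivative D) (at z) \<and> (\<forall>c v. D (c *s v) = c * D v)" by blast
qed

lemma holomorphic_several_on_imp_continuous_on:
  "holomorphic_several_on f S \<Longrightarrow> continuous_on S f"
  unfolding holomorphic_several_on_def
  by (meson continuous_at_imp_continuous_on has_derivative_continuous)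

lemma holomorphic_several_const: "holomorphic_several_on (\<lambda>z. c) S"
  unfolding holomorphic_several_on_def by (auto intro!: exI[of _ "\<lambda>_. 0"])

lemma holomorphic_several_coord: "holomorphic_several_on (\<lambda>z. z $ j) S"
  unfolding holomorphic_several_on_def
  by (auto intro!: exI[of _ "\<lambda>v. v $ j"] bounded_linear_imp_has_derivative bounded_linear_vec_nth)

lemma holomorphic_several_add:
  assumes "holomorphic_several_on f S" "holomorphic_several_on g S"
  shows "holomorphic_several_on (\<lambda>z. f z + g z) S"
  unfolding holomorphic_several_on_def
proof
  fix z assume "z \<in> S"
  then obtain D E where "(f has_derivative D) (at z)" "\<forall>c v. D (c *s v) = c * D v"
    "(g has_derivative E) (at z)" "\<forall>c v. E (c *s v) = c * E v"
    using assms unfolding holomorphic_several_on_def by meson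
  then show "\<exists>D. ((\<lambda>z. f z + g z) has_derivative D) (at z) \<and> (\<forall>c v. D (c *s v) = c * D v)"
    by (intro exI[of _ "\<lambda>v. D v + E v"]) (auto intro: has_derivative_add simp: algebra_simps)
qed

lemma holomorphic_several_mult:
  assumes "holomorphic_several_on f S" "holomorphic_several_on g S"
  shows "holomorphic_several_on (\<lambda>z. f z * g z) S"
  unfolding holomorphic_several_on_def
proof
  fix z assume "z \<in> S"
  then obtain D E where "(f has_derivative D) (at z)" "\<forall>c v. D (c *s v) = c * D v"
    "(g has_derivative E) (at z)" "\<forall>c v. E (c *s v) = c * E v"
    using assms unfolding holomorphic_several_on_def by meson
  then show "\<exists>D. ((\<lambda>z. f z * g z) has_derivative D) (at z) \<and> (\<forall>c v. D (c *s v) = c * D v)"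
    by (intro exI[of _ "\<lambda>v. f z * E v + D v * g z"] conjI has_derivative_mult)
      (auto simp: algebra_simps)
qed

lemma holomorphic_several_inverse:
  assumes "holomorphic_several_on f S" "\<And>z. z \<in> S \<Longrightarrow> f z \<noteq> 0"
  shows "holomorphic_several_on (\<lambda>z. inverse (f z)) S"
  unfolding holomorphic_several_on_def
proof
  fix z assume z: "z \<in> S"
  then obtain D where "(f has_derivative D) (at z)" "\<forall>c v. D (c *s v) = c * D v"
    using assms unfolding holomorphic_several_on_def by meson
  then show "\<exists>D. ((\<lambda>z. inverse (f z)) has_derivative D) (at z) \<and> (\<forall>c v. D (c *s v) = c * D v)"
    using assms(2)[OF z]
    by (intro exI[of _ "\<lambda>v. - (inverse (f z) * D v * inverse (f z))"] conjI Deriv.has_derivative_inverse)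
      (auto simp: algebra_simps)
qed

lemma holomorphic_several_sum:
  "(\<And>i. i \<in> I \<Longrightarrow> holomorphic_several_on (f i) S) \<Longrightarrow> holomorphic_several_on (\<lambda>z. \<Sum>i\<in>I. f i z) S"
  by (induction I rule: infinite_finite_induct)
    (auto intro: holomorphic_several_const holomorphic_several_add)

lemma holomorphic_several_power:
  "holomorphic_several_on f S \<Longrightarrow> holomorphic_several_on (\<lambda>z. f z ^ k) S"
  by (induction k) (auto intro: holomorphic_several_const holomorphic_several_mult)

lemma holomorphic_several_prod:
  "(\<And>i. i \<in> I \<Longrightarrow> holomorphic_several_on (f i) S) \<Longrightarrow> holomorphic_several_on (\<lambda>z. \<Prod>i\<in>I. f i z) S"
  by (induction I rule: infinite_finite_induct)
    (auto intro: holomorphic_several_const holomorphic_several_mult)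

lemma holomorphic_several_poly: "holomorphic_several_on (poly_eval p) S"
  unfolding poly_eval_def
  by (intro holomorphic_several_sum holomorphic_several_mult holomorphic_several_const
      holomorphic_several_prod holomorphic_several_power holomorphic_several_coord)

lemma holomorphic_several_poly_translate: "holomorphic_several_on (\<lambda>z. poly_eval p (z - w)) S"
  using poly_compose_translate[of p "- w"] holomorphic_several_poly[of _ S]
  by (metis (no_types, lifting) diff_conv_add_uminus ext)

lemma holomorphic_several_translate:
  assumes "holomorphic_several_on g S"
  shows "holomorphic_several_on (\<lambda>z. g (z - w)) {z. z - w \<in> S}"
  unfolding holomorphic_several_on_def
proof
  fix z assume "z \<in> {z. z - w \<in> S}"
  then obtain D where D: "(g has_derivative D) (at (z - w))" "\<forall>c v. D (c *s v) = c * D v"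
    using assms unfolding holomorphic_several_on_def by blast
  have "((\<lambda>z. z - w) has_derivative (\<lambda>v. v)) (at z)"
    by (auto intro!: derivative_eq_intros)
  from has_derivative_compose[OF this D(1)] D(2)
  show "\<exists>D. ((\<lambda>z. g (z - w)) has_derivative D) (at z) \<and> (\<forall>c v. D (c *s v) = c * D v)" by blast
qed

section \<open>Restriction to complex lines and Cauchy estimates\<close>

lemma norm_vector_smult: "norm (c *s (v :: complex^'n)) = cmod c * norm v"
  by (simp add: norm_vec_def L2_set_def norm_mult power_mult_distrib real_sqrt_mult flip: sum_distrib_left)

lemma has_derivative_affine_line:
  "((\<lambda>t. u + t *s (v :: complex^'n)) has_derivative (\<lambda>t. t *s v)) (at t)"
proof -
  have "bounded_linear (\<lambda>t::complex. t *s v)"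
    by (rule bounded_linear_intro[of _ "norm v"])
      (simp_all add: vec_eq_iff algebra_simps norm_vector_smult)
  then show ?thesis
    by (auto intro!: derivative_eq_intros bounded_linear_imp_has_derivative)
qed

lemma holomorphic_several_line_deriv:
  fixes f :: "complex^'n \<Rightarrow> complex"
  assumes D: "(f has_derivative D) (at (u + t *s v))" "\<And>c v. D (c *s v) = c * D v"
  shows "((\<lambda>t. f (u + t *s v)) has_field_derivative D v) (at t)"
proof -
  have "((\<lambda>t. f (u + t *s v)) has_derivative (\<lambda>t. D (t *s v))) (at t)"
    by (rule has_derivative_compose[OF has_derivative_affine_line D(1)])
  then show ?thesis
    by (simp add: has_field_derivative_def D(2) mult_commute_abs)
qed

lemma holomorphic_several_line:
  assumes f: "holomorphic_several_on f S" and T: "\<And>t. t \<in> T \<Longrightarrow> u + t *s v \<in> S"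
  shows "(\<lambda>t. f (u + t *s v)) holomorphic_on T"
  unfolding holomorphic_on_def field_differentiable_def
proof
  fix t assume "t \<in> T"
  then obtain D where "(f has_derivative D) (at (u + t *s v))" "\<forall>c v. D (c *s v) = c * D v"
    using f T unfolding holomorphic_several_on_def by blast
  then show "\<exists>f'. ((\<lambda>t. f (u + t *s v)) has_field_derivative f') (at t within T)"
    using holomorphic_several_line_deriv has_field_derivative_at_within by blast
qed

text \<open>Cauchy's inequality on the complex line through \<open>z\<close> in direction
  \<open>v\<close>. It turns a bound on the terms of a series into one on their derivatives.\<close>

lemma holomorphic_several_deriv_bound:
  assumes f: "holomorphic_several_on f (ball z r)" and r: "0 < r"
    and B: "\<And>y. y \<in> ball z r \<Longrightarrow> cmod (f y) \<le> B"
    and D: "(f has_derivative D) (at z)" "\<And>c v. D (c *s v) = c * D v"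
  shows "cmod (D v) \<le> (2 * B / r) * norm v"
proof (cases "v = 0")
  case True
  then show ?thesis using D(2)[of 0 0] by simp
next
  case False
  \<comment> \<open>Half the admissible radius keeps the closed disc inside the open ball; this is
    the factor 2 of the bound.\<close>
  define R where "R = r / (2 * norm v)"
  have R: "0 < R" using r False by (simp add: R_def)
  have in_ball: "z + t *s v \<in> ball z r" if "t \<in> cball 0 R" for t
  proof -
    have "cmod t * norm v \<le> R * norm v"
      using that by (intro mult_right_mono) auto
    also have "\<dots> < r" using r False by (simp add: R_def)
    finally show ?thesis by (simp add: dist_norm norm_vector_smult)
  qed
  have hol: "(\<lambda>t. f (z + t *s v)) holomorphic_on cball 0 R"
    using in_ball by (rule holomorphic_several_line[OF f])
  have "((\<lambda>t. f (z + t *s v)) has_field_derivative D v) (at 0)"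
    using D by (intro holomorphic_several_line_deriv) auto
  then have "deriv (\<lambda>t. f (z + t *s v)) 0 = D v"
    by (rule DERIV_imp_deriv)
  moreover have "norm ((deriv ^^ 1) (\<lambda>t. f (z + t *s v)) 0) \<le> fact 1 * B / R ^ 1"
  proof (rule Cauchy_inequality[OF _ _ R])
    show "(\<lambda>t. f (z + t *s v)) holomorphic_on ball 0 R"
      using hol ball_subset_cball holomorphic_on_subset by blast
    show "continuous_on (cball 0 R) (\<lambda>t. f (z + t *s v))"
      using hol by (rule holomorphic_on_imp_continuous_on)
  next
    fix t :: complex assume "norm (0 - t) = R"
    then show "cmod (f (z + t *s v)) \<le> B" by (intro B in_ball) simp
  qed
  ultimately show ?thesis by (simp add: R_def mult_ac)
qed

text \<open>Weierstrass' theorem under an M-test. The derivatives have the summable majorant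
  \<open>2 * M k / r\<close>, so termwise differentiation applies, and complex linearity passes to
  the sum.\<close>

lemma holomorphic_several_suminf:
  fixes F :: "nat \<Rightarrow> complex^'n::finite \<Rightarrow> complex"
  assumes S: "open S" and F: "\<And>k. holomorphic_several_on (F k) S"
    and M: "summable M" "\<And>k z. z \<in> S \<Longrightarrow> cmod (F k z) \<le> M k"
  shows "holomorphic_several_on (\<lambda>z. suminf (\<lambda>k. F k z)) S"
proof -
  have summ: "summable (\<lambda>k. F k z)" if "z \<in> S" for z
    using M that by (meson summable_comparison_test)
  have "\<exists>D. \<forall>k. \<forall>z\<in>S. (F k has_derivative D k z) (at z) \<and> (\<forall>c v. D k z (c *s v) = c * D k z v)"
    using F unfolding holomorphic_several_on_def by metis
  then obtain D where D: "\<And>k z. z \<in> S \<Longrightarrow> (F k has_derivative D k z) (at z)"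
    "\<And>k z c v. z \<in> S \<Longrightarrow> D k z (c *s v) = c * D k z v" by metis
  show ?thesis
    unfolding holomorphic_several_on_def
  proof
    fix z0 assume z0: "z0 \<in> S"
    \<comment> \<open>With radius \<open>2 * r\<close> around \<open>z0\<close>, every point of
      \<open>ball z0 r\<close> has a ball of the fixed radius \<open>r\<close> inside
      \<open>S\<close>, which makes the derivative bounds uniform.\<close>
    then obtain r where r: "0 < r" "ball z0 (2 * r) \<subseteq> S"
    proof -
      obtain e where "0 < e" "ball z0 e \<subseteq> S" using S z0 open_contains_ball by blast
      then show ?thesis using that[of "e / 2"] by simp
    qed
    have sub: "ball z r \<subseteq> S" if "z \<in> ball z0 r" for z
    proof -
      have "ball z r \<subseteq> ball z0 (2 * r)"
      proof
        fix y assume "y \<in> ball z r"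
        then show "y \<in> ball z0 (2 * r)"
          using that dist_triangle[of z0 y z] by simp
      qed
      then show ?thesis using r(2) by blast
    qed
    have Dbound: "cmod (D k z v) \<le> (2 * M k / r) * norm v" if "z \<in> ball z0 r" for k z v
    proof -
      have "z \<in> S" using subsetD[OF sub[OF that], of z] r(1) by simp
      then show ?thesis
        using sub[OF that] M(2) D r(1)
        by (intro holomorphic_several_deriv_bound[where f = "F k" and z = z] holomorphic_several_on_subset[OF F]) auto
    qed
    have summM: "summable (\<lambda>k. 2 * M k / r)"
      using M(1) by (intro summable_divide summable_mult)
    have summD: "summable (\<lambda>k. D k z v)" if "z \<in> ball z0 r" for z v
      by (rule summable_comparison_test'[OF summable_mult2[OF summM, of "norm v"]]) (rule Dbound[OF that])
    define G where "G z v = suminf (\<lambda>k. D k z v)" for z v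
    have z0b: "z0 \<in> ball z0 r" using r(1) by simp
    have "\<exists>g. \<forall>z\<in>ball z0 r. (\<lambda>k. F k z) sums g z \<and> (g has_derivative G z) (at z within ball z0 r)"
    proof (rule has_derivative_series)
      show "convex (ball z0 r)" by simp
      show "(F n has_derivative D n z) (at z within ball z0 r)" if "z \<in> ball z0 r" for n z
        using D(1) sub[OF that] r(1) by (meson centre_in_ball has_derivative_at_withinI subsetD)
      show "(\<lambda>k. F k z0) sums suminf (\<lambda>k. F k z0)" using summ z0 by (simp add: summable_sums)
    next
      fix e :: real assume e: "0 < e"
      have "\<forall>\<^sub>F n in sequentially. norm (suminf (\<lambda>k. 2 * M (k + n) / r)) < e"
        using suminf_exist_split[OF e summM] unfolding eventually_sequentially by auto
      then show "\<forall>\<^sub>F n in sequentially. \<forall>z\<in>ball z0 r. \<forall>h. norm ((\<Sum>i<n. D i z h) - G z h) \<le> e * norm h"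
      proof eventually_elim
        case (elim n)
        show ?case
        proof (intro ballI allI)
          fix z h assume z: "z \<in> ball z0 r"
          have "G z h = suminf (\<lambda>k. D (k + n) z h) + (\<Sum>i<n. D i z h)"
            unfolding G_def by (rule suminf_split_initial_segment[OF summD[OF z]])
          then have "norm ((\<Sum>i<n. D i z h) - G z h) = norm (suminf (\<lambda>k. D (k + n) z h))"
            by (simp add: norm_minus_commute)
          also have "\<dots> \<le> suminf (\<lambda>k. 2 * M (k + n) / r * norm h)"
          proof (rule norm_suminf_le[OF Dbound[OF z]])
            show "summable (\<lambda>k. 2 * M (k + n) / r * norm h)"
              using summable_ignore_initial_segment[OF summM, of n] by (rule summable_mult2)
          qed
          also have "\<dots> = suminf (\<lambda>k. 2 * M (k + n) / r) * norm h"
            using summable_ignore_initial_segment[OF summM, of n] by (rule suminf_mult2[symmetric])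
          also have "\<dots> \<le> e * norm h"
            using elim by (intro mult_right_mono) auto
          finally show "norm ((\<Sum>i<n. D i z h) - G z h) \<le> e * norm h" .
        qed
      qed
    qed (use z0b in auto)
    then obtain g where g: "\<And>z. z \<in> ball z0 r \<Longrightarrow> (\<lambda>k. F k z) sums g z"
      "\<And>z. z \<in> ball z0 r \<Longrightarrow> (g has_derivative G z) (at z within ball z0 r)" by blast
    have "(g has_derivative G z0) (at z0)"
      using g(2)[OF z0b] z0b by (simp add: at_within_open[of z0 "ball z0 r"])
    then have "((\<lambda>z. suminf (\<lambda>k. F k z)) has_derivative G z0) (at z0)"
      by (rule has_derivative_transform_within_open[OF _ open_ball z0b]) (use g(1) sums_unique in blast)
    moreover have "G z0 (c *s v) = c * G z0 v" for c v
      unfolding G_def using D(2)[OF z0] by (simp add: suminf_mult[OF summD[OF z0b]])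
    ultimately show "\<exists>D. ((\<lambda>z. suminf (\<lambda>k. F k z)) has_derivative D) (at z0) \<and> (\<forall>c v. D (c *s v) = c * D v)"
      by blast
  qed
qed

section \<open>Taylor polynomials\<close>

text \<open>Lagrange interpolation at the nodes \<open>0, ..., d\<close> is exact, because
  polynomials of degree at most \<open>d\<close> that agree at \<open>d + 1\<close> points are
  equal.\<close>

lemma ex_lagrange_basis:
  "\<exists>L :: nat \<Rightarrow> complex poly. \<forall>k\<le>d. \<forall>s. s ^ k = (\<Sum>m\<le>d. of_nat m ^ k * poly (L m) s)"
proof -
  define L :: "nat \<Rightarrow> complex poly" where
    "L m = smult (inverse (\<Prod>i\<in>{..d} - {m}. of_nat m - of_nat i)) (\<Prod>i\<in>{..d} - {m}. [:- of_nat i, 1:])" for m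
  have Lm: "poly (L m) (of_nat i) = (if i = m then 1 else 0)" if "m \<le> d" "i \<le> d" for m i
    using that by (auto simp: L_def poly_prod)
  have deg: "degree (L m) \<le> d" if "m \<le> d" for m
  proof -
    have "degree (L m) \<le> degree (\<Prod>i\<in>{..d} - {m}. [:- of_nat i, 1:] :: complex poly)"
      unfolding L_def by (rule degree_smult_le)
    also have "\<dots> \<le> (\<Sum>i\<in>{..d} - {m}. 1)"
      by (rule order_trans[OF degree_prod_sum_le]) (auto intro: sum_mono)
    also have "\<dots> = d" using that by simp
    finally show ?thesis .
  qed
  have "s ^ k = (\<Sum>m\<le>d. of_nat m ^ k * poly (L m) s)" if k: "k \<le> d" for k s
  proof -
    have "monom 1 k = (\<Sum>m\<le>d. smult (of_nat m ^ k) (L m))"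
    proof (rule poly_eqI_degree[of "of_nat ` {..d}"])
      fix x :: complex assume "x \<in> of_nat ` {..d}"
      then obtain i where i: "x = of_nat i" "i \<le> d" by auto
      have "(\<Sum>m\<le>d. of_nat m ^ k * poly (L m) x) = (\<Sum>m\<le>d. if m = i then x ^ k else 0)"
        using i Lm by (intro sum.cong) auto
      then show "poly (monom 1 k) x = poly (\<Sum>m\<le>d. smult (of_nat m ^ k) (L m)) x"
        using i by (simp add: poly_sum poly_monom)
    next
      have "card (of_nat ` {..d} :: complex set) = Suc d"
        by (subst card_image) (auto simp: inj_on_def)
      moreover have "degree (\<Sum>m\<le>d. smult (of_nat m ^ k) (L m)) \<le> d"
        by (intro degree_sum_le) (auto intro: order_trans[OF degree_smult_le] deg)
      ultimately show "degree (monom 1 k :: complex poly) < card (of_nat ` {..d} :: complex set)"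
        "degree (\<Sum>m\<le>d. smult (of_nat m ^ k) (L m)) < card (of_nat ` {..d} :: complex set)"
        using k by (auto simp: degree_monom_eq)
    qed
    then have "poly (monom 1 k) s = poly (\<Sum>m\<le>d. smult (of_nat m ^ k) (L m)) s" by simp
    then show ?thesis by (simp add: poly_sum poly_monom)
  qed
  then show ?thesis by blast
qed

section \<open>Separately polynomial functions\<close>

definition vec_update :: "complex^'n \<Rightarrow> 'n \<Rightarrow> complex \<Rightarrow> complex^('n::finite)" where
  "vec_update v j s = (\<chi> i. if i = j then s else v $ i)"

lemma vec_update_twice [simp]: "vec_update (vec_update v j s) j t = vec_update v j t"
  and vec_update_same [simp]: "vec_update v j (v $ j) = v"
  and vec_update_commute: "i \<noteq> j \<Longrightarrow> vec_update (vec_update v i s) j t = vec_update (vec_update v j t) i s"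
  by (auto simp: vec_update_def vec_eq_iff)

lemma ex_poly_of_var: "\<exists>q. \<forall>v. poly_eval q v = poly P (v $ j)"
proof -
  have "poly_eval (\<Sum>i\<le>degree P. const_poly (poly.coeff P i) * var_poly j ^ i) v = poly P (v $ j)" for v
    by (simp add: poly_altdef)
  then show ?thesis by blast
qed

text \<open>Interpolate in one variable at a time.\<close>

lemma separately_polynomial_imp_polynomial:
  fixes g :: "complex^'n::finite \<Rightarrow> complex"
  assumes "\<And>j u. \<exists>a. \<forall>s. g (vec_update u j s) = (\<Sum>k\<le>d. a k * s ^ k)"
  shows "\<exists>q. \<forall>v. g v = poly_eval q v"
proof -
  obtain L :: "nat \<Rightarrow> complex poly" where L: "\<And>k s. k \<le> d \<Longrightarrow> s ^ k = (\<Sum>m\<le>d. of_nat m ^ k * poly (L m) s)"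
    using ex_lagrange_basis[of d] by blast
  \<comment> \<open>Induction on the set \<open>T\<close> of variables on which \<open>g\<close> may
    depend; \<open>g\<close> is arbitrary because the step passes to slices.\<close>
  have "\<exists>q. \<forall>v. g v = poly_eval q v"
    if "finite T" "\<And>j u. \<exists>a. \<forall>s. g (vec_update u j s) = (\<Sum>k\<le>d. a k * s ^ k)"
      "\<And>u j s. j \<notin> T \<Longrightarrow> g (vec_update u j s) = g u" for T and g :: "complex^'n \<Rightarrow> complex"
    using that
  proof (induction T arbitrary: g)
    case empty
    have *: "g (\<chi> i. if i \<in> S then u $ i else v $ i) = g v" if "finite S" for S u v
      using that
    proof (induction S)
      case (insert j S)
      have "(\<chi> i. if i \<in> insert j S then u $ i else v $ i) =
          vec_update (\<chi> i. if i \<in> S then u $ i else v $ i) j (u $ j)"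
        by (auto simp: vec_update_def vec_eq_iff)
      then show ?case using insert empty(2) by simp
    qed simp
    have "g v = poly_eval (const_poly (g 0)) v" for v
      using *[of UNIV v 0] by simp
    then show ?case by blast
  next
    case (insert j T)
    define h where "h m v = g (vec_update v j (of_nat m))" for m v
    \<comment> \<open>The slice at the node \<open>m\<close> no longer depends on the variable
      \<open>j\<close>, so the induction hypothesis applies; interpolation in \<open>v $ j\<close>
      then recovers \<open>g\<close> from finitely many slices.\<close>
    have "\<exists>q. \<forall>v. h m v = poly_eval q v" for m
    proof (rule insert.IH)
      fix i u
      show "\<exists>a. \<forall>s. h m (vec_update u i s) = (\<Sum>k\<le>d. a k * s ^ k)"
      proof (cases "i = j")
        case True
        have "(\<Sum>k\<le>d. (if k = 0 then g (vec_update u j (of_nat m)) else 0) * s ^ k) = g (vec_update u j (of_nat m))" for s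
          by (subst sum.remove[of _ 0]) auto
        then show ?thesis unfolding h_def using True by (metis vec_update_twice)
      next
        case False
        show ?thesis
          unfolding h_def vec_update_commute[OF False] by (rule insert.prems(1))
      qed
    next
      fix u i s assume i: "i \<notin> T"
      show "h m (vec_update u i s) = h m u"
      proof (cases "i = j")
        case False
        show ?thesis
          using i False insert.prems(2)[of i] unfolding h_def vec_update_commute[OF False] by simp
      qed (simp add: h_def)
    qed
    then obtain q where q: "\<And>m v. h m v = poly_eval (q m) v" by metis
    obtain l where l: "\<And>m v. poly_eval (l m) v = poly (L m) (v $ j)"
      using ex_poly_of_var[of "L _" j] by metis
    have "g v = poly_eval (\<Sum>m\<le>d. q m * l m) v" for v
    proof -
      obtain a where a: "\<And>s. g (vec_update v j s) = (\<Sum>k\<le>d. a k * s ^ k)"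
        using insert.prems(1) by blast
      have "g v = (\<Sum>k\<le>d. a k * (v $ j) ^ k)"
        using a[of "v $ j"] by simp
      also have "\<dots> = (\<Sum>k\<le>d. \<Sum>m\<le>d. a k * of_nat m ^ k * poly (L m) (v $ j))"
      proof (rule sum.cong[OF refl])
        fix k assume "k \<in> {..d}"
        then have "k \<le> d" by simp
        from L[OF this, of "v $ j"]
        show "a k * (v $ j) ^ k = (\<Sum>m\<le>d. a k * of_nat m ^ k * poly (L m) (v $ j))"
          by (simp only: sum_distrib_left mult.assoc)
      qed
      also have "\<dots> = (\<Sum>m\<le>d. h m v * poly (L m) (v $ j))"
        unfolding h_def a by (subst sum.swap) (simp add: sum_distrib_right)
      finally show ?thesis by (simp add: q l)
    qed
    then show ?case by blast
  qed
  from this[of UNIV g] show ?thesis using assms by simp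
qed

text \<open>
  The part of degree \<open>d\<close> is a polynomial because it is a uniform limit of difference quotients, so it
  is holomorphic on complex lines near 0, by homogeneity it is entire on complex lines, and
  Liouville's theorem applies.
\<close>

lemma homogeneous_parts:
  fixes f :: "complex^'n::finite \<Rightarrow> complex"
  assumes f: "holomorphic_several_on f S" and S: "cball w R \<subseteq> S" and R: "0 < R"
    and B: "\<And>z. z \<in> cball w R \<Longrightarrow> cmod (f z) \<le> B"
  shows "\<exists>c. (\<forall>d. \<exists>q. \<forall>v. c d v = poly_eval q v) \<and> (\<forall>d v. cmod (c d v) \<le> B * (norm v / R) ^ d) \<and>
    (\<forall>v. norm v < R \<longrightarrow> (\<lambda>d. c d v) sums f (w + v))"
proof -
  define g where "g v t = f (w + t *s v)" for v t
  \<comment> \<open>The Taylor coefficient of order \<open>d\<close> along the line through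
    \<open>w\<close> in direction \<open>v\<close>. It makes sense for every \<open>v\<close>, since
    only small \<open>t\<close> matter.\<close>
  define c where "c d v = (deriv ^^ d) (g v) 0 / fact d" for d v
  have B0: "0 \<le> B" using B[of w] R by (auto intro: order_trans[OF norm_ge_zero])
  have in_cball: "w + t *s v \<in> cball w R" if "cmod t * norm v \<le> R" for t v
    using that by (simp add: dist_norm norm_vector_smult)
  have g_hol: "g v holomorphic_on T" if "\<And>t. t \<in> T \<Longrightarrow> cmod t * norm v \<le> R" for v T
    unfolding g_def using in_cball[OF that] S by (intro holomorphic_several_line[OF f]) auto
  have c_bound: "cmod (c d v) \<le> B * (norm v / R) ^ d" for d v
  proof (cases "v = 0")
    case True
    have "g 0 = (\<lambda>t. f w)" by (auto simp: g_def)
    then have "c d 0 = (if d = 0 then f w else 0)" by (simp add: c_def higher_deriv_const)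
    then show ?thesis using True B[of w] R by (cases d) auto
  next
    case False
    define r where "r = R / norm v"
    have r: "0 < r" "\<And>t. cmod t \<le> r \<Longrightarrow> cmod t * norm v \<le> R"
      using R False by (simp_all add: r_def pos_le_divide_eq)
    have "norm ((deriv ^^ d) (g v) 0) \<le> fact d * B / r ^ d"
    proof (rule Cauchy_inequality[OF _ _ r(1)])
      show "g v holomorphic_on ball 0 r" by (rule g_hol) (use r in auto)
      show "continuous_on (cball 0 r) (g v)"
        by (rule holomorphic_on_imp_continuous_on, rule g_hol) (use r in auto)
      fix t :: complex assume "norm (0 - t) = r"
      then show "cmod (g v t) \<le> B" unfolding g_def by (intro B in_cball r(2)) auto
    qed
    then have "cmod ((deriv ^^ d) (g v) 0) / fact d \<le> (fact d * B / r ^ d) / fact d"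
      by (rule divide_right_mono) simp
    then have "cmod (c d v) \<le> (fact d * B / r ^ d) / fact d"
      by (simp add: c_def norm_divide)
    also have "\<dots> = B * (norm v / R) ^ d"
      using False R by (simp add: r_def power_divide)
    finally show ?thesis .
  qed
  have c_sums: "(\<lambda>d. c d v * t ^ d) sums g v t" if "cmod t * norm v < R" for v t
  proof -
    define r where "r = (if v = 0 then cmod t + 1 else R / norm v)"
    have "cmod t < r" using that by (auto simp: r_def pos_less_divide_eq)
    moreover have "g v holomorphic_on ball 0 r"
    proof (rule g_hol)
      fix t :: complex assume "t \<in> ball 0 r"
      then show "cmod t * norm v \<le> R"
        using R by (cases "v = 0") (auto simp: r_def pos_less_divide_eq)
    qed
    ultimately show ?thesis
      using holomorphic_power_series[of "g v" 0 r t] by (simp add: c_def)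
  qed
  have c_hom: "c d (l *s v) = l ^ d * c d v" for d l v
  proof -
    define r where "r = R / (norm v + 1)"
    define r' where "r' = r / (cmod l + 1)"
    have pos: "0 < norm v + 1" "0 < cmod l + 1" by (simp_all add: add_nonneg_pos)
    have r: "0 < r" "0 < r'" using R pos by (simp_all add: r_def r'_def)
    have rv: "cmod t * norm v \<le> R" if "cmod t < r" for t
    proof -
      have "cmod t * norm v \<le> r * (norm v + 1)"
        using that r by (intro mult_mono) auto
      then show ?thesis using pos by (simp add: r_def)
    qed
    have "g (l *s v) = (\<lambda>t. g v (l * t))"
      by (auto simp: g_def mult.commute)
    then have "(deriv ^^ d) (g (l *s v)) 0 = l ^ d * (deriv ^^ d) (g v) (l * 0)"
    proof (simp only:, intro higher_deriv_compose_linear[where S = "ball 0 r'" and T = "ball 0 r"])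
      show "g v holomorphic_on ball 0 r" by (rule g_hol) (use rv in auto)
      fix t :: complex assume t: "t \<in> ball 0 r'"
      have "cmod (l * t) \<le> cmod l * r'"
        using t by (simp add: norm_mult mult_left_mono)
      also have "\<dots> < (cmod l + 1) * r'" using r by simp
      also have "\<dots> = r" using pos by (simp add: r'_def)
      finally show "l * t \<in> ball 0 r" by simp
    qed (use r in auto)
    then show ?thesis by (simp add: c_def)
  qed
  have c_poly: "\<exists>q. \<forall>v. c d v = poly_eval q v" for d
  proof (induction d rule: less_induct)
    case (less d)
    then obtain q where q: "\<And>e v. e < d \<Longrightarrow> c e v = poly_eval (q e) v" by metis
    \<comment> \<open>What remains after subtraction and division is \<open>c d v\<close> plus an
      error of order \<open>t\<close>. The lower parts are polynomials by induction, so
      \<open>Q t\<close> is holomorphic on lines near 0.\<close>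
    define Q where "Q t v = (f (w + t *s v) - (\<Sum>e<d. c e v * t ^ e)) / t ^ d" for t v
    have Q_approx: "cmod (Q t v - c d v) \<le> 2 * B * cmod t"
      if t: "t \<noteq> 0" "cmod t \<le> 1/2" and v: "norm v < R" for t v
    proof -
      have small: "cmod t * norm v < R"
        using t(2) v mult_right_mono[of "cmod t" 1 "norm v"] by simp
      have "(\<lambda>e. c (e + d) v * t ^ (e + d)) sums (g v t - (\<Sum>e<d. c e v * t ^ e))"
        using sums_split_initial_segment[OF c_sums[OF small], of d] .
      then have "(\<lambda>e. c (e + d) v * t ^ (e + d) / t ^ d) sums Q t v"
        unfolding Q_def g_def[symmetric] by (rule sums_divide)
      then have "(\<lambda>e. c (e + d) v * t ^ e) sums Q t v"
        using t(1) by (simp add: power_add)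
      from sums_split_initial_segment[OF this, of 1]
      have s: "(\<lambda>e. c (Suc e + d) v * t ^ Suc e) sums (Q t v - c d v)" by simp
      have bnd: "cmod (c (Suc e + d) v * t ^ Suc e) \<le> B * cmod t * (1/2) ^ e" for e
      proof -
        have "norm v / R \<le> 1" using v R by simp
        then have "(norm v / R) ^ (Suc e + d) \<le> 1"
          using R by (intro power_le_one) auto
        then have "cmod (c (Suc e + d) v) \<le> B"
          using c_bound[of "Suc e + d" v] B0 mult_left_mono[of "(norm v / R) ^ (Suc e + d)" 1 B] by simp
        moreover have "cmod t ^ e \<le> (1/2) ^ e" using t(2) by (intro power_mono) auto
        ultimately have "cmod (c (Suc e + d) v) * (cmod t * cmod t ^ e) \<le> B * (cmod t * (1/2) ^ e)"
          using B0 by (intro mult_mono) auto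
        then show ?thesis by (simp only: norm_mult norm_power power_Suc mult.assoc)
      qed
      have geo: "(\<lambda>e. B * cmod t * (1/2) ^ e) sums (B * cmod t * 2)"
        using geometric_sums[of "1/2 :: real"] by (intro sums_mult) simp
      have "cmod (Q t v - c d v) \<le> B * cmod t * 2"
        using norm_suminf_le[OF bnd sums_summable[OF geo]]
        unfolding sums_unique[OF s, symmetric] sums_unique[OF geo, symmetric] .
      then show ?thesis by (simp only: mult_ac)
    qed
    have hol_line_near: "(\<lambda>s. c d (u + s *s v)) holomorphic_on {s. norm (u + s *s v) < R}" for u v
    proof (rule holomorphic_uniform_sequence)
      let ?T = "{s. norm (u + s *s v) < R}"
      have "continuous_on UNIV (\<lambda>s. u + s *s v)"
        by (rule has_derivative_continuous_on[OF has_derivative_at_withinI[OF has_derivative_affine_line]])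
      then show T: "open ?T"
        by (intro open_Collect_less continuous_on_norm continuous_on_const)
      define t where "t n = complex_of_real (1 / (real n + 2))" for n
      have tn: "t n \<noteq> 0" "cmod (t n) \<le> 1/2" "cmod (t n) = 1 / (real n + 2)" for n
      proof -
        show 3: "cmod (t n) = 1 / (real n + 2)" by (simp only: t_def norm_of_real) simp
        show "cmod (t n) \<le> 1/2" unfolding 3 by (simp add: field_simps)
        have "(0::real) < 1 / (real n + 2)" by simp
        then show "t n \<noteq> 0" unfolding t_def by (metis less_irrefl of_real_eq_0_iff)
      qed
      show "(\<lambda>s. Q (t n) (u + s *s v)) holomorphic_on ?T" for n
      proof -
        have "(\<lambda>s. f ((w + t n *s u) + s *s (t n *s v))) holomorphic_on ?T"
        proof (rule holomorphic_several_line[OF f])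
          fix s assume "s \<in> ?T"
          then have "cmod (t n) * norm (u + s *s v) \<le> 1 * R"
            using tn(2)[of n] by (intro mult_mono) auto
          then have "cmod (t n) * norm (u + s *s v) \<le> R" by simp
          from subsetD[OF S in_cball[OF this]] have "w + t n *s (u + s *s v) \<in> S" .
          then show "(w + t n *s u) + s *s (t n *s v) \<in> S"
            by (simp add: vector_add_ldistrib add.assoc mult.commute)
        qed
        moreover have "(\<lambda>s. f ((w + t n *s u) + s *s (t n *s v))) = (\<lambda>s. f (w + t n *s (u + s *s v)))"
          by (simp add: vector_add_ldistrib add.assoc mult.commute)
        moreover have "(\<lambda>s. c e (u + s *s v)) holomorphic_on ?T" if "e < d" for e
          unfolding q[OF that] by (rule holomorphic_several_line[OF holomorphic_several_poly[of _ UNIV]]) simp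
        ultimately show ?thesis
          unfolding Q_def using tn(1)[of n] by (auto intro!: holomorphic_intros)
      qed
      fix s0 assume "s0 \<in> ?T"
      then obtain e where e: "0 < e" "cball s0 e \<subseteq> ?T"
        using T open_contains_cball by blast
      have "uniform_limit (cball s0 e) (\<lambda>n s. Q (t n) (u + s *s v)) (\<lambda>s. c d (u + s *s v)) sequentially"
      proof (rule uniform_limitI)
        fix \<epsilon> :: real assume \<epsilon>: "0 < \<epsilon>"
        have "(\<lambda>n. 2 * B * (1 / (real n + 2))) \<longlonglongrightarrow> 0" by real_asymp
        then have "\<forall>\<^sub>F n in sequentially. 2 * B * (1 / (real n + 2)) < \<epsilon>"
          using \<epsilon> order_tendstoD(2) by blast
        then show "\<forall>\<^sub>F n in sequentially. \<forall>s\<in>cball s0 e. dist (Q (t n) (u + s *s v)) (c d (u + s *s v)) < \<epsilon>"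
        proof eventually_elim
          case (elim n)
          show ?case
          proof
            fix s assume "s \<in> cball s0 e"
            then have "norm (u + s *s v) < R" using e(2) by blast
            then have "cmod (Q (t n) (u + s *s v) - c d (u + s *s v)) \<le> 2 * B * cmod (t n)"
              by (rule Q_approx[OF tn(1) tn(2)])
            then show "dist (Q (t n) (u + s *s v)) (c d (u + s *s v)) < \<epsilon>"
              using elim unfolding dist_norm tn(3) by linarith
          qed
        qed
      qed
      with e show "\<exists>e>0. cball s0 e \<subseteq> ?T \<and>
          uniform_limit (cball s0 e) (\<lambda>n s. Q (t n) (u + s *s v)) (\<lambda>s. c d (u + s *s v)) sequentially"
        by blast
    qed
    have entire: "(\<lambda>s. c d (u + s *s v)) holomorphic_on UNIV" for u v
    proof (rule analytic_imp_holomorphic)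
      show "(\<lambda>s. c d (u + s *s v)) analytic_on UNIV"
        unfolding analytic_on_def
      proof
        fix s0 :: complex
        \<comment> \<open>Scaling by \<open>l\<close> brings the unit disc of the line around
          \<open>s0\<close> into the ball of radius \<open>R\<close>; homogeneity undoes the scaling
          at the cost of a factor \<open>l ^ d\<close>.\<close>
        define l where "l = R / (norm (u + s0 *s v) + norm v + 1)"
        have pos: "0 < norm (u + s0 *s v) + norm v + 1" by (simp add: add_nonneg_pos)
        then have l: "0 < l" using R by (simp add: l_def)
        let ?l = "complex_of_real l"
        have "(\<lambda>s. c d (?l *s u + s *s (?l *s v))) holomorphic_on ball s0 1"
        proof (rule holomorphic_on_subset[OF hol_line_near], safe)
          fix s assume "s \<in> ball s0 1"
          then have "cmod (s - s0) * norm v \<le> 1 * norm v"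
            by (intro mult_right_mono) (auto simp: dist_norm norm_minus_commute)
          moreover have eq: "(u + s0 *s v) + (s - s0) *s v = u + s *s v"
            by (simp add: vec_eq_iff algebra_simps)
          ultimately have "norm (u + s *s v) \<le> norm (u + s0 *s v) + norm v"
            using norm_triangle_ineq[of "u + s0 *s v" "(s - s0) *s v"]
            unfolding eq norm_vector_smult by linarith
          then have "l * norm (u + s *s v) < l * (norm (u + s0 *s v) + norm v + 1)"
            using l by simp
          also have "\<dots> = R" using pos by (simp add: l_def)
          finally have "norm (?l *s (u + s *s v)) < R"
            using l unfolding norm_vector_smult by simp
          moreover have "?l *s u + s *s (?l *s v) = ?l *s (u + s *s v)"
            by (simp add: vec_eq_iff algebra_simps)
          ultimately show "norm (?l *s u + s *s (?l *s v)) < R" by (simp only:)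
        qed
        then have "(\<lambda>s. inverse (?l ^ d) * c d (?l *s u + s *s (?l *s v))) holomorphic_on ball s0 1"
          by (intro holomorphic_intros)
        moreover have "inverse (?l ^ d) * c d (?l *s u + s *s (?l *s v)) = c d (u + s *s v)" for s
        proof -
          have "?l *s u + s *s (?l *s v) = ?l *s (u + s *s v)"
            by (simp add: vec_eq_iff algebra_simps)
          then have "c d (?l *s u + s *s (?l *s v)) = ?l ^ d * c d (u + s *s v)"
            by (simp only: c_hom)
          then show ?thesis using l by simp
        qed
        ultimately show "\<exists>e>0. (\<lambda>s. c d (u + s *s v)) holomorphic_on ball s0 e"
          by (auto intro!: exI[of _ 1])
      qed
    qed
    show ?case
    proof (rule separately_polynomial_imp_polynomial)
      fix j :: 'n and u :: "complex^'n"
      define u0 where "u0 = vec_update u j 0"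
      have upd: "vec_update u j s = u0 + s *s axis j 1" for s
        by (auto simp: u0_def vec_update_def vec_eq_iff axis_def)
      let ?h = "\<lambda>s. c d (u0 + s *s axis j 1)"
      have taylor: "?h s = (\<Sum>k\<le>d. (deriv ^^ k) ?h 0 / fact k * s ^ k)" for s
      proof (rule Liouville_polynomial[OF entire])
        \<comment> \<open>For such \<open>z\<close> the norm of \<open>u0 + z *s axis j 1\<close> is
          at most \<open>2 * cmod z\<close>, hence growth of order \<open>d\<close> and a polynomial
          of degree at most \<open>d\<close>.\<close>
        fix z :: complex assume z: "norm u0 + 1 \<le> norm z"
        have "norm (u0 + z *s axis j 1) \<le> norm u0 + cmod z"
          using norm_triangle_ineq[of u0 "z *s axis j 1"] by (simp add: norm_vector_smult)
        then have "norm (u0 + z *s axis j 1) / R \<le> 2 * cmod z / R"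
          using z R by (intro divide_right_mono) auto
        then have "B * (norm (u0 + z *s axis j 1) / R) ^ d \<le> B * (2 * cmod z / R) ^ d"
          using R B0 by (intro mult_left_mono power_mono) auto
        also have "\<dots> = B * (2 / R) ^ d * cmod z ^ d"
          by (simp add: power_divide power_mult_distrib)
        finally show "cmod (c d (u0 + z *s axis j 1)) \<le> B * (2 / R) ^ d * cmod z ^ d"
          using c_bound order_trans by blast
      qed
      show "\<exists>a. \<forall>s. c d (vec_update u j s) = (\<Sum>k\<le>d. a k * s ^ k)"
        unfolding upd by (rule exI[of _ "\<lambda>k. (deriv ^^ k) ?h 0 / fact k"], rule allI, rule taylor)
    qed
  qed
  have "(\<lambda>d. c d v) sums f (w + v)" if "norm v < R" for v
    using c_sums[of 1 v] that by (simp add: g_def)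
  with c_poly c_bound show ?thesis by blast
qed

text \<open>\<open>A\<close> is the sum of the homogeneous parts of degree below \<open>k\<close>;
  on half the radius the tail is dominated by a geometric series of ratio \<open>1/2\<close>. That
  \<open>A\<close> is a polynomial later lets it act on an ideal of polynomials.\<close>

lemma taylor_polynomial:
  fixes f :: "complex^'n::finite \<Rightarrow> complex"
  assumes f: "holomorphic_several_on f S" and S: "open S" "w \<in> S"
  shows "\<exists>A C. \<forall>\<^sub>F z in nhds w. cmod (f z - poly_eval A (z - w)) \<le> C * norm (z - w) ^ k"
proof -
  obtain R where R: "0 < R" "cball w R \<subseteq> S"
    using S open_contains_cball by blast
  have "continuous_on (cball w R) f"
    using holomorphic_several_on_imp_continuous_on[OF f] R(2) continuous_on_subset by blast
  then have "bounded (f ` cball w R)"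
    by (intro compact_imp_bounded compact_continuous_image) auto
  then obtain B where B: "\<And>z. z \<in> cball w R \<Longrightarrow> cmod (f z) \<le> B"
    unfolding bounded_iff by (metis imageI)
  have B0: "0 \<le> B" using B[of w] R by (auto intro: order_trans[OF norm_ge_zero])
  obtain c where c: "\<And>d. \<exists>q. \<forall>v. c d v = poly_eval q v" "\<And>d v. cmod (c d v) \<le> B * (norm v / R) ^ d"
    "\<And>v. norm v < R \<Longrightarrow> (\<lambda>d. c d v) sums f (w + v)"
    using homogeneous_parts[OF f R(2,1) B] by blast
  obtain q where q: "\<And>d v. c d v = poly_eval (q d) v" using c(1) by metis
  have "cmod (f z - poly_eval (\<Sum>d<k. q d) (z - w)) \<le> (2 * B / R ^ k) * norm (z - w) ^ k"
    if z: "z \<in> ball w (R / 2)" for z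
  proof -
    define v where "v = z - w"
    have v: "norm v / R \<le> 1 / 2" "norm v < R" "z = w + v"
      using z R(1) by (auto simp: v_def dist_norm norm_minus_commute)
    have s: "(\<lambda>d. c (d + k) v) sums (f z - (\<Sum>d<k. c d v))"
      unfolding v(3) by (rule sums_split_initial_segment[OF c(3)[OF v(2)]])
    have bnd: "cmod (c (d + k) v) \<le> B * (norm v / R) ^ k * (1/2) ^ d" for d
    proof -
      have "(norm v / R) ^ d \<le> (1/2) ^ d" using v(1) R(1) by (intro power_mono) auto
      then have le: "B * (norm v / R) ^ k * (norm v / R) ^ d \<le> B * (norm v / R) ^ k * (1/2) ^ d"
        using B0 R(1) by (intro mult_left_mono) auto
      have eq: "B * (norm v / R) ^ (d + k) = B * (norm v / R) ^ k * (norm v / R) ^ d"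
        by (simp only: power_add mult.assoc mult.commute[of "(norm v / R) ^ d"])
      show ?thesis
        by (rule order_trans[OF c(2)[of "d + k" v, unfolded eq] le])
    qed
    have geo: "(\<lambda>d. B * (norm v / R) ^ k * (1/2) ^ d) sums (B * (norm v / R) ^ k * 2)"
      using geometric_sums[of "1/2 :: real"] by (intro sums_mult) simp
    have "cmod (f z - (\<Sum>d<k. c d v)) \<le> B * (norm v / R) ^ k * 2"
      using norm_suminf_le[OF bnd sums_summable[OF geo]]
      unfolding sums_unique[OF s, symmetric] sums_unique[OF geo, symmetric] .
    also have "(\<Sum>d<k. c d v) = poly_eval (\<Sum>d<k. q d) (z - w)"
      by (simp add: q v_def)
    also have "B * (norm v / R) ^ k * 2 = (2 * B / R ^ k) * norm (z - w) ^ k"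
      unfolding v_def power_divide by simp
    finally show ?thesis .
  qed
  moreover have "\<forall>\<^sub>F z in nhds w. z \<in> ball w (R / 2)"
    using R(1) by (intro eventually_nhds_in_open) auto
  ultimately have "\<forall>\<^sub>F z in nhds w. cmod (f z - poly_eval (\<Sum>d<k. q d) (z - w)) \<le> (2 * B / R ^ k) * norm (z - w) ^ k"
    by (rule eventually_mono[rotated])
  then show ?thesis by blast
qed

section \<open>Division by an ideal\<close>

text \<open>The radii match the weights of \<open>coeff_norm s\<close>, which bounds
  \<open>poly_eval\<close> there.\<close>

definition polydisc :: "nat \<Rightarrow> (complex^'n::finite) set" where
  "polydisc s = {z. \<forall>j. cmod (z $ j) < 1 / real (var_prime j) ^ s}"

lemma open_polydisc: "open (polydisc s :: (complex^'n::finite) set)"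
proof -
  have "(polydisc s :: (complex^'n) set) = (\<Inter>j\<in>UNIV. {z. cmod (z $ j) < 1 / real (var_prime j) ^ s})"
    by (auto simp: polydisc_def)
  moreover have "open {z :: complex^'n. cmod (z $ j) < 1 / real (var_prime j) ^ s}" for j
    by (intro open_Collect_less continuous_intros)
  ultimately show ?thesis by (simp add: open_INT)
qed

lemma zero_in_polydisc: "0 \<in> polydisc s"
  by (simp add: polydisc_def prime_gt_0_nat prime_var_prime)

lemma polydisc_antimono: "s \<le> t \<Longrightarrow> polydisc t \<subseteq> polydisc s"
proof
  fix z :: "complex^'n" assume "s \<le> t" "z \<in> polydisc t"
  moreover have "1 / real (var_prime j) ^ t \<le> 1 / real (var_prime j) ^ s" if "s \<le> t" for j :: 'n
    using prime_gt_1_nat[OF prime_var_prime[of j]] that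
    by (intro divide_left_mono power_increasing mult_pos_pos zero_less_power) auto
  ultimately show "z \<in> polydisc s"
    unfolding polydisc_def using less_le_trans by blast
qed

text \<open>Relative to \<open>a\<close>, a monomial \<open>b\<close> of larger code has weight
  \<open>(mon_code a / mon_code b) ^ s\<close>, which tends to 0. This is the reason for keeping
  \<open>s\<close> free.\<close>

lemma coeff_norm_eventually_small:
  assumes "\<And>b. b \<in> keys p \<Longrightarrow> mon_code a < mon_code b"
  shows "\<forall>\<^sub>F s in sequentially. coeff_norm s p \<le> (1/2) / real (mon_code a) ^ s"
proof -
  have "(\<lambda>s. \<Sum>b\<in>keys p. cmod (lookup p b) * (real (mon_code a) / real (mon_code b)) ^ s)
      \<longlonglongrightarrow> (\<Sum>b\<in>keys p. cmod (lookup p b) * 0)"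
  proof (intro tendsto_sum tendsto_mult tendsto_const LIMSEQ_power_zero)
    fix b assume "b \<in> keys p"
    then show "norm (real (mon_code a) / real (mon_code b)) < 1"
      using assms mon_code_pos[of b] by (simp add: pos_divide_less_eq)
  qed
  then have "\<forall>\<^sub>F s in sequentially.
      (\<Sum>b\<in>keys p. cmod (lookup p b) * (real (mon_code a) / real (mon_code b)) ^ s) < 1/2"
    by (rule order_tendstoD) simp
  then show ?thesis
  proof eventually_elim
    case (elim s)
    have "real (mon_code a) ^ s * coeff_norm s p =
        (\<Sum>b\<in>keys p. cmod (lookup p b) * (real (mon_code a) / real (mon_code b)) ^ s)"
      by (simp add: coeff_norm_def sum_distrib_left power_divide mult.commute)
    then show ?case
      using elim mon_code_pos[of a] by (simp add: field_simps)
  qed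
qed

text \<open>Each weight gains a factor of at most \<open>1 / n\<close> from the larger exponent. On
  the smaller polydisc the remainders of the division therefore tend to 0.\<close>

lemma coeff_norm_Suc_le:
  assumes "\<And>b. b \<in> keys p \<Longrightarrow> n \<le> mon_code b"
  shows "real n * coeff_norm (Suc s) p \<le> coeff_norm s p"
  unfolding coeff_norm_def sum_distrib_left
proof (rule sum_mono)
  fix b assume "b \<in> keys p"
  then have "real n \<le> real (mon_code b)" using assms by simp
  then have "real n * (cmod (lookup p b) / real (mon_code b) ^ s) \<le>
      real (mon_code b) * (cmod (lookup p b) / real (mon_code b) ^ s)"
    by (rule mult_right_mono) simp
  then have "real n * (cmod (lookup p b) / real (mon_code b) ^ s) / real (mon_code b) \<le>
      cmod (lookup p b) / real (mon_code b) ^ s"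
    using mon_code_pos[of b] by (simp only: pos_divide_le_eq of_nat_0_less_iff mult.commute)
  then show "real n * (cmod (lookup p b) / real (mon_code b) ^ Suc s) \<le>
      cmod (lookup p b) / real (mon_code b) ^ s"
    by (simp only: power_Suc times_divide_eq_right divide_divide_eq_left mult.commute)
qed

text \<open>One division step from \<open>u\<close> to \<open>v\<close> with quotient term
  \<open>single c k\<close> for the divisor \<open>f a\<close>. The norm inequality makes the
  quotient terms summable; the last clause drives the remainder to high codes. The alternative
  \<open>k = 0\<close> covers \<open>u = 0\<close>, where \<open>a\<close> is arbitrary.\<close>

definition reduction ::
  "nat \<Rightarrow> ('n \<Rightarrow>\<^sub>0 nat) set \<Rightarrow> (('n \<Rightarrow>\<^sub>0 nat) \<Rightarrow> 'n cpoly) \<Rightarrow> 'n cpoly \<Rightarrow>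
    ('n \<Rightarrow>\<^sub>0 nat) \<Rightarrow> ('n \<Rightarrow>\<^sub>0 nat) \<Rightarrow> complex \<Rightarrow> ('n::finite) cpoly \<Rightarrow> bool" where
  "reduction s A f u a c k v \<longleftrightarrow> (a \<in> A \<or> k = 0) \<and> u = v + single c k * f a \<and>
    coeff_norm s v + (1/2) * (cmod k / real (mon_code (c + a)) ^ s) \<le> coeff_norm s u \<and>
    (\<forall>n. (\<forall>b\<in>keys u. n \<le> mon_code b) \<longrightarrow> (\<forall>b\<in>keys v. Suc n \<le> mon_code b))"

text \<open>
  One step cancels the term of least code of \<open>u\<close>.  The correction \<open>r a\<close> is small relative to the
  leading monomial of \<open>f a\<close>, so the norm of \<open>u\<close> drops by half the size of the cancelled term.
\<close>

lemma division_step: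
  fixes J :: "('n::finite) cpoly set"
  assumes J: "poly_ideal J"
    and f: "\<And>a. a \<in> A \<Longrightarrow> f a \<in> J" "\<And>a. a \<in> A \<Longrightarrow> f a = single a 1 + r a"
    and r: "\<And>a b. a \<in> A \<Longrightarrow> b \<in> keys (r a) \<Longrightarrow> mon_code a < mon_code b"
      "\<And>a. a \<in> A \<Longrightarrow> coeff_norm s (r a) \<le> (1/2) / real (mon_code a) ^ s"
    and A: "\<And>p a. p \<in> J \<Longrightarrow> a \<in> keys p \<Longrightarrow>
      (\<And>b. b \<in> keys p \<Longrightarrow> mon_code a \<le> mon_code b) \<Longrightarrow> \<exists>a'\<in>A. \<exists>c. a = c + a'"
    and u: "u \<in> J"
  shows "\<exists>a c k v. v \<in> J \<and> reduction s A f u a c k v"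
proof (cases "u = 0")
  case True
  then show ?thesis
    unfolding reduction_def
    by (intro exI[of _ undefined] exI[of _ 0] conjI) (auto simp: poly_ideal_0[OF J])
next
  case False
  then have "keys u \<noteq> {}" by simp
  then obtain a0 where a0: "a0 \<in> keys u" "\<And>b. b \<in> keys u \<Longrightarrow> mon_code a0 \<le> mon_code b"
    using ex_has_least_nat[of "\<lambda>a. a \<in> keys u" _ mon_code] by blast
  from A[OF u a0] obtain a c where ac: "a \<in> A" "a0 = c + a" by blast
  define k where "k = lookup u a0"
  define u1 where "u1 = u - single a0 k"
  define u' where "u' = u - single c k * f a"
  \<comment> \<open>The step removes the lowest term exactly and leaves only the correction from
    \<open>r a\<close>, so the two effects on the norm can be estimated separately.\<close>
  have u'_eq: "u' = u1 + - (single c k * r a)"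
    unfolding u'_def u1_def f(2)[OF ac(1)] distrib_left mult_single mult_1_right ac(2)[symmetric]
    by (simp only: diff_diff_eq diff_conv_add_uminus[symmetric])
  have "u' \<in> J"
    unfolding u'_def using J u f(1)[OF ac(1)] by (intro poly_ideal_diff poly_ideal_mult)
  moreover have "u = u' + single c k * f a"
    by (simp add: u'_def)
  moreover have "coeff_norm s u' + (1/2) * (cmod k / real (mon_code (c + a)) ^ s) \<le> coeff_norm s u"
  proof -
    have "coeff_norm s (single c k * r a) \<le> cmod k / real (mon_code c) ^ s * coeff_norm s (r a)"
      by (rule coeff_norm_single_mult)
    also have "\<dots> \<le> cmod k / real (mon_code c) ^ s * ((1/2) / real (mon_code a) ^ s)"
      by (intro mult_left_mono r(2) ac(1)) simp
    also have "\<dots> = (1/2) * (cmod k / real (mon_code a0) ^ s)"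
      by (simp add: ac(2) mon_code_add power_mult_distrib)
    finally have "coeff_norm s (- (single c k * r a)) \<le> (1/2) * (cmod k / real (mon_code a0) ^ s)"
      by simp
    moreover have "coeff_norm s u1 = coeff_norm s u - cmod k / real (mon_code a0) ^ s"
      unfolding u1_def k_def by (rule coeff_norm_minus_term)
    moreover have "coeff_norm s u' \<le> coeff_norm s u1 + coeff_norm s (- (single c k * r a))"
      unfolding u'_eq by (rule coeff_norm_add)
    ultimately show ?thesis unfolding ac(2)[symmetric] by argo
  qed
  moreover have "mon_code a0 < mon_code b" if b: "b \<in> keys u'" for b
  proof -
    have "b \<in> keys u1 \<or> b \<in> keys (single c k * r a)"
      using b unfolding u'_eq by (auto simp: in_keys_iff lookup_add lookup_minus)
    then show ?thesis
    proof
      assume "b \<in> keys u1"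
      then have "b \<in> keys u" "b \<noteq> a0"
        by (auto simp: u1_def k_def in_keys_iff lookup_minus lookup_single when_def split: if_splits)
      then show ?thesis using a0(2) by (metis le_neq_implies_less mon_code_eq_iff)
    next
      assume "b \<in> keys (single c k * r a)"
      then obtain d where "d \<in> keys (r a)" "b = c + d"
        using keys_single_mult by blast
      then show ?thesis using r(1)[OF ac(1)] mon_code_pos[of c] by (simp add: ac(2) mon_code_add)
    qed
  qed
  then have "\<forall>n. (\<forall>b\<in>keys u. n \<le> mon_code b) \<longrightarrow> (\<forall>b\<in>keys u'. Suc n \<le> mon_code b)"
    using a0(1) by (meson Suc_leI le_less_trans)
  ultimately show ?thesis using ac(1) unfolding reduction_def by blast
qed

text \<open>The steps need not end, so the quotients are infinite series. Telescoping the norm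
  inequality bounds the total size of the terms by \<open>2 * coeff_norm s u\<close>, and this
  linear bound survives passage to limits.\<close>

lemma division:
  fixes J :: "('n::finite) cpoly set"
  assumes A: "finite A" and f: "\<And>a. a \<in> A \<Longrightarrow> f a \<in> J"
    and step: "\<And>u. u \<in> J \<Longrightarrow> \<exists>a c k v. v \<in> J \<and> reduction s A f u a c k v"
    and u: "u \<in> J"
  shows "\<exists>q. \<forall>z\<in>polydisc (Suc s). poly_eval u z = (\<Sum>a\<in>A. q a z * poly_eval (f a) z) \<and>
    (\<forall>a. holomorphic_several_on (q a) (polydisc (Suc s)) \<and>
      cmod (q a z) \<le> 2 * (\<Sum>a\<in>A. real (mon_code a) ^ s) * coeff_norm s u)"
proof -
  obtain a c k v where "\<And>u. u \<in> J \<Longrightarrow> v u \<in> J \<and> reduction s A f u (a u) (c u) (k u) (v u)"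
    using step by metis
  then have st: "\<And>u. u \<in> J \<Longrightarrow> a u \<in> A \<or> k u = 0" "\<And>u. u \<in> J \<Longrightarrow> v u \<in> J"
    "\<And>u. u \<in> J \<Longrightarrow> u = v u + single (c u) (k u) * f (a u)"
    "\<And>u. u \<in> J \<Longrightarrow> coeff_norm s (v u) + (1/2) * (cmod (k u) / real (mon_code (c u + a u)) ^ s) \<le> coeff_norm s u"
    "\<And>u n. u \<in> J \<Longrightarrow> (\<forall>b\<in>keys u. n \<le> mon_code b) \<Longrightarrow> (\<forall>b\<in>keys (v u). Suc n \<le> mon_code b)"
    unfolding reduction_def by blast+
  define w where "w n = (v ^^ n) u" for n
  have w0: "w 0 = u" and wS: "w (Suc n) = v (w n)" for n by (simp_all add: w_def)
  have wJ: "w n \<in> J" for n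
    by (induction n) (auto simp: w0 wS u st(2))
  define m where "m n = cmod (k (w n)) / real (mon_code (c (w n) + a (w n))) ^ s" for n
  have m0: "0 \<le> m n" for n by (simp add: m_def)
  have norms: "coeff_norm s (w n) + (1/2) * (\<Sum>i<n. m i) \<le> coeff_norm s u" for n
  proof (induction n)
    case (Suc n)
    then show ?case using st(4)[OF wJ, of n] unfolding wS m_def[symmetric] sum.lessThan_Suc by argo
  qed (simp add: w0)
  have codes: "\<forall>b\<in>keys (w n). n \<le> mon_code b" for n
  proof (induction n)
    case (Suc n)
    then show ?case unfolding wS by (rule st(5)[OF wJ])
  qed simp
  have msum: "(\<Sum>i<n. m i) \<le> 2 * coeff_norm s u" for n
    using norms[of n] coeff_norm_nonneg[of s "w n"] by argo
  have summ: "summable m"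
    using m0 msum by (rule summableI_nonneg_bounded)
  have mtotal: "suminf m \<le> 2 * coeff_norm s u"
    using msum by (intro suminf_le_const summ)
  define t where "t n z = k (w n) * mon_eval (c (w n)) z" for n z
  \<comment> \<open>A term is measured by \<open>m n\<close> at the product \<open>c + a\<close> but
    enters the quotient at \<open>c\<close> alone. The missing factor is
    \<open>mon_code a ^ s\<close>, and the sum over \<open>A\<close> bounds it for all divisors at
    once.\<close>
  define K where "K = (\<Sum>a\<in>A. real (mon_code a) ^ s)"
  have K0: "0 \<le> K" unfolding K_def by (intro sum_nonneg) simp
  have t_bound: "cmod (t n z) \<le> K * m n" if z: "z \<in> polydisc (Suc s)" for n z
  proof (cases "k (w n) = 0")
    case False
    then have aA: "a (w n) \<in> A" using st(1)[OF wJ] by blast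
    have "cmod (mon_eval (c (w n)) z) \<le> 1 / real (mon_code (c (w n))) ^ s"
      using z polydisc_antimono[of s "Suc s"] by (intro mon_eval_bound) (auto simp: polydisc_def intro: less_imp_le)
    then have "cmod (t n z) \<le> cmod (k (w n)) * (1 / real (mon_code (c (w n))) ^ s)"
      unfolding t_def norm_mult by (rule mult_left_mono) simp
    also have "\<dots> = real (mon_code (a (w n))) ^ s * m n"
      using mon_code_pos[of "a (w n)"] by (simp add: m_def mon_code_add power_mult_distrib)
    also have "\<dots> \<le> K * m n"
      unfolding K_def using A aA m0 by (intro mult_right_mono member_le_sum) auto
    finally show ?thesis .
  qed (simp add: t_def K0 m0)
  define q where "q b z = suminf (\<lambda>n. if a (w n) = b then t n z else 0)" for b z
  have qb: "cmod (if a (w n) = b then t n z else 0) \<le> K * m n" if "z \<in> polydisc (Suc s)" for n b z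
    using t_bound[OF that, of n] K0 m0[of n] by simp
  have sK: "summable (\<lambda>n. K * m n)" using summ by (rule summable_mult)
  have q_hol: "holomorphic_several_on (q b) (polydisc (Suc s))" for b
    unfolding q_def
  proof (rule holomorphic_several_suminf[OF open_polydisc _ sK qb])
    fix n
    have "holomorphic_several_on (t n) (polydisc (Suc s))"
      unfolding t_def mon_eval_poly
      by (intro holomorphic_several_mult holomorphic_several_const holomorphic_several_poly)
    then show "holomorphic_several_on (\<lambda>z. if a (w n) = b then t n z else 0) (polydisc (Suc s))"
      using holomorphic_several_const by (cases "a (w n) = b") auto
  qed
  have q_bound: "cmod (q b z) \<le> 2 * K * coeff_norm s u" if z: "z \<in> polydisc (Suc s)" for b z
  proof -
    have "cmod (q b z) \<le> suminf (\<lambda>n. K * m n)"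
      unfolding q_def by (rule norm_suminf_le[OF qb[OF z] sK])
    also have "\<dots> = K * suminf m" by (rule suminf_mult[OF summ])
    also have "\<dots> \<le> K * (2 * coeff_norm s u)" by (rule mult_left_mono[OF mtotal K0])
    finally show ?thesis by simp
  qed
  have "poly_eval u z = (\<Sum>b\<in>A. q b z * poly_eval (f b) z)" if z: "z \<in> polydisc (Suc s)" for z
  proof -
    have part: "poly_eval u z = poly_eval (w n) z + (\<Sum>i<n. t i z * poly_eval (f (a (w i))) z)" for n
    proof (induction n)
      case (Suc n)
      have "poly_eval (w n) z = poly_eval (w (Suc n)) z + t n z * poly_eval (f (a (w n))) z"
        unfolding wS t_def by (subst st(3)[OF wJ]) simp
      then show ?case using Suc by simp
    qed (simp add: w0)
    \<comment> \<open>All codes in \<open>w n\<close> are at least \<open>n\<close> while its norm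
      stays bounded; here the smaller polydisc enters.\<close>
    have "(\<lambda>n. poly_eval (w n) z) \<longlonglongrightarrow> 0"
    proof (rule Lim_null_comparison)
      show "\<forall>\<^sub>F n in sequentially. norm (poly_eval (w n) z) \<le> coeff_norm s u * (1 / real n)"
        using eventually_gt_at_top[of 0]
      proof eventually_elim
        case (elim n)
        have "norm (poly_eval (w n) z) \<le> coeff_norm (Suc s) (w n)"
          using z by (intro poly_eval_bound) (auto simp: polydisc_def intro: less_imp_le)
        then have "real n * norm (poly_eval (w n) z) \<le> real n * coeff_norm (Suc s) (w n)"
          by (rule mult_left_mono) simp
        also have "\<dots> \<le> coeff_norm s (w n)"
          using codes by (intro coeff_norm_Suc_le) auto
        also have "\<dots> \<le> coeff_norm s u"
          using norms[of n] sum_nonneg[of "{..<n}" m, OF m0] by argo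
        finally show ?case using elim by (simp add: field_simps)
      qed
      show "(\<lambda>n. coeff_norm s u * (1 / real n)) \<longlonglongrightarrow> 0"
        using tendsto_mult_right[OF lim_1_over_n, of "coeff_norm s u"] by simp
    qed
    then have "(\<lambda>n. poly_eval u z - poly_eval (w n) z) \<longlonglongrightarrow> poly_eval u z - 0"
      by (intro tendsto_diff tendsto_const)
    then have "(\<lambda>n. \<Sum>i<n. t i z * poly_eval (f (a (w i))) z) \<longlonglongrightarrow> poly_eval u z"
    proof -
      have "(\<Sum>i<n. t i z * poly_eval (f (a (w i))) z) = poly_eval u z - poly_eval (w n) z" for n
        using part[of n] by (metis add_diff_cancel_left')
      with \<open>(\<lambda>n. poly_eval u z - poly_eval (w n) z) \<longlonglongrightarrow> poly_eval u z - 0\<close> show ?thesis by simp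
    qed
    then have s1: "(\<lambda>i. t i z * poly_eval (f (a (w i))) z) sums poly_eval u z"
      by (simp add: sums_def)
    have "(\<lambda>i. \<Sum>b\<in>A. (if a (w i) = b then t i z else 0) * poly_eval (f b) z) sums (\<Sum>b\<in>A. q b z * poly_eval (f b) z)"
      unfolding q_def using summable_comparison_test'[OF sK qb[OF z]]
      by (intro sums_sum sums_mult2 summable_sums)
    moreover have "(\<Sum>b\<in>A. (if a (w i) = b then t i z else 0) * poly_eval (f b) z) = t i z * poly_eval (f (a (w i))) z" for i
    proof -
      have "(\<Sum>b\<in>A. (if a (w i) = b then t i z else 0) * poly_eval (f b) z) =
          (\<Sum>b\<in>A. if a (w i) = b then t i z * poly_eval (f b) z else 0)"
        by (intro sum.cong) auto
      \<comment> \<open>If \<open>a (w i)\<close> lies outside \<open>A\<close>, then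
        \<open>k (w i) = 0\<close> and both sides vanish.\<close>
      also have "\<dots> = t i z * poly_eval (f (a (w i))) z"
        using A st(1)[OF wJ, of i] by (auto simp: t_def)
      finally show ?thesis .
    qed
    ultimately show ?thesis using s1 sums_unique2 by simp
  qed
  then show ?thesis
    using q_hol q_bound unfolding K_def by blast
qed

text \<open>Quotients are merely chosen and need not depend continuously on the dividend, so a
  series is divided term by term and the quotients are summed. The set \<open>A\<close> and the
  divisors are fixed before \<open>s\<close>, which only has to be large.\<close>

lemma ideal_series_closed:
  fixes J :: "('n::finite) cpoly set"
  assumes J: "poly_ideal J"
  shows "\<exists>A f. finite A \<and> (\<forall>a\<in>A. f a \<in> J) \<and>
    (\<forall>\<^sub>F s in sequentially. \<forall>u F. (\<forall>n. u n \<in> J) \<longrightarrow> summable (\<lambda>n. coeff_norm s (u n)) \<longrightarrow>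
      (\<forall>z\<in>polydisc (Suc s). (\<lambda>n. poly_eval (u n) z) sums F z) \<longrightarrow>
      (\<exists>Q. (\<forall>a::'n \<Rightarrow>\<^sub>0 nat. holomorphic_several_on (Q a) (polydisc (Suc s))) \<and>
        (\<forall>z\<in>polydisc (Suc s). F z = (\<Sum>a\<in>A. Q a z * poly_eval (f a) z))))"
proof -
  define U where "U = {a. \<exists>p\<in>J. a \<in> keys p \<and> (\<forall>b\<in>keys p. mon_code a \<le> mon_code b)}"
  obtain A where A: "finite A" "A \<subseteq> U" "\<And>u. u \<in> U \<Longrightarrow> \<exists>a\<in>A. \<exists>c. u = c + a"
    using dickson[of U] by blast
  have "\<forall>a\<in>A. \<exists>p\<in>J. a \<in> keys p \<and> (\<forall>b\<in>keys p. mon_code a \<le> mon_code b)"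
    using A(2) unfolding U_def by blast
  then obtain P where P: "\<And>a. a \<in> A \<Longrightarrow> P a \<in> J" "\<And>a. a \<in> A \<Longrightarrow> a \<in> keys (P a)"
    "\<And>a b. a \<in> A \<Longrightarrow> b \<in> keys (P a) \<Longrightarrow> mon_code a \<le> mon_code b"
    by metis
  \<comment> \<open>Normalised so that the term of lowest code is the monomial \<open>a\<close>
    itself; the rest \<open>r a\<close> becomes negligible for large \<open>s\<close>.\<close>
  define f where "f a = single 0 (1 / lookup (P a) a) * P a" for a
  define r where "r a = f a - single a 1" for a
  have fJ: "f a \<in> J" if "a \<in> A" for a
    unfolding f_def by (rule poly_ideal_mult[OF J P(1)[OF that]])
  have f_lookup: "lookup (f a) b = lookup (P a) b / lookup (P a) a" for a b
    using lookup_single_mult_add[of 0 _ "P a" b] by (simp add: f_def)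
  have r_keys: "mon_code a < mon_code b" if ab: "a \<in> A" "b \<in> keys (r a)" for a b
  proof -
    have "b \<noteq> a"
      using ab P(2)[OF ab(1)] by (auto simp: r_def in_keys_iff lookup_minus f_lookup)
    then have "b \<in> keys (P a)"
      using ab by (auto simp: r_def in_keys_iff lookup_minus f_lookup lookup_single when_def)
    then show ?thesis
      using P(3)[OF ab(1)] \<open>b \<noteq> a\<close> by (metis le_neq_implies_less mon_code_eq_iff)
  qed
  have "\<forall>\<^sub>F s in sequentially. \<forall>a\<in>A. coeff_norm s (r a) \<le> (1/2) / real (mon_code a) ^ s"
    using A(1) r_keys by (intro eventually_ball_finite ballI coeff_norm_eventually_small) auto
  then have "\<forall>\<^sub>F s in sequentially. \<forall>u F. (\<forall>n. u n \<in> J) \<longrightarrow> summable (\<lambda>n. coeff_norm s (u n)) \<longrightarrow>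
      (\<forall>z\<in>polydisc (Suc s). (\<lambda>n. poly_eval (u n) z) sums F z) \<longrightarrow>
      (\<exists>Q. (\<forall>a. holomorphic_several_on (Q a) (polydisc (Suc s))) \<and>
        (\<forall>z\<in>polydisc (Suc s). F z = (\<Sum>a\<in>A. Q a z * poly_eval (f a) z)))"
  proof (eventually_elim, intro allI impI)
    fix s u F
    assume small: "\<forall>a\<in>A. coeff_norm s (r a) \<le> (1/2) / real (mon_code a) ^ s"
      and uJ: "\<forall>n. u n \<in> J" and summ: "summable (\<lambda>n. coeff_norm s (u n))"
      and F: "\<forall>z\<in>polydisc (Suc s). (\<lambda>n. poly_eval (u n) z) sums F z"
    let ?C = "2 * (\<Sum>a\<in>A. real (mon_code a) ^ s)"
    have "\<exists>q. \<forall>z\<in>polydisc (Suc s). poly_eval (u n) z = (\<Sum>a\<in>A. q a z * poly_eval (f a) z) \<and>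
      (\<forall>a. holomorphic_several_on (q a) (polydisc (Suc s)) \<and> cmod (q a z) \<le> ?C * coeff_norm s (u n))" for n
    proof (rule division[OF A(1) fJ])
      show "u n \<in> J" using uJ by blast
      fix v assume v: "v \<in> J"
      show "\<exists>a c k u'. u' \<in> J \<and> reduction s A f v a c k u'"
      proof (rule division_step[OF J fJ _ r_keys _ _ v])
        show "f a = single a 1 + r a" for a by (simp add: r_def)
        show "coeff_norm s (r a) \<le> (1/2) / real (mon_code a) ^ s" if "a \<in> A" for a using small that by blast
        show "\<exists>a'\<in>A. \<exists>c. a = c + a'" if "p \<in> J" "a \<in> keys p"
          "\<And>b. b \<in> keys p \<Longrightarrow> mon_code a \<le> mon_code b" for p a
          using that by (intro A(3)) (auto simp: U_def)
      qed
    qed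
    then have "\<forall>n. \<exists>q. \<forall>z\<in>polydisc (Suc s). poly_eval (u n) z = (\<Sum>a\<in>A. q a z * poly_eval (f a) z) \<and>
      (\<forall>a. holomorphic_several_on (q a) (polydisc (Suc s)) \<and> cmod (q a z) \<le> ?C * coeff_norm s (u n))"
      by (rule allI)
    from choice[OF this] obtain q where q0: "\<forall>n. \<forall>z\<in>polydisc (Suc s).
      poly_eval (u n) z = (\<Sum>a\<in>A. q n a z * poly_eval (f a) z) \<and>
      (\<forall>a. holomorphic_several_on (q n a) (polydisc (Suc s)) \<and> cmod (q n a z) \<le> ?C * coeff_norm s (u n))"
      by (rule exE)
    note q0' = bspec[OF spec[OF q0]]
    note q = conjunct1[OF q0'] conjunct1[OF spec[OF conjunct2[OF q0']]] conjunct2[OF spec[OF conjunct2[OF q0']]]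
    have sC: "summable (\<lambda>n. ?C * coeff_norm s (u n))" using summ by (rule summable_mult)
    define Q where "Q a z = suminf (\<lambda>n. q n a z)" for a z
    have "holomorphic_several_on (Q a) (polydisc (Suc s))" for a
      unfolding Q_def by (rule holomorphic_several_suminf[OF open_polydisc q(2)[OF zero_in_polydisc] sC q(3)])
    moreover have "F z = (\<Sum>a\<in>A. Q a z * poly_eval (f a) z)" if z: "z \<in> polydisc (Suc s)" for z
    proof -
      have "(\<lambda>n. \<Sum>a\<in>A. q n a z * poly_eval (f a) z) sums (\<Sum>a\<in>A. Q a z * poly_eval (f a) z)"
        unfolding Q_def using summable_comparison_test'[OF sC q(3)[OF z]]
        by (intro sums_sum sums_mult2 summable_sums)
      then show ?thesis using F z q(1)[OF z] sums_unique2 by fastforce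
    qed
    ultimately show "\<exists>Q. (\<forall>a. holomorphic_several_on (Q a) (polydisc (Suc s))) \<and>
        (\<forall>z\<in>polydisc (Suc s). F z = (\<Sum>a\<in>A. Q a z * poly_eval (f a) z))" by blast
  qed
  with A(1) fJ show ?thesis by blast
qed

section \<open>Germs\<close>

definition hol_at :: "complex^'n \<Rightarrow> (complex^('n::finite) \<Rightarrow> complex) \<Rightarrow> bool" where
  "hol_at w f \<longleftrightarrow> (\<exists>S. open S \<and> w \<in> S \<and> holomorphic_several_on f S)"

lemma hol_at_const: "hol_at w (\<lambda>z. c)"
  unfolding hol_at_def using holomorphic_several_const open_UNIV by blast

lemma
  assumes "hol_at w f" "hol_at w g"
  shows hol_at_add: "hol_at w (\<lambda>z. f z + g z)" and hol_at_mult: "hol_at w (\<lambda>z. f z * g z)"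
proof -
  obtain S T where S: "open S" "w \<in> S" "holomorphic_several_on f S"
    and T: "open T" "w \<in> T" "holomorphic_several_on g T"
    using assms unfolding hol_at_def by blast
  have "open (S \<inter> T)" "w \<in> S \<inter> T" "holomorphic_several_on f (S \<inter> T)" "holomorphic_several_on g (S \<inter> T)"
    using S T by (auto intro: holomorphic_several_on_subset)
  then show "hol_at w (\<lambda>z. f z + g z)"
    unfolding hol_at_def by (intro exI[of _ "S \<inter> T"] conjI holomorphic_several_add)
  show "hol_at w (\<lambda>z. f z * g z)"
    unfolding hol_at_def by (intro exI[of _ "S \<inter> T"] conjI holomorphic_several_mult) fact+
qed

lemma hol_at_uminus: "hol_at w f \<Longrightarrow> hol_at w (\<lambda>z. - f z)"
  using hol_at_mult[OF hol_at_const[of w "-1"], of f] by simp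

lemma hol_at_diff: "hol_at w f \<Longrightarrow> hol_at w g \<Longrightarrow> hol_at w (\<lambda>z. f z - g z)"
  using hol_at_add[OF _ hol_at_uminus, of w f g] by simp

lemma hol_at_cong:
  assumes f: "hol_at w f" and eq: "\<forall>\<^sub>F z in nhds w. g z = f z"
  shows "hol_at w g"
proof -
  obtain S where S: "open S" "w \<in> S" "holomorphic_several_on f S"
    using f unfolding hol_at_def by blast
  obtain T where T: "open T" "w \<in> T" "\<And>z. z \<in> T \<Longrightarrow> g z = f z"
    using eq unfolding eventually_nhds by blast
  have "holomorphic_several_on g (S \<inter> T)"
    using S T by (intro holomorphic_several_on_cong[OF holomorphic_several_on_subset[OF S(3)]]) auto
  then show ?thesis unfolding hol_at_def using S T by blast
qed

lemma hol_at_inverse: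
  assumes f: "hol_at w f" and nz: "f w \<noteq> 0"
  shows "hol_at w (\<lambda>z. inverse (f z))" and "\<forall>\<^sub>F z in nhds w. f z \<noteq> 0"
proof -
  obtain S where S: "open S" "w \<in> S" "holomorphic_several_on f S"
    using f unfolding hol_at_def by blast
  have "continuous_on S f" by (rule holomorphic_several_on_imp_continuous_on[OF S(3)])
  then have o: "open (S \<inter> f -` (- {0}))"
    using S(1) by (intro continuous_open_preimage) auto
  have "holomorphic_several_on (\<lambda>z. inverse (f z)) (S \<inter> f -` (- {0}))"
    using S(3) by (intro holomorphic_several_inverse holomorphic_several_on_subset[OF S(3)]) auto
  then show "hol_at w (\<lambda>z. inverse (f z))"
    unfolding hol_at_def using o S(2) nz by blast
  show "\<forall>\<^sub>F z in nhds w. f z \<noteq> 0"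
    unfolding eventually_nhds using o S(2) nz by blast
qed

lemma hol_at_poly: "hol_at w (\<lambda>z. poly_eval p (z - v))"
  unfolding hol_at_def using holomorphic_several_poly_translate open_UNIV by blast

section \<open>The ring of germs\<close>

lemma germ_eq_iff: "germ w f = germ w g \<longleftrightarrow> (\<forall>\<^sub>F z in nhds w. f z = g z)"
proof
  assume "germ w f = germ w g"
  moreover have "f \<in> germ w f" by (simp add: germ_def)
  ultimately show "\<forall>\<^sub>F z in nhds w. f z = g z" by (simp add: germ_def)
next
  assume eq: "\<forall>\<^sub>F z in nhds w. f z = g z"
  have "(\<forall>\<^sub>F z in nhds w. h z = f z) \<longleftrightarrow> (\<forall>\<^sub>F z in nhds w. h z = g z)" for h
    using eq by (auto elim: eventually_elim2)
  then show "germ w f = germ w g" by (simp add: germ_def)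
qed

text \<open>The operations of \<open>germ_ring\<close> are unions over all representatives. As all
  of them give the same germ, the union collapses.\<close>

lemma germ_UN_binary:
  assumes "\<And>a b c d. \<forall>\<^sub>F z in nhds w. a z = b z \<Longrightarrow> \<forall>\<^sub>F z in nhds w. c z = d z \<Longrightarrow> germ w (F a c) = germ w (F b d)"
  shows "(\<Union>f'\<in>germ w f. \<Union>g'\<in>germ w g. germ w (F f' g')) = germ w (F f g)"
proof -
  have "f \<in> germ w f" "g \<in> germ w g" by (simp_all add: germ_def)
  moreover have "germ w (F f' g') = germ w (F f g)" if "f' \<in> germ w f" "g' \<in> germ w g" for f' g'
    using that by (intro assms) (simp_all add: germ_def)
  ultimately show ?thesis by blast
qed

lemma germ_ring_mult: "germ w f \<otimes>\<^bsub>germ_ring w\<^esub> germ w g = germ w (\<lambda>z. f z * g z)"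
  unfolding germ_ring_def monoid.simps
  by (rule germ_UN_binary) (auto simp: germ_eq_iff elim: eventually_elim2)

lemma germ_ring_add: "germ w f \<oplus>\<^bsub>germ_ring w\<^esub> germ w g = germ w (\<lambda>z. f z + g z)"
  unfolding germ_ring_def ring_record_simps
  by (rule germ_UN_binary) (auto simp: germ_eq_iff elim: eventually_elim2)

lemma germ_ring_one: "\<one>\<^bsub>germ_ring w\<^esub> = germ w (\<lambda>z. 1)"
  and germ_ring_zero: "\<zero>\<^bsub>germ_ring w\<^esub> = germ w (\<lambda>z. 0)"
  by (simp_all add: germ_ring_def)

lemma germ_ring_carrier: "carrier (germ_ring w) = germ w ` {f. hol_at w f}"
  by (auto simp: germ_ring_def holomorphic_germs_def hol_at_def)

lemmas germ_ring_ops = germ_ring_mult germ_ring_add germ_ring_one germ_ring_zero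

lemma germ_in_carrier_iff [simp]: "germ w f \<in> carrier (germ_ring w) \<longleftrightarrow> hol_at w f"
proof
  assume "germ w f \<in> carrier (germ_ring w)"
  then obtain g where g: "hol_at w g" "germ w f = germ w g"
    unfolding germ_ring_carrier by blast
  then show "hol_at w f" using hol_at_cong germ_eq_iff by blast
qed (simp add: germ_ring_carrier)

lemma germ_ring_carrierE:
  assumes "x \<in> carrier (germ_ring w)"
  obtains f where "x = germ w f" "hol_at w f"
  using assms unfolding germ_ring_carrier by blast

lemma cring_germ_ring: "cring (germ_ring w)"
proof (rule cringI)
  show "abelian_group (germ_ring w)"
  proof (rule abelian_groupI)
    fix x y z assume "x \<in> carrier (germ_ring w)" "y \<in> carrier (germ_ring w)" "z \<in> carrier (germ_ring w)"
    then obtain f g h where "x = germ w f" "hol_at w f" "y = germ w g" "hol_at w g" "z = germ w h" "hol_at w h"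
      by (elim germ_ring_carrierE)
    then show "x \<oplus>\<^bsub>germ_ring w\<^esub> y \<in> carrier (germ_ring w)"
      "x \<oplus>\<^bsub>germ_ring w\<^esub> y = y \<oplus>\<^bsub>germ_ring w\<^esub> x"
      "x \<oplus>\<^bsub>germ_ring w\<^esub> y \<oplus>\<^bsub>germ_ring w\<^esub> z = x \<oplus>\<^bsub>germ_ring w\<^esub> (y \<oplus>\<^bsub>germ_ring w\<^esub> z)"
      "\<zero>\<^bsub>germ_ring w\<^esub> \<oplus>\<^bsub>germ_ring w\<^esub> x = x"
      "\<exists>y\<in>carrier (germ_ring w). y \<oplus>\<^bsub>germ_ring w\<^esub> x = \<zero>\<^bsub>germ_ring w\<^esub>"
      by (simp_all add: germ_ring_ops hol_at_add add.commute add.left_commute)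
        (intro bexI[of _ "germ w (\<lambda>z. - f z)"], simp_all add: germ_ring_ops hol_at_uminus)
  qed (simp add: germ_ring_zero hol_at_const)
  show "comm_monoid (germ_ring w)"
  proof (rule comm_monoidI)
    fix x y z assume "x \<in> carrier (germ_ring w)" "y \<in> carrier (germ_ring w)" "z \<in> carrier (germ_ring w)"
    then obtain f g h where "x = germ w f" "hol_at w f" "y = germ w g" "hol_at w g" "z = germ w h" "hol_at w h"
      by (elim germ_ring_carrierE)
    note fgh = this
    show "x \<otimes>\<^bsub>germ_ring w\<^esub> y \<in> carrier (germ_ring w)"
      using hol_at_mult[OF fgh(2,4)] by (simp only: fgh germ_ring_mult germ_in_carrier_iff)
    show "x \<otimes>\<^bsub>germ_ring w\<^esub> y = y \<otimes>\<^bsub>germ_ring w\<^esub> x"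
      by (simp only: fgh germ_ring_mult mult.commute)
    show "x \<otimes>\<^bsub>germ_ring w\<^esub> y \<otimes>\<^bsub>germ_ring w\<^esub> z = x \<otimes>\<^bsub>germ_ring w\<^esub> (y \<otimes>\<^bsub>germ_ring w\<^esub> z)"
      by (simp only: fgh germ_ring_mult mult.assoc)
    show "\<one>\<^bsub>germ_ring w\<^esub> \<otimes>\<^bsub>germ_ring w\<^esub> x = x"
      by (simp only: fgh germ_ring_mult germ_ring_one mult_1_left)
  qed (simp add: germ_ring_one hol_at_const)
next
  fix x y z assume "x \<in> carrier (germ_ring w)" "y \<in> carrier (germ_ring w)" "z \<in> carrier (germ_ring w)"
  then obtain f g h where "x = germ w f" "y = germ w g" "z = germ w h"
    by (elim germ_ring_carrierE)
  then show "(x \<oplus>\<^bsub>germ_ring w\<^esub> y) \<otimes>\<^bsub>germ_ring w\<^esub> z =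
      x \<otimes>\<^bsub>germ_ring w\<^esub> z \<oplus>\<^bsub>germ_ring w\<^esub> y \<otimes>\<^bsub>germ_ring w\<^esub> z"
    by (simp add: germ_ring_ops distrib_right)
qed

text \<open>
  With \<open>L\<close> the functions holomorphic at \<open>w\<close> this is the ideal generated by \<open>X\<close>; with those that
  moreover vanish at \<open>w\<close> it is the product of that ideal with the maximal ideal.
\<close>

inductive_set lcomb :: "complex^'n \<Rightarrow> ((complex^('n::finite) \<Rightarrow> complex) \<Rightarrow> bool) \<Rightarrow>
    (complex^'n \<Rightarrow> complex) set \<Rightarrow> (complex^'n \<Rightarrow> complex) set"
  for w L X where
    lcomb_zero: "\<forall>\<^sub>F z in nhds w. h z = 0 \<Longrightarrow> h \<in> lcomb w L X"
  | lcomb_step: "h \<in> lcomb w L X \<Longrightarrow> L a \<Longrightarrow> x \<in> X \<Longrightarrow> \<forall>\<^sub>F z in nhds w. g z = h z + a z * x z \<Longrightarrow> g \<in> lcomb w L X"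

definition hol_vanish :: "complex^'n \<Rightarrow> (complex^('n::finite) \<Rightarrow> complex) \<Rightarrow> bool" where
  "hol_vanish w f \<longleftrightarrow> hol_at w f \<and> f w = 0"

lemma hol_vanish_mult_left: "hol_vanish w f \<Longrightarrow> hol_at w g \<Longrightarrow> hol_vanish w (\<lambda>z. f z * g z)"
  and hol_vanish_mult_right: "hol_at w f \<Longrightarrow> hol_vanish w g \<Longrightarrow> hol_vanish w (\<lambda>z. f z * g z)"
  and hol_vanish_add: "hol_vanish w f \<Longrightarrow> hol_vanish w g \<Longrightarrow> hol_vanish w (\<lambda>z. f z + g z)"
  by (auto simp: hol_vanish_def intro: hol_at_mult hol_at_add)

lemma lcomb_cong:
  assumes h: "h \<in> lcomb w L X" and eq: "\<forall>\<^sub>F z in nhds w. g z = h z"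
  shows "g \<in> lcomb w L X"
  using h
proof cases
  case lcomb_zero
  then have "\<forall>\<^sub>F z in nhds w. g z = 0" using eq by eventually_elim simp
  then show ?thesis by (rule lcomb.lcomb_zero)
next
  case (lcomb_step h' a x)
  from eq lcomb_step(4) have "\<forall>\<^sub>F z in nhds w. g z = h' z + a z * x z" by eventually_elim simp
  then show ?thesis by (rule lcomb.lcomb_step[OF lcomb_step(1,2,3)])
qed

lemma lcomb_add:
  assumes "g \<in> lcomb w L X" "h \<in> lcomb w L X"
  shows "(\<lambda>z. g z + h z) \<in> lcomb w L X"
  using assms(2)
proof induction
  case (lcomb_zero h)
  then have "\<forall>\<^sub>F z in nhds w. g z + h z = g z" by eventually_elim simp
  then show ?case by (rule lcomb_cong[OF assms(1)])
next
  case (lcomb_step h a x k)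
  from lcomb_step(4) have "\<forall>\<^sub>F z in nhds w. g z + k z = (g z + h z) + a z * x z" by eventually_elim simp
  then show ?case by (rule lcomb.lcomb_step[OF lcomb_step(5,2,3)])
qed

lemma lcomb_mult:
  assumes "\<And>a. L a \<Longrightarrow> L' (\<lambda>z. b z * a z)" "h \<in> lcomb w L X"
  shows "(\<lambda>z. b z * h z) \<in> lcomb w L' X"
  using assms(2)
proof induction
  case (lcomb_zero h)
  then have "\<forall>\<^sub>F z in nhds w. b z * h z = 0" by eventually_elim simp
  then show ?case by (rule lcomb.lcomb_zero)
next
  case (lcomb_step h a x g)
  from lcomb_step(4) have "\<forall>\<^sub>F z in nhds w. b z * g z = b z * h z + (b z * a z) * x z"
    by eventually_elim (simp only: distrib_left mult.assoc)
  then show ?case by (rule lcomb.lcomb_step[OF lcomb_step(5) assms(1)[OF lcomb_step(2)] lcomb_step(3)])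
qed

lemma lcomb_base: "L a \<Longrightarrow> x \<in> X \<Longrightarrow> (\<lambda>z. a z * x z) \<in> lcomb w L X"
  by (rule lcomb_step[of "\<lambda>z. 0"]) (auto intro: lcomb_zero)

lemma lcomb_trans:
  assumes "\<And>x a. x \<in> X \<Longrightarrow> L a \<Longrightarrow> (\<lambda>z. a z * x z) \<in> lcomb w L' Y"
  shows "lcomb w L X \<subseteq> lcomb w L' Y"
proof
  fix h assume "h \<in> lcomb w L X"
  then show "h \<in> lcomb w L' Y"
  proof induction
    case (lcomb_step h a x g)
    show ?case
      by (rule lcomb_cong[OF lcomb_add[OF lcomb_step(5) assms[OF lcomb_step(3,2)]] lcomb_step(4)])
  qed (rule lcomb_zero)
qed

lemma lcomb_mono: "X \<subseteq> Y \<Longrightarrow> (\<And>a. L a \<Longrightarrow> L' a) \<Longrightarrow> lcomb w L X \<subseteq> lcomb w L' Y"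
  by (rule lcomb_trans) (blast intro: lcomb_base)

abbreviation "ocomb w \<equiv> lcomb w (hol_at w)"
abbreviation "mcomb w \<equiv> lcomb w (hol_vanish w)"

lemma ocomb_mult: "hol_at w b \<Longrightarrow> h \<in> ocomb w X \<Longrightarrow> (\<lambda>z. b z * h z) \<in> ocomb w X"
  by (rule lcomb_mult) (auto intro: hol_at_mult)

lemma mcomb_mult: "hol_at w b \<Longrightarrow> h \<in> mcomb w X \<Longrightarrow> (\<lambda>z. b z * h z) \<in> mcomb w X"
  by (rule lcomb_mult) (auto intro: hol_vanish_mult_right)

lemma ocomb_vanish_mult: "hol_vanish w b \<Longrightarrow> h \<in> ocomb w X \<Longrightarrow> (\<lambda>z. b z * h z) \<in> mcomb w X"
  by (rule lcomb_mult) (auto intro: hol_vanish_mult_left)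

lemma mcomb_subset_ocomb: "mcomb w X \<subseteq> ocomb w X"
  by (rule lcomb_mono) (auto simp: hol_vanish_def)

lemma ocomb_base: "x \<in> X \<Longrightarrow> x \<in> ocomb w X"
  using lcomb_base[of "hol_at w" "\<lambda>z. 1" x X w, OF hol_at_const] by simp

lemma ocomb_trans: "X \<subseteq> ocomb w Y \<Longrightarrow> ocomb w X \<subseteq> ocomb w Y"
  by (rule lcomb_trans) (auto intro: ocomb_mult)

lemma mcomb_trans: "X \<subseteq> ocomb w Y \<Longrightarrow> mcomb w X \<subseteq> mcomb w Y"
  by (rule lcomb_trans) (auto intro: ocomb_vanish_mult)

lemma ocomb_diff: "g \<in> ocomb w X \<Longrightarrow> h \<in> ocomb w X \<Longrightarrow> (\<lambda>z. g z - h z) \<in> ocomb w X"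
  using lcomb_add[of g w "hol_at w" X "\<lambda>z. -1 * h z"] ocomb_mult[OF hol_at_const[of w "-1"], of h X] by simp

lemma mcomb_diff: "g \<in> mcomb w X \<Longrightarrow> h \<in> mcomb w X \<Longrightarrow> (\<lambda>z. g z - h z) \<in> mcomb w X"
  using lcomb_add[of g w "hol_vanish w" X "\<lambda>z. -1 * h z"] mcomb_mult[OF hol_at_const[of w "-1"], of h X] by simp

lemma ocomb_sum:
  assumes "\<And>i. i \<in> I \<Longrightarrow> f i \<in> ocomb w X"
  shows "(\<lambda>z. \<Sum>i\<in>I. f i z) \<in> ocomb w X"
  using assms
proof (induction I rule: infinite_finite_induct)
  case (insert i I)
  then show ?case using lcomb_add[of "f i" w "hol_at w" X "\<lambda>z. \<Sum>i\<in>I. f i z"] by simp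
qed (auto intro: lcomb_zero)

lemma ocomb_hol_at:
  assumes "h \<in> ocomb w X" "\<And>x. x \<in> X \<Longrightarrow> hol_at w x"
  shows "hol_at w h"
  using assms(1)
proof induction
  case (lcomb_zero h)
  then show ?case by (rule hol_at_cong[OF hol_at_const])
next
  case (lcomb_step h a x g)
  show ?case
    by (rule hol_at_cong[OF hol_at_add[OF lcomb_step(5) hol_at_mult[OF lcomb_step(2) assms(2)[OF lcomb_step(3)]]] lcomb_step(4)])
qed

text \<open>The passage between the generated ideal in the ring of germs and combinations of
  functions; the other arguments concern functions up to equality near \<open>w\<close>.\<close>

lemma genideal_germs:
  assumes X: "\<And>x. x \<in> X \<Longrightarrow> hol_at w x"
  shows "genideal (germ_ring w) (germ w ` X) = germ w ` ocomb w X"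
proof
  interpret R: cring "germ_ring w" by (rule cring_germ_ring)
  have "ideal (germ w ` ocomb w X) (germ_ring w)"
  proof (rule idealI)
    show "ring (germ_ring w)" by (rule R.ring_axioms)
    show "subgroup (germ w ` ocomb w X) (add_monoid (germ_ring w))"
    proof (rule subgroup.intro)
      show "germ w ` ocomb w X \<subseteq> carrier (add_monoid (germ_ring w))"
        using ocomb_hol_at X by (auto simp: germ_ring_carrier)
      show "\<one>\<^bsub>add_monoid (germ_ring w)\<^esub> \<in> germ w ` ocomb w X"
        by (simp add: germ_ring_zero) (rule imageI, rule lcomb_zero, simp)
      fix x y assume x: "x \<in> germ w ` ocomb w X"
      then obtain f where f: "f \<in> ocomb w X" "x = germ w f" by blast
      show "x \<otimes>\<^bsub>add_monoid (germ_ring w)\<^esub> y \<in> germ w ` ocomb w X" if y: "y \<in> germ w ` ocomb w X"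
      proof -
        obtain g where "g \<in> ocomb w X" "y = germ w g" using y by blast
        then show ?thesis using f by (simp add: germ_ring_add lcomb_add)
      qed
      have m: "(\<lambda>z. 0 - f z) \<in> ocomb w X" by (rule ocomb_diff[OF lcomb_zero f(1)]) simp
      have "\<ominus>\<^bsub>germ_ring w\<^esub> x = germ w (\<lambda>z. 0 - f z)"
      proof (rule R.minus_equality)
        show "germ w (\<lambda>z. 0 - f z) \<oplus>\<^bsub>germ_ring w\<^esub> x = \<zero>\<^bsub>germ_ring w\<^esub>"
          by (simp add: f(2) germ_ring_add germ_ring_zero)
      qed (use f m ocomb_hol_at X in \<open>auto simp: germ_ring_carrier\<close>)
      then show "inv\<^bsub>add_monoid (germ_ring w)\<^esub> x \<in> germ w ` ocomb w X"
        using m by (simp add: a_inv_def)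
    qed
    fix a x assume "a \<in> germ w ` ocomb w X" "x \<in> carrier (germ_ring w)"
    then obtain f g where fg: "f \<in> ocomb w X" "a = germ w f" "hol_at w g" "x = germ w g"
      by (auto simp: germ_ring_carrier)
    then show "x \<otimes>\<^bsub>germ_ring w\<^esub> a \<in> germ w ` ocomb w X" "a \<otimes>\<^bsub>germ_ring w\<^esub> x \<in> germ w ` ocomb w X"
      using ocomb_mult[OF fg(3,1)] by (simp_all add: germ_ring_mult mult.commute)
  qed
  then show "genideal (germ_ring w) (germ w ` X) \<subseteq> germ w ` ocomb w X"
    unfolding genideal_def using ocomb_base by blast
  show "germ w ` ocomb w X \<subseteq> genideal (germ_ring w) (germ w ` X)"
    unfolding genideal_def
  proof safe
    fix h I assume h: "h \<in> ocomb w X" and I: "ideal I (germ_ring w)" "germ w ` X \<subseteq> I"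
    interpret I: ideal I "germ_ring w" by (rule I(1))
    show "germ w h \<in> I"
      using h
    proof induction
      case (lcomb_zero h)
      then have "germ w h = \<zero>\<^bsub>germ_ring w\<^esub>" by (simp add: germ_ring_zero germ_eq_iff)
      then show ?case by simp
    next
      case (lcomb_step h a x g)
      have "germ w g = germ w h \<oplus>\<^bsub>germ_ring w\<^esub> (germ w a \<otimes>\<^bsub>germ_ring w\<^esub> germ w x)"
        using lcomb_step(4) by (simp add: germ_ring_mult germ_ring_add germ_eq_iff)
      moreover have "germ w a \<otimes>\<^bsub>germ_ring w\<^esub> germ w x \<in> I"
        using lcomb_step(2,3) I(2) by (intro I.I_l_closed) (auto simp: germ_ring_carrier)
      ultimately show ?case using lcomb_step(5) by simp
    qed
  qed
qed

text \<open>Gathers all occurrences of \<open>f\<close> into one coefficient, so that a relation can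
  be solved for \<open>f\<close>.\<close>

lemma lcomb_insert:
  assumes L: "L (\<lambda>z. 0)" "\<And>a b. L a \<Longrightarrow> L b \<Longrightarrow> L (\<lambda>z. a z + b z)"
    and h: "h \<in> lcomb w L (insert f F)"
  shows "\<exists>h'\<in>lcomb w L F. \<exists>a. L a \<and> (\<forall>\<^sub>F z in nhds w. h z = h' z + a z * f z)"
  using h
proof induction
  case (lcomb_zero h)
  then show ?case
    using L(1) by (intro bexI[of _ "\<lambda>z. 0"] exI[of _ "\<lambda>z. 0"]) (auto intro: lcomb.lcomb_zero)
next
  case (lcomb_step h a x g)
  then obtain h' b where b: "h' \<in> lcomb w L F" "L b" "\<forall>\<^sub>F z in nhds w. h z = h' z + b z * f z" by blast
  show ?case
  proof (cases "x = f")
    case True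
    from lcomb_step(4) b(3) have "\<forall>\<^sub>F z in nhds w. g z = h' z + (a z + b z) * f z"
      by eventually_elim (simp add: True algebra_simps)
    then show ?thesis using b(1) L(2)[OF lcomb_step(2) b(2)] by blast
  next
    case False
    then have "x \<in> F" using lcomb_step(3) by simp
    then have "(\<lambda>z. h' z + a z * x z) \<in> lcomb w L F"
      using b(1) lcomb_step(2) by (intro lcomb_add lcomb_base)
    moreover from lcomb_step(4) b(3) have "\<forall>\<^sub>F z in nhds w. g z = (h' z + a z * x z) + b z * f z"
      by eventually_elim (simp add: algebra_simps)
    ultimately show ?thesis
      using b(2) by (intro bexI[of _ "\<lambda>z. h' z + a z * x z"] exI[of _ b] conjI)
  qed
qed

text \<open>Elimination by induction on \<open>F\<close>. In a relation
  \<open>f = t + m' + a f\<close> with \<open>a\<close> vanishing at \<open>w\<close>, the germ of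
  \<open>1 - a\<close> is invertible, so \<open>f\<close> can be expressed through the others and
  substituted in their relations.\<close>

lemma nakayama:
  assumes F: "finite F"
    and dec: "\<And>f. f \<in> F \<Longrightarrow> \<exists>t\<in>ocomb w Y. \<exists>m\<in>mcomb w F. \<forall>\<^sub>F z in nhds w. f z = t z + m z"
  shows "F \<subseteq> ocomb w Y"
  using assms
proof (induction F)
  case (insert f F)
  have split: "\<exists>m'\<in>mcomb w F. \<exists>a. hol_vanish w a \<and> (\<forall>\<^sub>F z in nhds w. m z = m' z + a z * f z)"
    if "m \<in> mcomb w (insert f F)" for m
    using that by (intro lcomb_insert hol_vanish_add) (simp_all add: hol_vanish_def hol_at_const)
  obtain t m where tm: "t \<in> ocomb w Y" "m \<in> mcomb w (insert f F)" "\<forall>\<^sub>F z in nhds w. f z = t z + m z"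
    using insert.prems by blast
  obtain m' a where a: "m' \<in> mcomb w F" "hol_vanish w a" "\<forall>\<^sub>F z in nhds w. m z = m' z + a z * f z"
    using split[OF tm(2)] by blast
  have h1: "hol_at w (\<lambda>z. 1 - a z)" "1 - a w \<noteq> 0"
    using a(2) by (auto simp: hol_vanish_def intro: hol_at_diff hol_at_const)
  define i where "i z = inverse (1 - a z)" for z
  have i: "hol_at w i" "\<forall>\<^sub>F z in nhds w. 1 - a z \<noteq> 0"
    using hol_at_inverse[OF h1] by (simp_all add: i_def[abs_def])
  define t0 where "t0 z = i z * t z" for z
  define m0 where "m0 z = i z * m' z" for z
  have t0: "t0 \<in> ocomb w Y" and m0: "m0 \<in> mcomb w F"
    using ocomb_mult[OF i(1) tm(1)] mcomb_mult[OF i(1) a(1)] by (simp_all add: t0_def[abs_def] m0_def[abs_def])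
  have f: "\<forall>\<^sub>F z in nhds w. f z = t0 z + m0 z"
    using tm(3) a(3) i(2)
  proof eventually_elim
    case (elim z)
    then have "(1 - a z) * f z = t z + m' z" by (simp add: algebra_simps)
    then have "i z * (t z + m' z) = i z * (1 - a z) * f z" by (simp only: mult.assoc)
    also have "i z * (1 - a z) = 1" using elim(3) by (simp add: i_def)
    finally show ?case by (simp only: t0_def m0_def distrib_left mult_1_left)
  qed
  have "F \<subseteq> ocomb w Y"
  proof (rule insert.IH)
    fix g assume "g \<in> F"
    then obtain s n where sn: "s \<in> ocomb w Y" "n \<in> mcomb w (insert f F)" "\<forall>\<^sub>F z in nhds w. g z = s z + n z"
      using insert.prems by blast
    obtain n' b where b: "n' \<in> mcomb w F" "hol_vanish w b" "\<forall>\<^sub>F z in nhds w. n z = n' z + b z * f z"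
      using split[OF sn(2)] by blast
    then have hb: "hol_at w b" by (simp add: hol_vanish_def)
    have "(\<lambda>z. s z + b z * t0 z) \<in> ocomb w Y"
      using sn(1) ocomb_mult[OF hb t0] by (rule lcomb_add)
    moreover have "(\<lambda>z. n' z + b z * m0 z) \<in> mcomb w F"
      using b(1) mcomb_mult[OF hb m0] by (rule lcomb_add)
    moreover from f sn(3) b(3) have "\<forall>\<^sub>F z in nhds w. g z = (s z + b z * t0 z) + (n' z + b z * m0 z)"
      by eventually_elim (simp add: algebra_simps)
    ultimately show "\<exists>t\<in>ocomb w Y. \<exists>m\<in>mcomb w F. \<forall>\<^sub>F z in nhds w. g z = t z + m z"
      by (intro bexI[of _ "\<lambda>z. s z + b z * t0 z"] bexI[of _ "\<lambda>z. n' z + b z * m0 z"])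
  qed
  moreover from this have "m0 \<in> ocomb w Y"
    using m0 mcomb_subset_ocomb ocomb_trans by blast
  then have "f \<in> ocomb w Y" using lcomb_cong[OF lcomb_add[OF t0] f] by blast
  ultimately show ?case by simp
qed simp

section \<open>Minimal generating sets\<close>

interpretation fun_space: vector_space "fun_scale :: complex \<Rightarrow> ('a \<Rightarrow> complex) \<Rightarrow> 'a \<Rightarrow> complex"
proof (rule vector_space.intro)
  fix a b :: complex and f g :: "'a \<Rightarrow> complex"
  show "fun_scale a (f + g) = fun_scale a f + fun_scale a g"
    by (rule ext) (simp add: fun_scale_def distrib_left)
  show "fun_scale (a + b) f = fun_scale a f + fun_scale b f"
    by (rule ext) (simp add: fun_scale_def distrib_right)
  show "fun_scale a (fun_scale b f) = fun_scale (a * b) f"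
    by (rule ext) (simp add: fun_scale_def)
  show "fun_scale 1 f = f"
    by (rule ext) (simp add: fun_scale_def)
qed

text \<open>Vectors indexed by the set \<open>B\<close>, realised as functions vanishing off
  \<open>B\<close>, so that the dimension theory of \<open>fun_scale\<close> applies to coordinates
  as well.\<close>

lemma coordinate_space:
  fixes B :: "'i set"
  assumes B: "finite B"
  defines "V \<equiv> {c :: 'i \<Rightarrow> complex. \<forall>i. i \<notin> B \<longrightarrow> c i = 0}"
    and "e \<equiv> \<lambda>i j. if j = i then 1 else (0 :: complex)"
  shows "fun_space.subspace V" and "V \<subseteq> fun_space.span (e ` B)" and "fun_space.dim V = card B" and "e ` B \<subseteq> V"
    and "inj_on e B"
proof -
  show sub: "fun_space.subspace V"
    by (rule fun_space.subspaceI) (auto simp: V_def fun_scale_def)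
  show inj: "inj_on e B"
    by (rule inj_onI) (metis e_def zero_neq_one)
  show eV: "e ` B \<subseteq> V" by (auto simp: V_def e_def)
  have expand: "(\<Sum>i\<in>B. fun_scale (c i) (e i)) j = (if j \<in> B then c j else 0)" for c j
  proof -
    have "(\<Sum>i\<in>B. fun_scale (c i) (e i)) j = (\<Sum>i\<in>B. fun_scale (c i) (e i) j)"
      by (induction B rule: infinite_finite_induct) auto
    also have "\<dots> = (\<Sum>i\<in>B. if i = j then c j else 0)"
      by (intro sum.cong) (auto simp: fun_scale_def e_def)
    finally show ?thesis using B by simp
  qed
  show span: "V \<subseteq> fun_space.span (e ` B)"
  proof
    fix c assume "c \<in> V"
    then have "c = (\<Sum>i\<in>B. fun_scale (c i) (e i))"
      by (intro ext) (simp add: expand, simp add: V_def)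
    also have "\<dots> \<in> fun_space.span (e ` B)"
      by (intro fun_space.span_sum fun_space.span_scale fun_space.span_base) auto
    finally show "c \<in> fun_space.span (e ` B)" .
  qed
  have "fun_space.independent (e ` B)"
  proof (rule fun_space.independent_if_scalars_zero)
    show "finite (e ` B)" using B by simp
    fix u x assume u: "(\<Sum>x\<in>e ` B. fun_scale (u x) x) = 0" and x: "x \<in> e ` B"
    then obtain j where j: "j \<in> B" "x = e j" by blast
    have "(\<Sum>x\<in>e ` B. fun_scale (u x) x) = (\<Sum>i\<in>B. fun_scale (u (e i)) (e i))"
      using inj by (simp add: sum.reindex)
    then have "(\<Sum>i\<in>B. fun_scale (u (e i)) (e i)) j = 0" using u by simp
    then show "u x = 0" using j by (simp add: expand)
  qed
  then have "card (e ` B) = fun_space.dim V"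
    using fun_space.basis_card_eq_dim eV span by blast
  then show "fun_space.dim V = card B"
    using inj by (simp add: card_image)
qed

text \<open>
  In the situation below \<open>S\<close> is a finitely generated ideal of germs and the \<open>b i\<close> represent a basis of
  \<open>S\<close> modulo its product with the maximal ideal; \<open>\<phi>\<close> is the coordinate map of that quotient.
\<close>

lemma minimal_generators_card:
  fixes w :: "complex^'n::finite" and b :: "'i \<Rightarrow> complex^'n \<Rightarrow> complex"
  assumes F: "finite F" "\<And>f. f \<in> F \<Longrightarrow> hol_at w f" and S: "S = ocomb w F"
    and B: "finite B" "\<And>i. i \<in> B \<Longrightarrow> b i \<in> S"
    and gen: "\<And>f. f \<in> S \<Longrightarrow> \<exists>c. (\<lambda>z. f z - (\<Sum>i\<in>B. c i * b i z)) \<in> mcomb w F"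
    and ind: "\<And>c. (\<lambda>z. \<Sum>i\<in>B. c i * b i z) \<in> mcomb w F \<Longrightarrow> \<forall>i\<in>B. c i = 0"
  shows "\<exists>G. minimal_generators (germ_ring w) (germ w ` S) G"
    and "minimal_generators (germ_ring w) (germ w ` S) G \<Longrightarrow> finite G \<and> card G = card B"
proof -
  define V where "V = {c :: 'i \<Rightarrow> complex. \<forall>i. i \<notin> B \<longrightarrow> c i = 0}"
  define e where "e = (\<lambda>i j :: 'i. if j = i then 1 else (0 :: complex))"
  note V = coordinate_space[OF B(1), folded V_def e_def]
  let ?comb = "\<lambda>c z. \<Sum>i\<in>B. c i * b i z"
  have S_hol: "hol_at w f" if "f \<in> S" for f
    using that F(2) unfolding S by (rule ocomb_hol_at)
  have comb_S: "?comb c \<in> S" for c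
    unfolding S using B(2) by (intro ocomb_sum ocomb_mult hol_at_const) (auto simp: S)
  have S_cong: "g \<in> S" if "f \<in> S" "\<forall>\<^sub>F z in nhds w. g z = f z" for f g
    using that unfolding S by (rule lcomb_cong)
  \<comment> \<open>\<open>C f c\<close> says that \<open>c\<close> is the coordinate vector of
    \<open>f\<close> in the quotient; vanishing off \<open>B\<close> makes it unique.\<close>
  define C where "C f c \<longleftrightarrow> c \<in> V \<and> (\<lambda>z. f z - ?comb c z) \<in> mcomb w F" for f c
  have C_V: "c \<in> V" and C_diff: "(\<lambda>z. f z - ?comb c z) \<in> mcomb w F" if "C f c" for f c
    using that by (simp_all add: C_def)
  have C_ex: "\<exists>c. C f c" if f: "f \<in> S" for f
  proof -
    obtain c where c: "(\<lambda>z. f z - ?comb c z) \<in> mcomb w F" using gen[OF f] by blast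
    have "?comb (\<lambda>i. if i \<in> B then c i else 0) = ?comb c"
      by (intro ext sum.cong) auto
    then have "C f (\<lambda>i. if i \<in> B then c i else 0)"
      using c unfolding C_def by (simp add: V_def)
    then show ?thesis by blast
  qed
  have C_unique: "c = d" if "C f c" "C f d" for f c d
  proof -
    have "(\<lambda>z. (f z - ?comb d z) - (f z - ?comb c z)) \<in> mcomb w F"
      by (rule mcomb_diff[OF C_diff[OF that(2)] C_diff[OF that(1)]])
    moreover have "(\<lambda>z. (f z - ?comb d z) - (f z - ?comb c z)) = ?comb (\<lambda>i. c i - d i)"
      by (simp add: fun_eq_iff left_diff_distrib sum_subtractf)
    ultimately have "\<forall>i\<in>B. c i - d i = 0" using ind by metis
    moreover have "\<forall>i. i \<notin> B \<longrightarrow> c i = 0" "\<forall>i. i \<notin> B \<longrightarrow> d i = 0"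
      using C_V[OF that(1)] C_V[OF that(2)] by (simp_all add: V_def)
    ultimately show ?thesis by (intro ext) (metis right_minus_eq)
  qed
  define \<phi> where "\<phi> f = (THE c. C f c)" for f
  have \<phi>I: "\<phi> f = c" if "C f c" for f c
    unfolding \<phi>_def using that C_unique by blast
  have \<phi>C: "C f (\<phi> f)" if "f \<in> S" for f
    using C_ex[OF that] \<phi>I by metis
  have \<phi>V: "\<phi> f \<in> V" if "f \<in> S" for f
    using \<phi>C[OF that] by (simp add: C_def)
  have \<phi>_cong: "\<phi> g = \<phi> f" if f: "f \<in> S" and eq: "\<forall>\<^sub>F z in nhds w. g z = f z" for f g
  proof (rule \<phi>I)
    have "\<forall>\<^sub>F z in nhds w. g z - ?comb (\<phi> f) z = f z - ?comb (\<phi> f) z"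
      using eq by eventually_elim simp
    then have "(\<lambda>z. g z - ?comb (\<phi> f) z) \<in> mcomb w F"
      by (rule lcomb_cong[OF C_diff[OF \<phi>C[OF f]]])
    then show "C g (\<phi> f)" using C_V[OF \<phi>C[OF f]] by (simp add: C_def)
  qed
  have \<phi>_add: "\<phi> (\<lambda>z. f z + g z) = \<phi> f + \<phi> g" if "f \<in> S" "g \<in> S" for f g
  proof (rule \<phi>I)
    have "(\<lambda>z. (f z - ?comb (\<phi> f) z) + (g z - ?comb (\<phi> g) z)) \<in> mcomb w F"
      by (rule lcomb_add[OF C_diff[OF \<phi>C[OF that(1)]] C_diff[OF \<phi>C[OF that(2)]]])
    moreover have "(\<lambda>z. (f z - ?comb (\<phi> f) z) + (g z - ?comb (\<phi> g) z)) = (\<lambda>z. (f z + g z) - ?comb (\<phi> f + \<phi> g) z)"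
      by (simp add: fun_eq_iff distrib_right sum.distrib)
    moreover have "\<phi> f + \<phi> g \<in> V"
      using \<phi>V that V(1) by (intro fun_space.subspace_add) auto
    ultimately show "C (\<lambda>z. f z + g z) (\<phi> f + \<phi> g)" unfolding C_def by simp
  qed
  \<comment> \<open>On the quotient a germ acts through its value at \<open>w\<close>, since
    \<open>a - a w\<close> multiplies \<open>S\<close> into the product with the maximal
    ideal.\<close>
  have \<phi>_mult: "\<phi> (\<lambda>z. a z * f z) = fun_scale (a w) (\<phi> f)" if f: "f \<in> S" and a: "hol_at w a" for a f
  proof (rule \<phi>I)
    have "(\<lambda>z. a z * (f z - ?comb (\<phi> f) z)) \<in> mcomb w F"
      by (rule mcomb_mult[OF a C_diff[OF \<phi>C[OF f]]])
    moreover have "hol_vanish w (\<lambda>z. a z - a w)"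
      using a unfolding hol_vanish_def by (auto intro: hol_at_diff hol_at_const)
    then have "(\<lambda>z. (a z - a w) * ?comb (\<phi> f) z) \<in> mcomb w F"
      using comb_S unfolding S by (rule ocomb_vanish_mult)
    ultimately have "(\<lambda>z. a z * (f z - ?comb (\<phi> f) z) + (a z - a w) * ?comb (\<phi> f) z) \<in> mcomb w F"
      by (rule lcomb_add)
    moreover have "(\<lambda>z. a z * (f z - ?comb (\<phi> f) z) + (a z - a w) * ?comb (\<phi> f) z) =
        (\<lambda>z. a z * f z - ?comb (fun_scale (a w) (\<phi> f)) z)"
    proof
      fix z
      have "?comb (fun_scale (a w) (\<phi> f)) z = a w * ?comb (\<phi> f) z"
        by (simp only: fun_scale_def sum_distrib_left mult.assoc)
      moreover have "u * (v - x) + (u - y) * x = u * v - y * x" for x y u v :: complex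
        by (simp add: algebra_simps)
      ultimately show "a z * (f z - ?comb (\<phi> f) z) + (a z - a w) * ?comb (\<phi> f) z =
          a z * f z - ?comb (fun_scale (a w) (\<phi> f)) z"
        by (simp only:)
    qed
    moreover have "fun_scale (a w) (\<phi> f) \<in> V"
      using \<phi>V[OF f] V(1) by (intro fun_space.subspace_scale) auto
    ultimately show "C (\<lambda>z. a z * f z) (fun_scale (a w) (\<phi> f))" unfolding C_def by simp
  qed
  have zero_S: "(\<lambda>z. 0) \<in> S" unfolding S by (rule lcomb_zero) simp
  have \<phi>_zero: "\<phi> (\<lambda>z. 0) = 0"
    using \<phi>_mult[OF zero_S hol_at_const[of w 0]] by (simp add: fun_scale_def zero_fun_def)
  have \<phi>_b: "\<phi> (b i) = e i" if i: "i \<in> B" for i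
  proof (rule \<phi>I)
    have "?comb (e i) z = b i z" for z
    proof -
      have "?comb (e i) z = (\<Sum>j\<in>B. if j = i then b i z else 0)"
        by (intro sum.cong) (auto simp: e_def)
      then show ?thesis using i B(1) by simp
    qed
    then show "C (b i) (e i)"
      unfolding C_def using V(4) i by (auto intro: lcomb_zero)
  qed
  have comb_sub: "ocomb w X \<subseteq> S" if "X \<subseteq> S" for X
    using that unfolding S by (rule ocomb_trans)
  have gen_imp: "V \<subseteq> fun_space.span (\<phi> ` X)" if X: "X \<subseteq> S" "S \<subseteq> ocomb w X" for X
  proof -
    have "\<phi> h \<in> fun_space.span (\<phi> ` X) \<and> h \<in> S" if "h \<in> ocomb w X" for h
      using that
    proof induction
      case (lcomb_zero h)
      have "\<phi> h = \<phi> (\<lambda>z. 0)" "h \<in> S"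
        by (rule \<phi>_cong[OF zero_S lcomb_zero], rule S_cong[OF zero_S lcomb_zero])
      then show ?case using fun_space.span_zero[of "\<phi> ` X"] by (simp only: \<phi>_zero simp_thms)
    next
      case (lcomb_step h a x g)
      have x: "x \<in> S" using lcomb_step(3) X(1) by blast
      then have ax: "(\<lambda>z. a z * x z) \<in> S" using lcomb_step(2) unfolding S by (intro ocomb_mult)
      then have hax: "(\<lambda>z. h z + a z * x z) \<in> S"
        using lcomb_step(5) unfolding S by (intro lcomb_add) auto
      have "\<phi> g = \<phi> h + fun_scale (a w) (\<phi> x)"
        using \<phi>_cong[OF hax lcomb_step(4)] \<phi>_add[of h, OF _ ax] \<phi>_mult[OF x lcomb_step(2)] lcomb_step(5) by simp
      moreover have "\<dots> \<in> fun_space.span (\<phi> ` X)"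
        using lcomb_step(5) by (intro fun_space.span_add fun_space.span_scale fun_space.span_base[OF imageI[OF lcomb_step(3)]]) simp
      ultimately show ?case by (simp only: S_cong[OF hax lcomb_step(4)] simp_thms)
    qed
    then have "e ` B \<subseteq> fun_space.span (\<phi> ` X)"
      using B(2) X(2) \<phi>_b by fastforce
    then have "fun_space.span (e ` B) \<subseteq> fun_space.span (\<phi> ` X)"
      by (intro fun_space.span_minimal) auto
    then show ?thesis using V(2) by blast
  qed
  \<comment> \<open>Nakayama's lemma: each \<open>f\<close> in \<open>F\<close> differs from a
    combination of \<open>X\<close> with the same coordinates by an element of
    \<open>mcomb w F\<close>.\<close>
  have imp_gen: "S \<subseteq> ocomb w X" if X: "X \<subseteq> S" "V \<subseteq> fun_space.span (\<phi> ` X)" for X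
  proof -
    have lift: "\<exists>t\<in>ocomb w X. \<phi> t = v" if "v \<in> fun_space.span (\<phi> ` X)" for v
      using that
    proof (induction rule: fun_space.span_induct_alt)
      case base
      show ?case by (rule bexI[of _ "\<lambda>z. 0"], rule \<phi>_zero, rule lcomb_zero) simp
    next
      case (step c v v')
      then obtain x t where xt: "x \<in> X" "v = \<phi> x" "t \<in> ocomb w X" "v' = \<phi> t" by blast
      then have inS: "x \<in> S" "t \<in> S" using X(1) comb_sub[OF X(1)] by auto
      have cx: "(\<lambda>z. c * x z) \<in> ocomb w X" by (intro ocomb_mult hol_at_const ocomb_base xt(1))
      have "\<phi> (\<lambda>z. c * x z + t z) = fun_scale c v + v'"
        using \<phi>_add[of "\<lambda>z. c * x z" t] \<phi>_mult[OF inS(1) hol_at_const] cx comb_sub[OF X(1)] inS xt(2,4) by auto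
      then show ?case using lcomb_add[OF cx xt(3)] by blast
    qed
    have "F \<subseteq> ocomb w X"
    proof (rule nakayama[OF F(1)])
      fix f assume f: "f \<in> F"
      then have fS: "f \<in> S" unfolding S by (rule ocomb_base)
      then obtain t where t: "t \<in> ocomb w X" "\<phi> t = \<phi> f" using lift \<phi>V X(2) by blast
      then have tS: "t \<in> S" using comb_sub[OF X(1)] by blast
      have "(\<lambda>z. (f z - ?comb (\<phi> f) z) - (t z - ?comb (\<phi> t) z)) \<in> mcomb w F"
        by (rule mcomb_diff[OF C_diff[OF \<phi>C[OF fS]] C_diff[OF \<phi>C[OF tS]]])
      then have "(\<lambda>z. f z - t z) \<in> mcomb w F" by (simp add: t(2))
      then show "\<exists>t\<in>ocomb w X. \<exists>m\<in>mcomb w F. \<forall>\<^sub>F z in nhds w. f z = t z + m z"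
        using t(1) by (intro bexI[of _ t] bexI[of _ "\<lambda>z. f z - t z"]) auto
    qed
    then show ?thesis unfolding S by (rule ocomb_trans)
  qed
  \<comment> \<open>Generating the ideal is the same as lying in \<open>S\<close> and spanning
    \<open>V\<close>, so minimality becomes a question of linear algebra.\<close>
  have genideal_iff: "genideal (germ_ring w) (germ w ` X) = germ w ` S \<longleftrightarrow> X \<subseteq> S \<and> V \<subseteq> fun_space.span (\<phi> ` X)"
    if X: "\<And>x. x \<in> X \<Longrightarrow> hol_at w x" for X
  proof -
    have "germ w ` ocomb w X = germ w ` S \<longleftrightarrow> ocomb w X = S"
    proof
      assume eq: "germ w ` ocomb w X = germ w ` S"
      show "ocomb w X = S"
      proof
        show "ocomb w X \<subseteq> S"
        proof
          fix h assume "h \<in> ocomb w X"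
          then obtain g where "g \<in> S" "germ w h = germ w g" using eq by blast
          then show "h \<in> S" using S_cong germ_eq_iff by blast
        qed
        show "S \<subseteq> ocomb w X"
        proof
          fix h assume "h \<in> S"
          then obtain g where "g \<in> ocomb w X" "germ w h = germ w g" using eq by blast
          then show "h \<in> ocomb w X" using lcomb_cong germ_eq_iff by blast
        qed
      qed
    qed simp
    also have "\<dots> \<longleftrightarrow> X \<subseteq> S \<and> V \<subseteq> fun_space.span (\<phi> ` X)"
      using gen_imp imp_gen comb_sub ocomb_base by (metis order_antisym subset_iff)
    finally show ?thesis by (simp add: genideal_germs[OF X])
  qed
  have b_hol: "hol_at w x" if "x \<in> b ` B" for x using that B(2) S_hol by auto
  have \<phi>bB: "\<phi> ` b ` B = e ` B" using \<phi>_b by (force simp: image_image)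
  have "minimal_generators (germ_ring w) (germ w ` S) (germ w ` b ` B)"
    unfolding minimal_generators_def
  proof (intro conjI allI impI)
    show "germ w ` b ` B \<subseteq> carrier (germ_ring w)" using b_hol by auto
    show "genideal (germ_ring w) (germ w ` b ` B) = germ w ` S"
    proof (rule genideal_iff[THEN iffD2])
      show "b ` B \<subseteq> S \<and> V \<subseteq> fun_space.span (\<phi> ` b ` B)"
        unfolding \<phi>bB using B(2) V(2) by blast
    qed (rule b_hol)
    fix G' assume G': "G' \<subset> germ w ` b ` B"
    \<comment> \<open>Indices are selected through their germs; a proper subset of germs forces a
      proper subset of indices, hence too few vectors to span \<open>V\<close>.\<close>
    define B' where "B' = {i\<in>B. germ w (b i) \<in> G'}"
    have G'_eq: "G' = germ w ` b ` B'" using G' unfolding B'_def by blast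
    have "B' \<subseteq> B" unfolding B'_def by blast
    moreover have "B' \<noteq> B" using G' G'_eq by blast
    ultimately have "B' \<subset> B" by blast
    then have card: "card B' < card B" using B(1) by (rule psubset_card_mono[rotated])
    have fB': "finite B'" using B(1) by (simp add: B'_def)
    show "genideal (germ_ring w) G' \<noteq> germ w ` S"
    proof
      assume "genideal (germ_ring w) G' = germ w ` S"
      then have "V \<subseteq> fun_space.span (\<phi> ` b ` B')"
        unfolding G'_eq by (rule genideal_iff[THEN iffD1, THEN conjunct2, rotated])
          (auto intro: b_hol simp: B'_def)
      then have "fun_space.dim V \<le> card (\<phi> ` b ` B')"
        using fB' by (intro fun_space.dim_le_card) auto
      also have "\<dots> \<le> card B'"
        using fB' by (metis card_image_le finite_imageI order_trans)
      finally show False using card V(3) by simp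
    qed
  qed
  then show "\<exists>G. minimal_generators (germ_ring w) (germ w ` S) G" by blast
  assume G: "minimal_generators (germ_ring w) (germ w ` S) G"
  define X where "X = (\<lambda>g. SOME f. hol_at w f \<and> germ w f = g) ` G"
  have rep: "hol_at w (SOME f. hol_at w f \<and> germ w f = g) \<and> germ w (SOME f. hol_at w f \<and> germ w f = g) = g"
    if "g \<in> G" for g
  proof (rule someI_ex[of "\<lambda>f. hol_at w f \<and> germ w f = g"])
    have "g \<in> carrier (germ_ring w)" using G that unfolding minimal_generators_def by blast
    then show "\<exists>f. hol_at w f \<and> germ w f = g" by (auto elim: germ_ring_carrierE)
  qed
  have X_hol: "hol_at w x" if "x \<in> X" for x using that rep by (auto simp: X_def)
  have X_germ: "germ w ` X = G" using rep by (force simp: X_def image_image)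
  have X_inj: "inj_on (germ w) X" using rep by (auto simp: X_def inj_on_def)
  have "genideal (germ_ring w) (germ w ` X) = germ w ` S"
    using G unfolding minimal_generators_def X_germ by blast
  then have "X \<subseteq> S \<and> V \<subseteq> fun_space.span (\<phi> ` X)"
    by (rule iffD1[OF genideal_iff, rotated]) (rule X_hol)
  then have XS: "X \<subseteq> S" "V \<subseteq> fun_space.span (\<phi> ` X)" by auto
  \<comment> \<open>A basis \<open>D\<close> extracted from the coordinates comes from a subset
    \<open>X'\<close> of \<open>X\<close> that still generates. Minimality of \<open>G\<close>
    forces \<open>X' = X\<close>, so \<open>X\<close> has as many elements as a basis of
    \<open>V\<close>.\<close>
  obtain D where D: "D \<subseteq> \<phi> ` X" "fun_space.independent D" "\<phi> ` X \<subseteq> fun_space.span D"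
    using fun_space.maximal_independent_subset by blast
  obtain X' where X': "X' \<subseteq> X" "inj_on \<phi> X'" "D = \<phi> ` X'"
    using D(1) subset_image_inj[of D \<phi> X] by blast
  have VD: "V \<subseteq> fun_space.span D"
    using XS(2) D(3) fun_space.span_minimal[of "\<phi> ` X" "fun_space.span D"] by auto
  have "genideal (germ_ring w) (germ w ` X') = germ w ` S"
  proof (rule genideal_iff[THEN iffD2])
    show "X' \<subseteq> S \<and> V \<subseteq> fun_space.span (\<phi> ` X')"
      using X'(1) XS(1) VD unfolding X'(3) by blast
  qed (use X'(1) X_hol in blast)
  moreover have "germ w ` X' \<subseteq> G" using X'(1) X_germ by blast
  ultimately have "germ w ` X' = G" using G unfolding minimal_generators_def by (metis psubsetI)
  then have X'X: "X' = X" using X_inj X'(1) X_germ by (metis inj_on_image_eq_iff subset_refl)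
  have DV: "D \<subseteq> V" using D(1) XS(1) \<phi>V by blast
  then have "card D = card B" using fun_space.basis_card_eq_dim[OF DV VD D(2)] V(3) by simp
  moreover have "finite D"
    using fun_space.independent_span_bound[of "e ` B" D] B(1) D(2) DV V(2) by auto
  moreover have "card D = card G" "finite D \<longleftrightarrow> finite G"
    using X'(2,3) X'X X_inj X_germ by (metis card_image, metis finite_image_iff)
  ultimately show "finite G \<and> card G = card B" by simp
qed

section \<open>The fibre of an ideal at a point\<close>

text \<open>The coefficient estimate with bound 0. That one torus suffices matters for polynomials
  known only on \<Omega>.\<close>

lemma poly_eval_eq_0_imp:
  fixes p :: "('n::finite) cpoly"
  assumes r: "0 < r" and 0: "\<And>z. (\<And>j. cmod (z $ j) = r) \<Longrightarrow> poly_eval p z = 0"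
  shows "p = 0"
proof (rule poly_mapping_eqI)
  fix a
  have "cmod (lookup p a) * r ^ mon_degree a \<le> 0"
    by (rule poly_coeff_bound[OF r]) (simp add: 0)
  then show "lookup p a = lookup 0 a"
    using zero_less_power[OF r, of "mon_degree a"] by (simp add: mult_le_0_iff)
qed

lemma poly_eval_inject: "(\<And>z. poly_eval p z = poly_eval q z) \<Longrightarrow> p = q"
  using poly_eval_eq_0_imp[of 1 "p - q"] by simp

text \<open>Specified through its values, which determine a polynomial, so that the laws of
  translation can be checked pointwise.\<close>

definition translate :: "complex^('n::finite) \<Rightarrow> 'n cpoly \<Rightarrow> 'n cpoly" where
  "translate w p = (SOME q. \<forall>z. poly_eval q z = poly_eval p (z + w))"

lemma poly_eval_translate [simp]: "poly_eval (translate w p) z = poly_eval p (z + w)"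
  using someI_ex[OF poly_compose_translate[of p w]] unfolding translate_def by blast

lemma translate_mult: "translate w (p * q) = translate w p * translate w q"
  and translate_add: "translate w (p + q) = translate w p + translate w q"
  and translate_0: "translate w 0 = 0"
  and translate_translate: "translate w (translate (- w) p) = p"
  by (rule poly_eval_inject; simp)+

lemma poly_ideal_translate:
  assumes I: "poly_ideal I"
  shows "poly_ideal (translate w ` I)"
proof (rule poly_idealI)
  show "0 \<in> translate w ` I" using poly_ideal_0[OF I] translate_0 by (metis imageI)
next
  fix p q assume "p \<in> translate w ` I" "q \<in> translate w ` I"
  then obtain p' q' where "p' \<in> I" "q' \<in> I" "p = translate w p'" "q = translate w q'" by blast
  then show "p + q \<in> translate w ` I"
    using poly_ideal_add[OF I] by (metis imageI translate_add)
next
  fix p q assume "q \<in> translate w ` I"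
  then obtain q' where q': "q' \<in> I" "q = translate w q'" by blast
  have "p * q = translate w (translate (- w) p * q')"
    by (simp add: translate_mult translate_translate q'(2))
  then show "p * q \<in> translate w ` I"
    using poly_ideal_mult[OF I q'(1)] by (metis imageI)
qed

text \<open>The product of \<open>J\<close> with the maximal ideal at 0. The variables generate that
  ideal, and for an ideal \<open>J\<close> one cofactor per variable is enough.\<close>

definition max_ideal_times :: "('n::finite) cpoly set \<Rightarrow> 'n cpoly set" where
  "max_ideal_times J = {\<Sum>j\<in>UNIV. var_poly j * q j | q. \<forall>j. q j \<in> J}"

lemma max_ideal_times_ideal:
  assumes J: "poly_ideal J"
  shows "poly_ideal (max_ideal_times J)"
proof (rule poly_idealI)
  show "0 \<in> max_ideal_times J"
    unfolding max_ideal_times_def using poly_ideal_0[OF J] by (auto intro!: exI[of _ "\<lambda>_. 0"])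
next
  fix p q assume "p \<in> max_ideal_times J" "q \<in> max_ideal_times J"
  then obtain u v where uv: "\<forall>j. u j \<in> J" "\<forall>j. v j \<in> J" "p = (\<Sum>j\<in>UNIV. var_poly j * u j)" "q = (\<Sum>j\<in>UNIV. var_poly j * v j)"
    unfolding max_ideal_times_def by blast
  then have "p + q = (\<Sum>j\<in>UNIV. var_poly j * (u j + v j))"
    by (simp add: distrib_left sum.distrib)
  moreover have "\<forall>j. u j + v j \<in> J" using uv poly_ideal_add[OF J] by blast
  ultimately show "p + q \<in> max_ideal_times J"
    unfolding max_ideal_times_def by (intro CollectI exI[of _ "\<lambda>j. u j + v j"] conjI)
next
  fix p q assume "q \<in> max_ideal_times J"
  then obtain v where v: "\<forall>j. v j \<in> J" "q = (\<Sum>j\<in>UNIV. var_poly j * v j)"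
    unfolding max_ideal_times_def by blast
  then have "p * q = (\<Sum>j\<in>UNIV. var_poly j * (p * v j))"
    by (simp only: sum_distrib_left mult.left_commute)
  moreover have "\<forall>j. p * v j \<in> J" using v poly_ideal_mult[OF J] by blast
  ultimately show "p * q \<in> max_ideal_times J"
    unfolding max_ideal_times_def by (intro CollectI exI[of _ "\<lambda>j. p * v j"] conjI)
qed

lemma max_ideal_times_subset: "poly_ideal J \<Longrightarrow> max_ideal_times J \<subseteq> J"
  unfolding max_ideal_times_def by (auto intro: poly_ideal_sum poly_ideal_mult)

lemma var_mult_in_max_ideal_times:
  assumes J: "poly_ideal J" and q: "q \<in> J"
  shows "var_poly j * q \<in> max_ideal_times J"
proof -
  have "(\<Sum>i\<in>UNIV. var_poly i * (if i = j then q else 0)) = (\<Sum>i\<in>UNIV. if i = j then var_poly j * q else 0)"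
    by (intro sum.cong) auto
  then have "(\<Sum>i\<in>UNIV. var_poly i * (if i = j then q else 0)) = var_poly j * q" by simp
  moreover have "\<forall>i. (if i = j then q else 0) \<in> J" using q poly_ideal_0[OF J] by simp
  ultimately show ?thesis
    unfolding max_ideal_times_def by (intro CollectI exI[of _ "\<lambda>i. if i = j then q else 0"] conjI) simp_all
qed

text \<open>Every monomial other than 1 contains a variable and maps \<open>J\<close> into
  \<open>max_ideal_times J\<close>. So ideal generators of \<open>J\<close> span the fibre over the
  complex numbers.\<close>

lemma mult_congruent_constant:
  fixes J :: "('n::finite) cpoly set"
  assumes J: "poly_ideal J" and g: "g \<in> J"
  shows "u * g - const_poly (poly_eval u 0) * g \<in> max_ideal_times J"
proof -
  note W = max_ideal_times_ideal[OF J]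
  have mono: "single a k * g - const_poly (poly_eval (single a k) 0) * g \<in> max_ideal_times J" for a k
  proof (cases "a = 0")
    case True
    then show ?thesis using poly_ideal_0[OF W] by (simp add: const_poly_def)
  next
    case False
    then obtain j where j: "lookup a j \<noteq> 0"
      by (metis lookup_zero poly_mapping_eqI)
    have "mon_eval a (0 :: complex^'n) = 0"
      unfolding mon_eval_def using j by (intro prod_zero) auto
    moreover have "a = single j 1 + (a - single j 1)"
      using j by (intro poly_mapping_eqI) (auto simp: lookup_add lookup_minus lookup_single when_def)
    then have "single a k = var_poly j * single (a - single j 1) k"
      unfolding var_poly_def by (metis mult_1 mult_single)
    then have "single a k * g = var_poly j * (single (a - single j 1) k * g)"
      by (simp only: mult.assoc)
    ultimately show ?thesis
      using var_mult_in_max_ideal_times[OF J poly_ideal_mult[OF J g]] by simp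
  qed
  let ?s = "\<Sum>a\<in>keys u. single a (lookup u a)"
  have const_sum: "const_poly (\<Sum>a\<in>S. f a) = (\<Sum>a\<in>S. const_poly (f a))" for S :: "('n \<Rightarrow>\<^sub>0 nat) set" and f
    by (rule poly_eval_inject) simp
  have "?s * g - const_poly (poly_eval ?s 0) * g =
    (\<Sum>a\<in>keys u. single a (lookup u a) * g -
      const_poly (poly_eval (single a (lookup u a)) 0) * g)"
    by (simp only: poly_eval_sum const_sum sum_distrib_right sum_subtractf)
  also have "\<dots> \<in> max_ideal_times J"
    by (rule poly_ideal_sum[OF W mono])
  finally show ?thesis by (simp only: poly_mapping_sum_single[symmetric])
qed

text \<open>Representatives in \<open>J\<close> of a basis of the quotient by
  \<open>max_ideal_times J\<close>, with congruences in place of a quotient space.\<close>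

definition fibre_basis :: "('n::finite) cpoly set \<Rightarrow> 'n cpoly set \<Rightarrow> bool" where
  "fibre_basis J B \<longleftrightarrow> finite B \<and> B \<subseteq> J \<and>
    (\<forall>p\<in>J. \<exists>c. p - (\<Sum>b\<in>B. const_poly (c b) * b) \<in> max_ideal_times J) \<and>
    (\<forall>c. (\<Sum>b\<in>B. const_poly (c b) * b) \<in> max_ideal_times J \<longrightarrow> (\<forall>b\<in>B. c b = 0))"

lemma fibre_basisD:
  assumes "fibre_basis J B"
  shows "finite B" and "B \<subseteq> J"
    and "p \<in> J \<Longrightarrow> \<exists>c. p - (\<Sum>b\<in>B. const_poly (c b) * b) \<in> max_ideal_times J"
    and "(\<Sum>b\<in>B. const_poly (c b) * b) \<in> max_ideal_times J \<Longrightarrow> \<forall>b\<in>B. c b = 0"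
  using assms unfolding fibre_basis_def by blast+

text \<open>Ideal generators span the fibre, and a spanning set of least size is independent, as a
  nontrivial relation would allow one element to be dropped.\<close>

lemma ex_fibre_basis:
  fixes J :: "('n::finite) cpoly set"
  assumes J: "poly_ideal J"
  shows "\<exists>B. fibre_basis J B"
proof -
  let ?W = "max_ideal_times J"
  note W = max_ideal_times_ideal[OF J]
  define P where "P B \<longleftrightarrow> finite B \<and> B \<subseteq> J \<and> (\<forall>p\<in>J. \<exists>c. p - (\<Sum>b\<in>B. const_poly (c b) * b) \<in> ?W)" for B
  obtain G where G: "finite G" "G \<subseteq> J" "ring_module.span G = J"
    using hilbert_basis[OF J] by blast
  have "P G"
    unfolding P_def
  proof (intro conjI ballI G)
    fix p assume "p \<in> J"
    then obtain u where u: "p = (\<Sum>g\<in>G. u g * g)"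
      using G(1,3) ring_module.span_finite[OF G(1)] by auto
    have "p - (\<Sum>g\<in>G. const_poly (poly_eval (u g) 0) * g) = (\<Sum>g\<in>G. u g * g - const_poly (poly_eval (u g) 0) * g)"
      by (simp only: u sum_subtractf)
    also have "\<dots> \<in> ?W"
      using G(2) by (intro poly_ideal_sum[OF W] mult_congruent_constant[OF J]) blast
    finally show "\<exists>c. p - (\<Sum>g\<in>G. const_poly (c g) * g) \<in> ?W" by (rule exI[of _ "\<lambda>g. poly_eval (u g) 0"])
  qed
  then obtain B where B: "P B" "\<And>B'. P B' \<Longrightarrow> card B \<le> card B'"
    using ex_has_least_nat[of P G card] by blast
  have "c b0 = 0" if c: "(\<Sum>b\<in>B. const_poly (c b) * b) \<in> ?W" and b0: "b0 \<in> B" for c b0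
  proof (rule ccontr)
    assume nz: "c b0 \<noteq> 0"
    have fB: "finite B" using B(1) by (simp add: P_def)
    have "P (B - {b0})"
      unfolding P_def
    proof (intro conjI ballI)
      fix p assume "p \<in> J"
      then obtain d where d: "p - (\<Sum>b\<in>B. const_poly (d b) * b) \<in> ?W"
        using B(1) unfolding P_def by blast
      define t where "t = d b0 / c b0"
      have "p - (\<Sum>b\<in>B - {b0}. const_poly (d b - t * c b) * b) = p - (\<Sum>b\<in>B. const_poly (d b - t * c b) * b)"
      proof -
        have "d b0 - t * c b0 = 0" using nz by (simp add: t_def)
        then show ?thesis
          unfolding sum.remove[OF fB b0, of "\<lambda>b. const_poly (d b - t * c b) * b"]
          by (simp only: const_poly_0 mult_zero_left add_0_left)
      qed
      also have "(\<Sum>b\<in>B. const_poly (d b - t * c b) * b) = (\<Sum>b\<in>B. const_poly (d b) * b - const_poly t * (const_poly (c b) * b))"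
        by (rule sum.cong[OF refl], rule poly_eval_inject) (simp add: algebra_simps)
      also have "\<dots> = (\<Sum>b\<in>B. const_poly (d b) * b) - const_poly t * (\<Sum>b\<in>B. const_poly (c b) * b)"
        by (simp only: sum_subtractf sum_distrib_left)
      also have "p - \<dots> = (p - (\<Sum>b\<in>B. const_poly (d b) * b)) + const_poly t * (\<Sum>b\<in>B. const_poly (c b) * b)"
        by (simp only: diff_diff_eq2 diff_add_eq)
      also have "\<dots> \<in> ?W"
        by (rule poly_ideal_add[OF W d poly_ideal_mult[OF W c]])
      finally show "\<exists>c. p - (\<Sum>b\<in>B - {b0}. const_poly (c b) * b) \<in> ?W" by (rule exI[of _ "\<lambda>b. d b - t * c b"])
    qed (use B(1) in \<open>auto simp: P_def\<close>)
    then have "card B \<le> card (B - {b0})" by (rule B(2))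
    moreover have "card (B - {b0}) < card B" using fB b0 by (rule card_Diff1_less)
    ultimately show False by simp
  qed
  then show ?thesis using B(1) unfolding P_def fibre_basis_def by blast
qed

text \<open>On the torus of radius \<open>r\<close> the coefficient estimate gives
  \<open>cmod (lookup p a) * r ^ mon_degree a \<le> D * r ^ k\<close>; small \<open>r\<close>
  excludes degrees below \<open>k\<close>.\<close>

lemma small_imp_high_degree:
  fixes p :: "('n::finite) cpoly"
  assumes small: "\<forall>\<^sub>F z in nhds w. cmod (poly_eval p (z - w)) \<le> C * norm (z - w) ^ k"
    and a: "a \<in> keys p"
  shows "k \<le> mon_degree a"
proof (rule ccontr)
  assume "\<not> k \<le> mon_degree a"
  then have lt: "mon_degree a < k" by simp
  obtain e where e: "0 < e" "\<And>z. dist z w < e \<Longrightarrow> cmod (poly_eval p (z - w)) \<le> C * norm (z - w) ^ k"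
    using small unfolding eventually_nhds_metric by blast
  define N where "N = real CARD('n)"
  define D where "D = \<bar>C\<bar> * N ^ k"
  have N: "0 < N" by (simp add: N_def)
  have D: "0 \<le> D" by (simp add: D_def N less_imp_le)
  have est: "cmod (lookup p a) \<le> D * r" if r: "0 < r" "r \<le> 1" "N * r < e" for r
  proof -
    have "cmod (lookup p a) * r ^ mon_degree a \<le> D * r ^ k"
    proof (rule poly_coeff_bound[OF r(1)])
      fix z :: "complex^'n" assume z: "\<And>j. cmod (z $ j) = r"
      have "norm z \<le> (\<Sum>j\<in>UNIV. cmod (z $ j))"
        unfolding norm_vec_def by (rule L2_set_le_sum) simp
      then have nz: "norm z \<le> N * r" by (simp add: z N_def)
      then have "cmod (poly_eval p ((z + w) - w)) \<le> C * norm ((z + w) - w) ^ k"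
        using r(3) by (intro e(2)) (simp add: dist_norm)
      also have "\<dots> \<le> \<bar>C\<bar> * (N * r) ^ k"
        using nz by (intro mult_mono power_mono) auto
      finally show "cmod (poly_eval p z) \<le> D * r ^ k" by (simp add: D_def power_mult_distrib)
    qed
    also have "D * r ^ k = D * r ^ (k - mon_degree a) * r ^ mon_degree a"
      using lt by (simp flip: power_add)
    finally have "cmod (lookup p a) \<le> D * r ^ (k - mon_degree a)"
      using r(1) by (simp add: mult_le_cancel_right)
    also have "r ^ (k - mon_degree a) \<le> r ^ 1"
      using r lt by (intro power_decreasing) auto
    finally show ?thesis using D by (simp add: mult_left_mono)
  qed
  have pos: "0 < cmod (lookup p a)" using a by (simp add: in_keys_iff)
  \<comment> \<open>The second bound keeps the torus inside the ball of radius \<open>e\<close>, the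
    third makes \<open>D * r\<close> smaller than the coefficient; \<open>D + 1\<close> avoids
    division by 0.\<close>
  define r where "r = min 1 (min (e / (2 * N)) (cmod (lookup p a) / (2 * (D + 1))))"
  have "0 < r" "r \<le> 1" "r \<le> e / (2 * N)" "r \<le> cmod (lookup p a) / (2 * (D + 1))"
    using e(1) N D pos by (auto simp: r_def)
  note r = this
  have "r * (2 * N) \<le> e"
    by (rule iffD1[OF pos_le_divide_eq r(3)]) (simp add: N)
  moreover have "N * r = r * (2 * N) / 2" by simp
  ultimately have "N * r < e" using e(1) by argo
  have "r * (2 * (D + 1)) \<le> cmod (lookup p a)"
    by (rule iffD1[OF pos_le_divide_eq r(4)]) (use D in simp)
  moreover have "r * (2 * (D + 1)) = 2 * (D * r) + 2 * r" by (simp add: algebra_simps)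
  ultimately show False using est[OF r(1,2) \<open>N * r < e\<close>] pos r(1) by argo
qed

section \<open>Comparison of the polynomial fibre with the analytic one\<close>

definition poly_at :: "complex^'n \<Rightarrow> ('n::finite) cpoly \<Rightarrow> complex^'n \<Rightarrow> complex" where
  "poly_at w p = (\<lambda>z. poly_eval p (z - w))"

lemma hol_at_poly_at: "hol_at w (poly_at v p)"
  unfolding poly_at_def by (rule hol_at_poly)

lemma mcomb_max_ideal_times:
  assumes "p \<in> max_ideal_times J"
  shows "poly_at w p \<in> mcomb w (poly_at w ` J)"
proof -
  obtain q where q: "\<And>j. q j \<in> J" "p = (\<Sum>j\<in>UNIV. var_poly j * q j)"
    using assms unfolding max_ideal_times_def by blast
  have "(\<lambda>z. \<Sum>j\<in>T. (z $ j - w $ j) * poly_at w (q j) z) \<in> mcomb w (poly_at w ` J)" if "finite T" for T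
    using that
  proof induction
    case (insert j T)
    have "hol_vanish w (\<lambda>z. z $ j - w $ j)"
      unfolding hol_vanish_def using hol_at_poly_at[of w w "var_poly j"] by (simp add: poly_at_def)
    then have "(\<lambda>z. (z $ j - w $ j) * poly_at w (q j) z) \<in> mcomb w (poly_at w ` J)"
      by (rule lcomb_base) (rule imageI[OF q(1)])
    from lcomb_add[OF this insert.IH] show ?case using insert.hyps by simp
  qed (simp add: lcomb_zero)
  from this[of UNIV] show ?thesis by (simp add: q(2) poly_at_def)
qed

text \<open>
  Taylor polynomials of the coefficients turn a relation with holomorphic coefficients into a
  polynomial relation up to terms of high degree, which the Artin--Rees lemma absorbs.
\<close>

lemma mcomb_imp_max_ideal_times:
  assumes J: "poly_ideal J" and q: "q \<in> J" "poly_at w q \<in> mcomb w (poly_at w ` J)"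
  shows "q \<in> max_ideal_times J"
proof -
  let ?W = "max_ideal_times J"
  note W = max_ideal_times_ideal[OF J] and WJ = max_ideal_times_subset[OF J]
  obtain k where k: "\<And>p. p \<in> J \<Longrightarrow> (\<forall>a\<in>keys p. k \<le> mon_degree a) \<Longrightarrow> p \<in> ?W"
    using artin_rees[OF J W WJ var_mult_in_max_ideal_times[OF J]] by blast
  have approx: "\<exists>P\<in>?W. \<exists>C. \<forall>\<^sub>F z in nhds w. cmod (h z - poly_at w P z) \<le> C * norm (z - w) ^ k"
    if "h \<in> mcomb w (poly_at w ` J)" for h
    using that
  proof induction
    case (lcomb_zero h)
    then have "\<forall>\<^sub>F z in nhds w. cmod (h z - poly_at w 0 z) \<le> 0 * norm (z - w) ^ k"
      by eventually_elim (simp add: poly_at_def)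
    then show ?case using poly_ideal_0[OF W] by blast
  next
    case (lcomb_step h a x h')
    obtain P C where P: "P \<in> ?W" "\<forall>\<^sub>F z in nhds w. cmod (h z - poly_at w P z) \<le> C * norm (z - w) ^ k"
      using lcomb_step(5) by blast
    obtain g where g: "g \<in> J" "x = poly_at w g" using lcomb_step(3) by blast
    obtain S where S: "open S" "w \<in> S" "holomorphic_several_on a S"
      using lcomb_step(2) unfolding hol_vanish_def hol_at_def by blast
    \<comment> \<open>Order \<open>Suc k\<close> rather than \<open>k\<close>: the exponent is
      positive even for \<open>k = 0\<close>, so the estimate at \<open>z = w\<close> gives
      \<open>poly_eval A 0 = a w = 0\<close>.\<close>
    obtain A E where A: "\<forall>\<^sub>F z in nhds w. cmod (a z - poly_eval A (z - w)) \<le> E * norm (z - w) ^ Suc k"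
      using taylor_polynomial[OF S(3,1,2), of "Suc k"] by blast
    have "poly_eval A 0 = 0"
      using eventually_nhds_x_imp_x[OF A] lcomb_step(2) by (simp add: hol_vanish_def)
    then have AW: "A * g \<in> ?W" using mult_congruent_constant[OF J g(1), of A] by simp
    define K where "K = cmod (x w) + 1"
    have "isCont x w"
    proof -
      have "continuous_on UNIV x"
        unfolding g(2) poly_at_def
        by (rule holomorphic_several_on_imp_continuous_on[OF holomorphic_several_poly_translate])
      then show ?thesis by (simp add: continuous_on_eq_continuous_at)
    qed
    then have "(x \<longlongrightarrow> x w) (nhds w)"
      unfolding isCont_def tendsto_at_iff_tendsto_nhds .
    then have "\<forall>\<^sub>F z in nhds w. dist (x z) (x w) < 1"
      by (rule tendstoD) simp
    then have K: "\<forall>\<^sub>F z in nhds w. cmod (x z) \<le> K"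
    proof eventually_elim
      case (elim z)
      then show ?case using norm_triangle_sub[of "x z" "x w"] by (simp add: K_def dist_norm)
    qed
    have "\<forall>\<^sub>F z in nhds w. dist z w < 1"
      by (rule eventually_nhds_metric[THEN iffD2]) (auto intro: exI[of _ 1])
    then have "\<forall>\<^sub>F z in nhds w. cmod (h' z - poly_at w (P + A * g) z) \<le> (C + \<bar>E\<bar> * K) * norm (z - w) ^ k"
      using P(2) A K lcomb_step(4)
    proof eventually_elim
      case (elim z)
      have "h' z - poly_at w (P + A * g) z = (h z - poly_at w P z) + (a z - poly_eval A (z - w)) * x z"
        using elim(5) by (simp add: g(2) poly_at_def algebra_simps)
      then have "cmod (h' z - poly_at w (P + A * g) z) \<le>
          cmod (h z - poly_at w P z) + cmod (a z - poly_eval A (z - w)) * cmod (x z)"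
        by (metis norm_mult norm_triangle_ineq)
      moreover have "cmod (a z - poly_eval A (z - w)) * cmod (x z) \<le> (\<bar>E\<bar> * norm (z - w) ^ k) * K"
      proof (rule mult_mono)
        have "cmod (a z - poly_eval A (z - w)) \<le> \<bar>E\<bar> * norm (z - w) ^ Suc k"
          using elim(3) by (rule order_trans) (rule mult_right_mono, auto)
        also have "\<dots> \<le> \<bar>E\<bar> * norm (z - w) ^ k"
          using elim(1) by (intro mult_left_mono power_decreasing) (auto simp: dist_norm)
        finally show "cmod (a z - poly_eval A (z - w)) \<le> \<bar>E\<bar> * norm (z - w) ^ k" .
      qed (use elim(4) in auto)
      moreover have "(C + \<bar>E\<bar> * K) * norm (z - w) ^ k = C * norm (z - w) ^ k + (\<bar>E\<bar> * norm (z - w) ^ k) * K"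
        by (simp add: algebra_simps)
      ultimately show ?case using elim(2) by linarith
    qed
    then show ?case using poly_ideal_add[OF W P(1) AW] by blast
  qed
  obtain P C where P: "P \<in> ?W" "\<forall>\<^sub>F z in nhds w. cmod (poly_at w q z - poly_at w P z) \<le> C * norm (z - w) ^ k"
    using approx[OF q(2)] by blast
  then have small: "\<forall>\<^sub>F z in nhds w. cmod (poly_eval (q - P) (z - w)) \<le> C * norm (z - w) ^ k"
    by (simp add: poly_at_def)
  have "q - P \<in> ?W"
  proof (rule k)
    show "q - P \<in> J" using q(1) P(1) WJ poly_ideal_diff[OF J] by blast
    show "\<forall>a\<in>keys (q - P). k \<le> mon_degree a" using small_imp_high_degree[OF small] by blast
  qed
  from poly_ideal_add[OF W this P(1)] show ?thesis by simp
qed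

text \<open>Nakayama's lemma is stated for a finite set, so the functions from \<open>J\<close> are
  replaced by finitely many generators \<open>F\<close>; this leaves both kinds of combination
  unchanged.\<close>

lemma minimal_generators_ideal:
  fixes J :: "('n::finite) cpoly set"
  assumes J: "poly_ideal J"
    and basis: "fibre_basis J B"
  shows "\<exists>G. minimal_generators (germ_ring w) (germ w ` ocomb w (poly_at w ` J)) G"
    and "minimal_generators (germ_ring w) (germ w ` ocomb w (poly_at w ` J)) G \<Longrightarrow> finite G \<and> card G = card B"
proof -
  note B = fibre_basisD[OF basis]
  obtain G0 where G0: "finite G0" "G0 \<subseteq> J" "ring_module.span G0 = J"
    using hilbert_basis[OF J] by blast
  define F where "F = poly_at w ` G0"
  have JF: "poly_at w ` J \<subseteq> ocomb w F"
  proof (rule image_subsetI)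
    fix p assume "p \<in> J"
    then have "p \<in> ring_module.span G0" by (simp add: G0(3))
    then show "poly_at w p \<in> ocomb w F"
    proof (induction rule: ring_module.span_induct_alt)
      case base
      show ?case by (rule lcomb_zero) (simp add: poly_at_def)
    next
      case (step c g p)
      have "(\<lambda>z. poly_at w c z * poly_at w g z) \<in> ocomb w F"
        using step(1) by (intro ocomb_mult hol_at_poly_at ocomb_base) (simp add: F_def)
      from lcomb_add[OF this step(2)] show ?case by (simp add: poly_at_def)
    qed
  qed
  have FJ: "F \<subseteq> poly_at w ` J" using G0(2) by (auto simp: F_def)
  have SF: "ocomb w (poly_at w ` J) = ocomb w F"
    using ocomb_trans[OF JF] lcomb_mono[OF FJ] by blast
  have mF: "mcomb w (poly_at w ` J) = mcomb w F"
    using mcomb_trans[OF JF] lcomb_mono[OF FJ] by blast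
  have comb: "(\<lambda>z. \<Sum>b\<in>B. c b * poly_at w b z) = poly_at w (\<Sum>b\<in>B. const_poly (c b) * b)" for c
    by (simp add: poly_at_def)
  have gen: "\<exists>c. (\<lambda>z. f z - (\<Sum>b\<in>B. c b * poly_at w b z)) \<in> mcomb w F" if "f \<in> ocomb w (poly_at w ` J)" for f
    using that
  proof induction
    case (lcomb_zero h)
    then have "\<forall>\<^sub>F z in nhds w. h z - (\<Sum>b\<in>B. 0 * poly_at w b z) = 0" by eventually_elim simp
    then have "(\<lambda>z. h z - (\<Sum>b\<in>B. 0 * poly_at w b z)) \<in> mcomb w F" by (rule lcomb.lcomb_zero)
    then show ?case by (rule exI[of _ "\<lambda>_. 0"])
  next
    case (lcomb_step h a x h')
    obtain c where c: "(\<lambda>z. h z - (\<Sum>b\<in>B. c b * poly_at w b z)) \<in> mcomb w F" using lcomb_step(5) by blast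
    obtain g where g: "g \<in> J" "x = poly_at w g" using lcomb_step(3) by blast
    obtain d where "g - (\<Sum>b\<in>B. const_poly (d b) * b) \<in> max_ideal_times J" using B(3)[OF g(1)] by blast
    then have "poly_at w (g - (\<Sum>b\<in>B. const_poly (d b) * b)) \<in> mcomb w F"
      unfolding mF[symmetric] by (rule mcomb_max_ideal_times)
    then have d: "(\<lambda>z. x z - (\<Sum>b\<in>B. d b * poly_at w b z)) \<in> mcomb w F"
      by (simp add: g(2) poly_at_def)
    have xF: "x \<in> ocomb w F" using g JF by blast
    have v: "hol_vanish w (\<lambda>z. a z - a w)"
      unfolding hol_vanish_def using hol_at_diff[OF lcomb_step(2) hol_at_const] by simp
    \<comment> \<open>Splits \<open>a x\<close> into \<open>a w\<close> times \<open>x\<close>,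
      which is reduced by the basis, and \<open>a - a w\<close> times \<open>x\<close>, which lies
      in \<open>mcomb w F\<close>.\<close>
    have "(\<lambda>z. (h z - (\<Sum>b\<in>B. c b * poly_at w b z)) +
        (a w * (x z - (\<Sum>b\<in>B. d b * poly_at w b z)) + (a z - a w) * x z)) \<in> mcomb w F"
      by (intro lcomb_add c mcomb_mult hol_at_const d ocomb_vanish_mult v xF)
    moreover have "\<forall>\<^sub>F z in nhds w. h' z - (\<Sum>b\<in>B. (c b + a w * d b) * poly_at w b z) =
        (h z - (\<Sum>b\<in>B. c b * poly_at w b z)) + (a w * (x z - (\<Sum>b\<in>B. d b * poly_at w b z)) + (a z - a w) * x z)"
      using lcomb_step(4)
    proof eventually_elim
      case (elim z)
      have "(\<Sum>b\<in>B. (c b + a w * d b) * poly_at w b z) =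
          (\<Sum>b\<in>B. c b * poly_at w b z) + a w * (\<Sum>b\<in>B. d b * poly_at w b z)"
        by (simp only: distrib_right sum.distrib sum_distrib_left mult.assoc)
      moreover have "u + v * y - (s + t * r) = (u - s) + (t * (y - r) + (v - t) * y)" for u v y s t r :: complex
        by (simp add: algebra_simps)
      ultimately show ?case by (simp only: elim)
    qed
    ultimately have "(\<lambda>z. h' z - (\<Sum>b\<in>B. (c b + a w * d b) * poly_at w b z)) \<in> mcomb w F"
      by (rule lcomb_cong)
    then show ?case by (rule exI[of _ "\<lambda>b. c b + a w * d b"])
  qed
  have ind: "\<forall>b\<in>B. c b = 0" if "(\<lambda>z. \<Sum>b\<in>B. c b * poly_at w b z) \<in> mcomb w F" for c
  proof (rule B(4), rule mcomb_imp_max_ideal_times[OF J])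
    show "(\<Sum>b\<in>B. const_poly (c b) * b) \<in> J"
      using B(2) by (intro poly_ideal_sum[OF J] poly_ideal_mult[OF J]) blast
    show "poly_at w (\<Sum>b\<in>B. const_poly (c b) * b) \<in> mcomb w (poly_at w ` J)"
      using that unfolding comb mF .
  qed
  have F: "finite F" "\<And>f. f \<in> F \<Longrightarrow> hol_at w f"
    using G0(1) hol_at_poly_at by (auto simp: F_def)
  have bS: "\<And>b. b \<in> B \<Longrightarrow> poly_at w b \<in> ocomb w (poly_at w ` J)"
    using B(2) by (intro ocomb_base) blast
  note main = minimal_generators_card[where b = "poly_at w" and B = B, OF F SF B(1) bS gen ind]
  show "\<exists>G. minimal_generators (germ_ring w) (germ w ` ocomb w (poly_at w ` J)) G"
    by (rule main(1))
  show "minimal_generators (germ_ring w) (germ w ` ocomb w (poly_at w ` J)) G \<Longrightarrow> finite G \<and> card G = card B"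
    by (rule main(2))
qed

text \<open>By elimination of one functional at a time. The operations are parameters because
  complex scalars act on polynomials through \<open>const_poly\<close>. It serves to express
  coordinates on the fibre by finitely many coefficients.\<close>

lemma functional_combination:
  fixes x :: "'i \<Rightarrow> 'v \<Rightarrow> complex" and l :: "'v \<Rightarrow> complex" and add :: "'v \<Rightarrow> 'v \<Rightarrow> 'v" and scl :: "complex \<Rightarrow> 'v \<Rightarrow> 'v"
  assumes D: "finite D"
    and J: "\<And>p q. p \<in> J \<Longrightarrow> q \<in> J \<Longrightarrow> add p q \<in> J" "\<And>c p. p \<in> J \<Longrightarrow> scl c p \<in> J"
    and x: "\<And>i p q. p \<in> J \<Longrightarrow> q \<in> J \<Longrightarrow> x i (add p q) = x i p + x i q" "\<And>i c p. p \<in> J \<Longrightarrow> x i (scl c p) = c * x i p"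
    and l: "\<And>p q. p \<in> J \<Longrightarrow> q \<in> J \<Longrightarrow> l (add p q) = l p + l q" "\<And>c p. p \<in> J \<Longrightarrow> l (scl c p) = c * l p"
    and van: "\<And>q. q \<in> J \<Longrightarrow> (\<And>i. i \<in> D \<Longrightarrow> x i q = 0) \<Longrightarrow> l q = 0"
  shows "\<exists>k. \<forall>q\<in>J. l q = (\<Sum>i\<in>D. k i * x i q)"
  using D l van
proof (induction D arbitrary: l)
  case (insert i D)
  show ?case
  proof (cases "\<exists>q\<in>J. (\<forall>j\<in>D. x j q = 0) \<and> x i q \<noteq> 0")
    case False
    then have "\<exists>k. \<forall>q\<in>J. l q = (\<Sum>i\<in>D. k i * x i q)"
      by (intro insert.IH insert.prems(1,2)) (auto intro!: insert.prems(3))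
    then obtain k where k: "\<forall>q\<in>J. l q = (\<Sum>i\<in>D. k i * x i q)" by blast
    have "(\<Sum>j\<in>D. (k(i := 0)) j * x j q) = (\<Sum>j\<in>D. k j * x j q)" for q
      using insert.hyps by (intro sum.cong) auto
    then show ?thesis using k insert.hyps by (intro exI[of _ "k(i := 0)"]) simp
  next
    case True
    then obtain q0 where q0: "q0 \<in> J" "\<And>j. j \<in> D \<Longrightarrow> x j q0 = 0" "x i q0 \<noteq> 0" by blast
    \<comment> \<open>Chosen so that \<open>l - m * x i\<close> vanishes at \<open>q0\<close>;
      adding a multiple of \<open>q0\<close> then reduces to elements on which \<open>x i\<close>
      vanishes as well.\<close>
    define m where "m = l q0 / x i q0"
    have "\<exists>k. \<forall>q\<in>J. l q - m * x i q = (\<Sum>i\<in>D. k i * x i q)"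
    proof (rule insert.IH)
      fix q assume q: "q \<in> J" "\<And>j. j \<in> D \<Longrightarrow> x j q = 0"
      define c where "c = - (x i q / x i q0)"
      have cJ: "scl c q0 \<in> J" "add q (scl c q0) \<in> J" using J q0(1) q(1) by auto
      have "l (add q (scl c q0)) = 0"
      proof (rule insert.prems(3)[OF cJ(2)])
        fix j assume "j \<in> insert i D"
        then show "x j (add q (scl c q0)) = 0"
          using q q0 cJ by (auto simp: x c_def)
      qed
      then show "l q - m * x i q = 0"
        using q q0 cJ by (simp add: insert.prems(1,2) c_def m_def)
    next
      fix p q assume pq: "p \<in> J" "q \<in> J"
      show "l (add p q) - m * x i (add p q) = (l p - m * x i p) + (l q - m * x i q)"
        unfolding insert.prems(1)[OF pq] x(1)[OF pq] by (simp add: distrib_left)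
    next
      fix c p assume p: "p \<in> J"
      show "l (scl c p) - m * x i (scl c p) = c * (l p - m * x i p)"
        unfolding insert.prems(2)[OF p] x(2)[OF p] by (simp add: right_diff_distrib)
    qed
    then obtain k where k: "\<forall>q\<in>J. l q - m * x i q = (\<Sum>i\<in>D. k i * x i q)" by blast
    have "(\<Sum>j\<in>D. (k(i := m)) j * x j q) = (\<Sum>j\<in>D. k j * x j q)" for q
      using insert.hyps by (intro sum.cong) auto
    then show ?thesis using k insert.hyps by (intro exI[of _ "k(i := m)"]) (simp add: algebra_simps)
  qed
qed simp

section \<open>Hilbert spaces\<close>

context complex_hilbert_space
begin

section \<open>Inner product and norm\<close>

abbreviation nrm :: "'v \<Rightarrow> real" where "nrm \<equiv> hilbert_norm ip"

lemma H_zero: "0 \<in> H" and H_add: "f \<in> H \<Longrightarrow> g \<in> H \<Longrightarrow> f + g \<in> H"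
  and H_scale: "f \<in> H \<Longrightarrow> scale c f \<in> H" and H_diff: "f \<in> H \<Longrightarrow> g \<in> H \<Longrightarrow> f - g \<in> H"
  and H_uminus: "f \<in> H \<Longrightarrow> - f \<in> H"
  using subspace_H by (auto intro: subspace_0 subspace_add subspace_scale subspace_diff subspace_neg)

lemma ip_zero_left: "g \<in> H \<Longrightarrow> ip 0 g = 0"
  using ip_add[of 0 0 g] H_zero by simp

lemma ip_uminus: "f \<in> H \<Longrightarrow> g \<in> H \<Longrightarrow> ip (- f) g = - ip f g"
  using ip_add[of f "- f" g] H_uminus[of f] ip_zero_left[of g] by (simp add: eq_neg_iff_add_eq_0 add.commute)

lemma ip_diff: "f \<in> H \<Longrightarrow> g \<in> H \<Longrightarrow> h \<in> H \<Longrightarrow> ip (f - g) h = ip f h - ip g h"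
  using ip_add[of f "- g" h] ip_uminus[of g h] H_uminus[of g] by simp

lemma ip_add_right: "f \<in> H \<Longrightarrow> g \<in> H \<Longrightarrow> h \<in> H \<Longrightarrow> ip h (f + g) = ip h f + ip h g"
  using ip_cnj[of "f + g" h] ip_cnj[of f h] ip_cnj[of g h] by (simp add: ip_add H_add)

lemma ip_scale_right: "f \<in> H \<Longrightarrow> g \<in> H \<Longrightarrow> ip g (scale c f) = cnj c * ip g f"
  using ip_cnj[of "scale c f" g] ip_cnj[of f g] by (simp add: ip_scale H_scale)

lemma ip_zero_right: "g \<in> H \<Longrightarrow> ip g 0 = 0"
  using ip_cnj[of 0 g] H_zero ip_zero_left by simp

lemma ip_diff_right: "f \<in> H \<Longrightarrow> g \<in> H \<Longrightarrow> h \<in> H \<Longrightarrow> ip h (f - g) = ip h f - ip h g"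
  using ip_cnj[of "f - g" h] ip_cnj[of f h] ip_cnj[of g h] by (simp add: ip_diff H_diff)

lemma ip_uminus_right: "f \<in> H \<Longrightarrow> g \<in> H \<Longrightarrow> ip g (- f) = - ip g f"
  using ip_cnj[of "- f" g] ip_cnj[of f g] by (simp add: ip_uminus H_uminus)

lemma ip_self: "f \<in> H \<Longrightarrow> ip f f = of_real ((nrm f)\<^sup>2)"
proof -
  assume f: "f \<in> H"
  have "Im (ip f f) = 0" using ip_cnj[OF f f] by (metis cnj.simps(2) equal_neg_zero)
  then show ?thesis
    using ip_nonneg[OF f] by (simp add: complex_eq_iff hilbert_norm_def)
qed

lemma nrm_nonneg: "f \<in> H \<Longrightarrow> 0 \<le> nrm f"
  by (simp add: hilbert_norm_def ip_nonneg)

lemma nrm_eq_0: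
  assumes f: "f \<in> H"
  shows "nrm f = 0 \<longleftrightarrow> f = 0"
proof
  assume "nrm f = 0"
  then have "ip f f = 0" using ip_self[OF f] by simp
  then show "f = 0" by (rule ip_definite[OF f])
qed (simp add: hilbert_norm_def ip_zero_left[OF H_zero])

lemma nrm_zero [simp]: "nrm 0 = 0"
  using nrm_eq_0[OF H_zero] by simp

lemma nrm_scale:
  assumes f: "f \<in> H"
  shows "nrm (scale c f) = cmod c * nrm f"
proof -
  have "ip (scale c f) (scale c f) = c * cnj c * ip f f"
    using f by (simp add: ip_scale ip_scale_right H_scale)
  then have "complex_of_real ((nrm (scale c f))\<^sup>2) = of_real ((cmod c * nrm f)\<^sup>2)"
    unfolding ip_self[OF f] ip_self[OF H_scale[OF f]] complex_norm_square[symmetric]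
    by (simp add: power_mult_distrib)
  then have "(nrm (scale c f))\<^sup>2 = (cmod c * nrm f)\<^sup>2"
    by (simp only: of_real_eq_iff)
  then show ?thesis
    by (rule power2_eq_imp_eq) (simp_all add: nrm_nonneg f H_scale)
qed

lemma nrm_uminus: "f \<in> H \<Longrightarrow> nrm (- f) = nrm f"
  using nrm_scale[of f "-1"] by (simp add: scale_minus_left)

lemma nrm_minus_commute: "f \<in> H \<Longrightarrow> g \<in> H \<Longrightarrow> nrm (f - g) = nrm (g - f)"
  using nrm_uminus[of "f - g"] H_diff by simp

lemma nrm_add_square:
  "f \<in> H \<Longrightarrow> g \<in> H \<Longrightarrow> (nrm (f + g))\<^sup>2 = (nrm f)\<^sup>2 + 2 * Re (ip f g) + (nrm g)\<^sup>2"
proof -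
  assume fg: "f \<in> H" "g \<in> H"
  have "Re (ip (f + g) (f + g)) = Re (ip f f) + 2 * Re (ip f g) + Re (ip g g)"
    using fg ip_cnj[OF fg] by (simp add: ip_add ip_add_right H_add)
  then show ?thesis using fg by (simp add: ip_self H_add)
qed

lemma cauchy_schwarz:
  assumes f: "f \<in> H" and g: "g \<in> H"
  shows "cmod (ip f g) \<le> nrm f * nrm g"
proof (cases "g = 0")
  case True
  then show ?thesis using f by (simp add: ip_zero_right)
next
  case False
  then have n: "0 < nrm g" using nrm_eq_0[OF g] nrm_nonneg[OF g] by simp
  define c where "c = - ip f g / of_real ((nrm g)\<^sup>2)"
  have "0 \<le> (nrm (f + scale c g))\<^sup>2" by simp
  also have "\<dots> = (nrm f)\<^sup>2 + 2 * Re (ip f (scale c g)) + (nrm (scale c g))\<^sup>2"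
    using f g by (intro nrm_add_square H_scale)
  also have "ip f (scale c g) = - of_real ((cmod (ip f g))\<^sup>2 / (nrm g)\<^sup>2)"
    unfolding ip_scale_right[OF g f] c_def by (simp add: complex_norm_square mult.commute del: of_real_power)
  also have "(nrm (scale c g))\<^sup>2 = (cmod (ip f g))\<^sup>2 / (nrm g)\<^sup>2"
    unfolding nrm_scale[OF g] c_def norm_divide norm_minus_cancel norm_of_real using n
    by (simp add: power2_eq_square)
  finally have "(cmod (ip f g))\<^sup>2 / (nrm g)\<^sup>2 \<le> (nrm f)\<^sup>2" by simp
  then have "(cmod (ip f g))\<^sup>2 \<le> (nrm f * nrm g)\<^sup>2"
    using n by (simp add: pos_divide_le_eq power_mult_distrib)
  then show ?thesis
    by (rule power2_le_imp_le) (simp add: f g nrm_nonneg)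
qed

lemma nrm_triangle: "f \<in> H \<Longrightarrow> g \<in> H \<Longrightarrow> nrm (f + g) \<le> nrm f + nrm g"
proof -
  assume fg: "f \<in> H" "g \<in> H"
  have "Re (ip f g) \<le> nrm f * nrm g"
    using cauchy_schwarz[OF fg] complex_Re_le_cmod order_trans by blast
  then have "(nrm (f + g))\<^sup>2 \<le> (nrm f + nrm g)\<^sup>2"
    using fg by (simp add: nrm_add_square power2_sum)
  then show ?thesis
    by (rule power2_le_imp_le) (simp add: fg nrm_nonneg)
qed

lemma nrm_triangle_diff:
  "f \<in> H \<Longrightarrow> g \<in> H \<Longrightarrow> h \<in> H \<Longrightarrow> nrm (f - h) \<le> nrm (f - g) + nrm (g - h)"
  using nrm_triangle[of "f - g" "g - h"] H_diff by simp

section \<open>Metric, closure and limits\<close>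

sublocale metric: Metric_space H "hilbert_dist H ip"
proof
  show "0 \<le> hilbert_dist H ip x y" for x y
    by (simp add: hilbert_dist_def nrm_nonneg H_diff)
  show "hilbert_dist H ip x y = hilbert_dist H ip y x" for x y
    by (simp add: hilbert_dist_def nrm_minus_commute)
  show "hilbert_dist H ip x y = 0 \<longleftrightarrow> x = y" if "x \<in> H" "y \<in> H" for x y
    using that by (simp add: hilbert_dist_def nrm_eq_0 H_diff)
  show "hilbert_dist H ip x z \<le> hilbert_dist H ip x y + hilbert_dist H ip y z"
    if "x \<in> H" "y \<in> H" "z \<in> H" for x y z
    using that by (simp add: hilbert_dist_def nrm_triangle_diff)
qed

lemma in_closure_iff:
  assumes "D \<subseteq> H"
  shows "f \<in> hilbert_topology H ip closure_of D \<longleftrightarrow> f \<in> H \<and> (\<forall>e>0. \<exists>g\<in>D. nrm (f - g) < e)"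
  using assms unfolding hilbert_topology_def metric.metric_closure_of
  by (auto simp: metric.in_mball hilbert_dist_def subset_iff)

lemma cauchy_sequence_converges:
  assumes x: "\<And>n. x n \<in> H"
    and cauchy: "\<And>e. 0 < e \<Longrightarrow> \<exists>N. \<forall>m\<ge>N. \<forall>n\<ge>N. nrm (x m - x n) < e"
  shows "\<exists>l\<in>H. (\<lambda>n. nrm (x n - l)) \<longlonglongrightarrow> 0"
proof -
  have "metric.MCauchy x"
    unfolding metric.MCauchy_def using x cauchy by (auto simp: hilbert_dist_def)
  then obtain l where "limitin metric.mtopology x l sequentially"
    using complete unfolding metric.mcomplete_def by blast
  then have l: "l \<in> H" "\<And>e. 0 < e \<Longrightarrow> \<exists>N. \<forall>n\<ge>N. nrm (x n - l) < e"
    using x by (auto simp: metric.limit_metric_sequentially hilbert_dist_def)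
  have "(\<lambda>n. nrm (x n - l)) \<longlonglongrightarrow> 0"
    by (rule LIMSEQ_I) (use l x nrm_nonneg H_diff in \<open>auto simp: abs_of_nonneg\<close>)
  then show ?thesis using l(1) by blast
qed

lemma tendsto_ip:
  assumes x: "\<And>n. x n \<in> H" and l: "l \<in> H" "(\<lambda>n. nrm (x n - l)) \<longlonglongrightarrow> 0" and f: "f \<in> H"
  shows "(\<lambda>n. ip (x n) f) \<longlonglongrightarrow> ip l f"
proof (rule LIM_zero_cancel, rule Lim_null_comparison)
  show "\<forall>\<^sub>F n in sequentially. norm (ip (x n) f - ip l f) \<le> nrm (x n - l) * nrm f"
    using cauchy_schwarz[OF H_diff[OF x l(1)] f] x l(1) f by (simp add: ip_diff)
  show "(\<lambda>n. nrm (x n - l) * nrm f) \<longlonglongrightarrow> 0"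
    using tendsto_mult_right[OF l(2), of "nrm f"] by simp
qed

text \<open>
  The Riesz vector lies in the closure of \<open>D\<close>; it is the limit of a minimizing sequence of the
  functional \<open>nrm x ^ 2 - 2 * Re (\<phi> x)\<close> on \<open>D\<close>.
\<close>

lemma riesz:
  assumes D: "subspace D" "D \<subseteq> H"
    and add: "\<And>f g. f \<in> D \<Longrightarrow> g \<in> D \<Longrightarrow> \<phi> (f + g) = \<phi> f + \<phi> g"
    and scl: "\<And>c f. f \<in> D \<Longrightarrow> \<phi> (scale c f) = c * \<phi> f"
    and bnd: "\<And>f. f \<in> D \<Longrightarrow> cmod (\<phi> f) \<le> C * nrm f"
  shows "\<exists>k \<in> hilbert_topology H ip closure_of D. \<forall>f\<in>D. \<phi> f = ip f k"
proof -
  define F where "F x = (nrm x)\<^sup>2 - 2 * Re (\<phi> x)" for x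
  have D0: "0 \<in> D" using D(1) by (rule subspace_0)
  have DH: "f \<in> H" if "f \<in> D" for f using that D(2) by blast
  have low: "- (C\<^sup>2) \<le> F x" if "x \<in> D" for x
  proof -
    have "Re (\<phi> x) \<le> C * nrm x"
      using bnd[OF that] complex_Re_le_cmod order_trans by blast
    moreover have "0 \<le> (nrm x - C)\<^sup>2" by simp
    ultimately show ?thesis unfolding F_def by (simp add: power2_diff mult.commute)
  qed
  define m where "m = Inf (F ` D)"
  have bdd: "bdd_below (F ` D)" using low by (auto simp: bdd_below_def)
  have m_le: "m \<le> F x" if "x \<in> D" for x
    unfolding m_def using bdd that by (intro cInf_lower) auto
  have "\<exists>x\<in>D. F x < m + 1 / real (Suc n)" for n
  proof -
    have "Inf (F ` D) < m + 1 / real (Suc n)" by (simp add: m_def)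
    then show ?thesis using D0 by (subst (asm) cInf_less_iff[OF _ bdd]) auto
  qed
  then obtain x where x: "\<And>n. x n \<in> D" "\<And>n. F (x n) < m + 1 / real (Suc n)" by metis
  \<comment> \<open>Parallelogram law: as the value at the midpoint is at least \<open>m\<close>,
    nearly minimal vectors are close to each other.\<close>
  have par: "(nrm (f - g))\<^sup>2 \<le> 2 * (F f + F g - 2 * m)" if fg: "f \<in> D" "g \<in> D" for f g
  proof -
    let ?h = "scale (1/2) (f + g)"
    have h: "f + g \<in> D" "?h \<in> D" using D(1) fg by (auto intro: subspace_add subspace_scale)
    have e1: "\<phi> ?h = (\<phi> f + \<phi> g) / 2" using h fg by (simp add: scl add)
    have e2: "nrm ?h = nrm (f + g) / 2" using nrm_scale[OF DH[OF h(1)], of "1/2"] by simp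
    have "F ?h = (nrm (f + g))\<^sup>2 / 4 - Re (\<phi> f + \<phi> g)"
      unfolding F_def e1 e2 by (simp add: power_divide field_simps)
    moreover have "(nrm (f + g))\<^sup>2 + (nrm (f - g))\<^sup>2 = 2 * (nrm f)\<^sup>2 + 2 * (nrm g)\<^sup>2"
      using nrm_add_square[of f g] nrm_add_square[of f "- g"] fg
      by (simp add: DH H_uminus nrm_uminus ip_uminus_right)
    ultimately show ?thesis using m_le[OF h(2)] by (simp add: F_def)
  qed
  have small: "(nrm (x i - x j))\<^sup>2 \<le> 2 * (1 / real (Suc i) + 1 / real (Suc j))" for i j
  proof -
    have "a \<le> 2 * (p + q)" if "a \<le> 2 * (b + c - 2 * m)" "b < m + p" "c < m + q" for a b c p q :: real
      using that by argo
    from this[OF par[OF x(1) x(1)] x(2) x(2)] show ?thesis .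
  qed
  have "\<exists>N. \<forall>i\<ge>N. \<forall>j\<ge>N. nrm (x i - x j) < e" if e: "0 < e" for e
  proof -
    obtain N where N: "inverse (real (Suc N)) < e\<^sup>2 / 4"
      using reals_Archimedean[of "e\<^sup>2 / 4"] e by auto
    have "nrm (x i - x j) < e" if "i \<ge> N" "j \<ge> N" for i j
    proof -
      have "1 / real (Suc i) \<le> inverse (real (Suc N))" "1 / real (Suc j) \<le> inverse (real (Suc N))"
        using that by (simp_all add: field_simps)
      then have "(nrm (x i - x j))\<^sup>2 < e\<^sup>2" using small[of i j] N by argo
      then show ?thesis using e by (auto intro: power2_less_imp_less)
    qed
    then show ?thesis by blast
  qed
  then obtain k where k: "k \<in> H" "(\<lambda>n. nrm (x n - k)) \<longlonglongrightarrow> 0"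
    using cauchy_sequence_converges[of x] x(1) DH by blast
  have "k \<in> hilbert_topology H ip closure_of D"
    unfolding in_closure_iff[OF D(2)]
  proof (intro conjI allI impI)
    fix e :: real assume "0 < e"
    then have "\<forall>\<^sub>F n in sequentially. nrm (x n - k) < e"
      using k(2) by (rule order_tendstoD(2)[rotated])
    then obtain n where "nrm (x n - k) < e" by (auto simp: eventually_sequentially)
    then show "\<exists>g\<in>D. nrm (k - g) < e" using x(1) k(1) DH nrm_minus_commute by metis
  qed (rule k(1))
  moreover have "\<phi> f = ip f k" if f: "f \<in> D" for f
  proof -
    define \<delta> where "\<delta> = ip f k - \<phi> f"
    \<comment> \<open>First variation at the limit: moving \<open>x n\<close> by
      \<open>scale c f\<close> lowers \<open>F\<close> by less than
      \<open>1 / real (Suc n)\<close>.\<close>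
    have var: "0 \<le> (cmod c * nrm f)\<^sup>2 + 2 * Re (c * \<delta>)" for c
    proof (rule LIMSEQ_le)
      show "(\<lambda>n. - (1 / real (Suc n))) \<longlonglongrightarrow> 0"
        using LIMSEQ_inverse_real_of_nat by (auto simp: divide_inverse intro: tendsto_minus_cancel_left[THEN iffD1])
      show "(\<lambda>n. (cmod c * nrm f)\<^sup>2 + 2 * Re (c * (ip f (x n) - \<phi> f))) \<longlonglongrightarrow> (cmod c * nrm f)\<^sup>2 + 2 * Re (c * \<delta>)"
      proof -
        have "(\<lambda>n. cnj (ip (x n) f)) \<longlonglongrightarrow> cnj (ip k f)"
          using tendsto_ip[of x k f] x(1) k f DH by (intro tendsto_cnj) auto
        then have "(\<lambda>n. ip f (x n)) \<longlonglongrightarrow> ip f k"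
          using ip_cnj x(1) k(1) f DH by (metis (mono_tags, lifting) Lim_transform_eventually eventually_sequentiallyI)
        then show ?thesis unfolding \<delta>_def by (intro tendsto_intros)
      qed
      have "- (1 / real (Suc n)) \<le> (cmod c * nrm f)\<^sup>2 + 2 * Re (c * (ip f (x n) - \<phi> f))" for n
      proof -
        have cf: "scale c f \<in> D" "x n + scale c f \<in> D"
          using D(1) f x(1) by (auto intro: subspace_add subspace_scale)
        have "F (x n + scale c f) = F (x n) + (cmod c * nrm f)\<^sup>2 + 2 * Re (c * (ip f (x n) - \<phi> f))"
        proof -
          have "Re (ip (x n) (scale c f)) = Re (c * ip f (x n))"
            using ip_cnj[of "x n" "scale c f"] ip_scale[of f "x n" c] f x(1)
            by (metis DH H_scale cnj.simps(1))
          then show ?thesis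
            using nrm_add_square[of "x n" "scale c f"] cf f x(1)
            by (simp add: F_def add scl DH nrm_scale algebra_simps)
        qed
        moreover have "F (x n) - 1 / real (Suc n) < F (x n + scale c f)"
          using m_le[OF cf(2)] x(2)[of n] by linarith
        ultimately show ?thesis by linarith
      qed
      then show "\<exists>N. \<forall>n\<ge>N. - (1 / real (Suc n)) \<le> (cmod c * nrm f)\<^sup>2 + 2 * Re (c * (ip f (x n) - \<phi> f))"
        by blast
    qed
    have "cmod \<delta> = 0"
    proof (rule ccontr)
      assume nz: "cmod \<delta> \<noteq> 0"
      \<comment> \<open>With \<open>c = - t * cnj \<delta>\<close> the linear term beats the
        quadratic one, because \<open>t * (nrm f)\<^sup>2 < 2\<close>.\<close>
      define t where "t = 1 / ((nrm f)\<^sup>2 + 1)"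
      have p: "0 < (nrm f)\<^sup>2 + 1" by (simp add: add_nonneg_pos)
      have t: "0 < t" "t * (nrm f)\<^sup>2 < 2"
        using p by (auto simp: t_def field_simps)
      have "Re (cnj \<delta> * \<delta>) = (cmod \<delta>)\<^sup>2"
        by (metis Re_complex_of_real complex_norm_square mult.commute)
      then have "0 \<le> (t * cmod \<delta> * nrm f)\<^sup>2 - 2 * t * (cmod \<delta>)\<^sup>2"
        using var[of "- of_real t * cnj \<delta>"] t(1) by (simp add: norm_mult mult.assoc)
      also have "\<dots> = t * (cmod \<delta>)\<^sup>2 * (t * (nrm f)\<^sup>2 - 2)"
        by (simp add: power2_eq_square algebra_simps)
      also have "\<dots> < 0" using t nz by (intro mult_pos_neg) auto
      finally show False by simp
    qed
    then show ?thesis by (simp add: \<delta>_def)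
  qed
  ultimately show ?thesis by blast
qed

text \<open>Baire's theorem for the closed sets \<open>E n\<close>, on which all the functionals are
  bounded by \<open>n\<close>: one of them contains a ball, and the bound there transfers to all of
  \<open>K\<close>.\<close>

lemma uniform_boundedness:
  assumes K: "K \<subseteq> H" and bnd: "\<And>f. f \<in> H \<Longrightarrow> \<exists>B. \<forall>k\<in>K. cmod (ip f k) \<le> B"
  shows "\<exists>C. \<forall>k\<in>K. nrm k \<le> C"
proof -
  define E where "E n = {f\<in>H. \<forall>k\<in>K. cmod (ip f k) \<le> real n}" for n
  have closed: "closedin metric.mtopology (E n)" for n
    unfolding metric.closedin_metric
  proof (intro conjI allI impI)
    show "E n \<subseteq> H" by (auto simp: E_def)
    fix f assume f: "f \<in> H - E n"
    then obtain k where k: "k \<in> K" "real n < cmod (ip f k)" "f \<in> H" by (auto simp: E_def not_le)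
    have kH: "k \<in> H" using k K by blast
    define r where "r = (cmod (ip f k) - real n) / (nrm k + 1)"
    have p: "0 < nrm k + 1" using nrm_nonneg[OF kH] by simp
    then have r: "0 < r" using k(2) by (simp add: r_def)
    have "g \<notin> E n" if g: "g \<in> H" "nrm (f - g) < r" for g
    proof
      assume "g \<in> E n"
      then have "cmod (ip g k) \<le> real n" using k(1) by (simp add: E_def)
      then have "cmod (ip f k) - real n \<le> cmod (ip f k - ip g k)"
        using norm_triangle_ineq2[of "ip f k" "ip g k"] by linarith
      also have "\<dots> \<le> nrm (f - g) * nrm k"
        using cauchy_schwarz[OF H_diff[OF k(3) g(1)] kH] k(3) g(1) kH by (simp add: ip_diff)
      also have "\<dots> \<le> nrm (f - g) * (nrm k + 1)"
        using nrm_nonneg[OF H_diff[OF k(3) g(1)]] by (intro mult_left_mono) auto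
      also have "\<dots> < r * (nrm k + 1)"
        using g(2) p by (intro mult_strict_right_mono)
      finally show False using p by (simp add: r_def)
    qed
    then have "disjnt (E n) (metric.mball f r)"
      by (auto simp: disjnt_iff metric.in_mball hilbert_dist_def)
    with r show "\<exists>r>0. disjnt (E n) (metric.mball f r)" by blast
  qed
  have "\<exists>n. metric.mtopology interior_of (E n) \<noteq> {}"
  proof (rule ccontr)
    assume "\<not> ?thesis"
    then have "metric.mtopology interior_of \<Union>(range E) = {}"
      using closed by (intro metric.metric_Baire_category_alt complete) auto
    moreover have "\<Union>(range E) = H"
    proof
      show "H \<subseteq> \<Union>(range E)"
      proof
        fix f assume f: "f \<in> H"
        then obtain B where "\<forall>k\<in>K. cmod (ip f k) \<le> B" using bnd by blast
        then have "\<forall>k\<in>K. cmod (ip f k) \<le> real (nat \<lceil>B\<rceil>)"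
          using real_nat_ceiling_ge[of B] order_trans by blast
        then show "f \<in> \<Union>(range E)" using f by (auto simp: E_def)
      qed
    qed (auto simp: E_def)
    ultimately have "metric.mtopology interior_of H = {}" by simp
    moreover have "0 \<in> metric.mtopology interior_of H"
      using H_zero interior_of_topspace[of metric.mtopology] by simp
    ultimately show False by simp
  qed
  then obtain n f r where f: "f \<in> H" "0 < r" "metric.mball f r \<subseteq> E n"
    by (auto simp: metric.metric_interior_of)
  have "nrm k \<le> 4 * real n / r" if k: "k \<in> K" for k
  proof (cases "k = 0")
    case True
    then show ?thesis using f(2) by simp
  next
    case False
    have kH: "k \<in> H" using k K by blast
    then have nk: "0 < nrm k" using False nrm_eq_0[OF kH] nrm_nonneg[OF kH] by simp
    \<comment> \<open>A vector of norm \<open>r / 2\<close> in the direction of \<open>k\<close>, so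
      that \<open>f + g\<close> stays in the ball; comparing \<open>f + g\<close> with
      \<open>f\<close> gives the bound \<open>2 * n\<close> and hence the constant 4.\<close>
    define g where "g = scale (of_real (r / (2 * nrm k))) k"
    have gH: "g \<in> H" by (simp add: g_def H_scale kH)
    have ng: "nrm g = r / 2" using nk f(2) by (simp add: g_def nrm_scale kH norm_divide)
    have "f \<in> E n" "f + g \<in> E n"
      using f(2) ng gH f(1) by (auto intro!: subsetD[OF f(3)] simp: metric.in_mball hilbert_dist_def H_add nrm_uminus)
    then have "cmod (ip f k) \<le> n" "cmod (ip (f + g) k) \<le> n" using k by (auto simp: E_def)
    moreover have "ip g k = ip (f + g) k - ip f k" using f(1) gH kH by (simp add: ip_add)
    ultimately have "cmod (ip g k) \<le> 2 * real n"
      using norm_triangle_ineq4[of "ip (f + g) k" "ip f k"] by simp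
    moreover have "ip g k = of_real (r / 2 * nrm k)"
      using nk by (simp add: g_def ip_scale kH ip_self power2_eq_square)
    then have "cmod (ip g k) = r / 2 * nrm k"
      using nk f(2) by (simp only: norm_of_real) simp
    ultimately show ?thesis using f(2) by (simp add: field_simps)
  qed
  then show ?thesis by blast
qed

section \<open>Closures of subspaces\<close>

lemma closure_subset: "hilbert_topology H ip closure_of D \<subseteq> H"
  using closure_of_subset_topspace[of "hilbert_topology H ip" D]
  by (simp add: hilbert_topology_def metric.topspace_mtopology)

lemma closure_idem: "hilbert_topology H ip closure_of (hilbert_topology H ip closure_of D) = hilbert_topology H ip closure_of D"
  by (rule closure_of_closure_of)

lemma subspace_closure:
  assumes D: "subspace D" "D \<subseteq> H"
  shows "subspace (hilbert_topology H ip closure_of D)"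
proof (rule subspaceI)
  show "0 \<in> hilbert_topology H ip closure_of D"
    unfolding in_closure_iff[OF D(2)] using subspace_0[OF D(1)] H_zero by (auto intro!: bexI[of _ 0])
next
  fix f g assume fg: "f \<in> hilbert_topology H ip closure_of D" "g \<in> hilbert_topology H ip closure_of D"
  then have fgH: "f \<in> H" "g \<in> H" using closure_subset by blast+
  show "f + g \<in> hilbert_topology H ip closure_of D"
    unfolding in_closure_iff[OF D(2)]
  proof (intro conjI allI impI)
    fix e :: real assume "0 < e"
    then have "0 < e / 2" by simp
    then obtain f' g' where fg': "f' \<in> D" "nrm (f - f') < e / 2" "g' \<in> D" "nrm (g - g') < e / 2"
      using fg unfolding in_closure_iff[OF D(2)] by meson
    then have "nrm ((f - f') + (g - g')) < e"
      using nrm_triangle[of "f - f'" "g - g'"] fgH D(2) H_diff by fastforce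
    moreover have "(f - f') + (g - g') = (f + g) - (f' + g')" by simp
    ultimately show "\<exists>h\<in>D. nrm (f + g - h) < e" using fg' subspace_add[OF D(1)] by metis
  qed (use fgH H_add in blast)
next
  fix c f assume f: "f \<in> hilbert_topology H ip closure_of D"
  then have fH: "f \<in> H" using closure_subset by blast
  show "scale c f \<in> hilbert_topology H ip closure_of D"
    unfolding in_closure_iff[OF D(2)]
  proof (intro conjI allI impI)
    fix e :: real assume e: "0 < e"
    have p: "0 < cmod c + 1" by (simp add: add_nonneg_pos)
    then have "0 < e / (cmod c + 1)" using e by simp
    then obtain f' where f': "f' \<in> D" "nrm (f - f') < e / (cmod c + 1)"
      using f unfolding in_closure_iff[OF D(2)] by meson
    have h: "f - f' \<in> H" using fH f' D(2) H_diff by blast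
    have "nrm (scale c (f - f')) \<le> (cmod c + 1) * nrm (f - f')"
      using nrm_nonneg[OF h] by (simp add: nrm_scale[OF h] distrib_right)
    also have "\<dots> < e" using f'(2) p by (simp add: pos_less_divide_eq mult.commute)
    finally show "\<exists>h\<in>D. nrm (scale c f - h) < e"
      using f' subspace_scale[OF D(1)] by (metis scale_right_diff_distrib)
  qed (use fH H_scale in blast)
qed

text \<open>Continuity of \<open>ip (T g) f\<close> in \<open>g\<close>. It reduces orthogonality
  conditions on \<open>M\<close> to polynomials; with the identity as \<open>T\<close> it gives that
  a vector of the closure orthogonal to \<open>D\<close> vanishes.\<close>

lemma orthogonal_closure:
  assumes D: "D \<subseteq> H" and f: "f \<in> H" and T: "\<And>g. g \<in> H \<Longrightarrow> T g \<in> H"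
      "\<And>g h. g \<in> H \<Longrightarrow> h \<in> H \<Longrightarrow> T (g - h) = T g - T h" "\<And>g. g \<in> H \<Longrightarrow> nrm (T g) \<le> B * nrm g"
    and orth: "\<And>g. g \<in> D \<Longrightarrow> ip (T g) f = 0" and g: "g \<in> hilbert_topology H ip closure_of D"
  shows "ip (T g) f = 0"
proof (rule ccontr)
  assume nz: "ip (T g) f \<noteq> 0"
  have gH: "g \<in> H" using g closure_subset by blast
  define K where "K = \<bar>B\<bar> * nrm f + 1"
  have K: "0 < K" unfolding K_def using nrm_nonneg[OF f] by (simp add: add_nonneg_pos)
  then have "0 < cmod (ip (T g) f) / K" using nz by simp
  then obtain h where h: "h \<in> D" "nrm (g - h) < cmod (ip (T g) f) / K"
    using g unfolding in_closure_iff[OF D] by meson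
  have hH: "h \<in> H" "g - h \<in> H" using h(1) D gH H_diff by blast+
  have "ip (T g) f = ip (T (g - h)) f"
    using orth[OF h(1)] gH hH f T by (simp add: ip_diff)
  then have "cmod (ip (T g) f) \<le> nrm (T (g - h)) * nrm f"
    using cauchy_schwarz[OF T(1)[OF hH(2)] f] by simp
  also have "\<dots> \<le> (\<bar>B\<bar> * nrm (g - h)) * nrm f"
  proof (rule mult_right_mono)
    show "nrm (T (g - h)) \<le> \<bar>B\<bar> * nrm (g - h)"
      using T(3)[OF hH(2)] nrm_nonneg[OF hH(2)] mult_right_mono[OF abs_ge_self[of B]] order_trans by blast
  qed (rule nrm_nonneg[OF f])
  also have "\<dots> \<le> K * nrm (g - h)"
  proof -
    have "a * x * y + x = (a * y + 1) * x" for a x y :: real by (simp add: algebra_simps)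
    from this[of "\<bar>B\<bar>" "nrm (g - h)" "nrm f"] show ?thesis
      unfolding K_def using nrm_nonneg[OF hH(2)] by argo
  qed
  also have "\<dots> < cmod (ip (T g) f)"
    using h(2) K by (simp add: pos_less_divide_eq mult.commute)
  finally show False by simp
qed

text \<open>The existence of the adjoint is what makes the definite description in \<^const>\<open>adjoint_on\<close> meaningful.\<close>

lemma adjoint_on_eq_0_iff:
  assumes M: "subspace M" "M \<subseteq> H" "hilbert_topology H ip closure_of M = M"
    and T: "\<And>g. g \<in> M \<Longrightarrow> T g \<in> H" "\<And>g h. g \<in> M \<Longrightarrow> h \<in> M \<Longrightarrow> T (g + h) = T g + T h"
      "\<And>c g. g \<in> M \<Longrightarrow> T (scale c g) = scale c (T g)" "\<And>g. g \<in> M \<Longrightarrow> nrm (T g) \<le> B * nrm g"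
    and f: "f \<in> M"
  shows "adjoint_on M ip T f = 0 \<longleftrightarrow> (\<forall>g\<in>M. ip (T g) f = 0)"
proof -
  have fH: "f \<in> H" and MH: "\<And>g. g \<in> M \<Longrightarrow> g \<in> H" using f M(2) by blast+
  \<comment> \<open>The Riesz vector of the functional sending \<open>g\<close> to
    \<open>ip (T g) f\<close>; since \<open>M\<close> is closed, it lies in \<open>M\<close> and is
    the adjoint vector.\<close>
  have "\<exists>h\<in>hilbert_topology H ip closure_of M. \<forall>g\<in>M. ip (T g) f = ip g h"
  proof (rule riesz[OF M(1,2)])
    show "cmod (ip (T g) f) \<le> (B * nrm f) * nrm g" if g: "g \<in> M" for g
    proof -
      have "cmod (ip (T g) f) \<le> nrm (T g) * nrm f" by (rule cauchy_schwarz[OF T(1)[OF g] fH])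
      also have "\<dots> \<le> (B * nrm g) * nrm f" by (rule mult_right_mono[OF T(4)[OF g] nrm_nonneg[OF fH]])
      finally show ?thesis by (simp add: mult_ac)
    qed
  qed (simp_all add: T fH ip_add ip_scale)
  then obtain h where h: "h \<in> M" "\<And>g. g \<in> M \<Longrightarrow> ip (T g) f = ip g h" using M(3) by auto
  have "adjoint_on M ip T f = h"
    unfolding adjoint_on_def
  proof (rule the_equality)
    fix k assume k: "k \<in> M \<and> (\<forall>g\<in>M. ip (T g) f = ip g k)"
    have d: "k - h \<in> M" using k h(1) subspace_diff[OF M(1)] by blast
    then have "ip (k - h) k = ip (k - h) h" using k h(2) by metis
    then have "ip (k - h) (k - h) = 0" using k h(1) d MH by (simp add: ip_diff_right)
    then show "k = h" using ip_definite[OF MH[OF d]] by simp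
  qed (use h in blast)
  moreover have "h = 0 \<longleftrightarrow> (\<forall>g\<in>M. ip g h = 0)"
    using h(1) MH ip_definite ip_zero_right by blast
  ultimately show ?thesis using h(2) by simp
qed

end

section \<open>Analytic Hilbert modules\<close>

text \<open>The polynomial \<open>q\<close> in the variables \<open>z - w\<close>, so that the ideal
  is kept at the origin while the module stays in place.\<close>

definition poly_on :: "(complex^'n) set \<Rightarrow> complex^'n \<Rightarrow> ('n::finite) cpoly \<Rightarrow> complex^'n \<Rightarrow> complex" where
  "poly_on \<Omega> w q = poly_fun \<Omega> (translate (- w) q)"

lemma poly_on_apply: "poly_on \<Omega> w q z = (if z \<in> \<Omega> then poly_eval q (z - w) else 0)"
  by (simp add: poly_on_def poly_fun_def)

lemma poly_on_add: "poly_on \<Omega> w (p + q) = poly_on \<Omega> w p + poly_on \<Omega> w q"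
  and poly_on_diff: "poly_on \<Omega> w (p - q) = poly_on \<Omega> w p - poly_on \<Omega> w q"
  and poly_on_scale: "poly_on \<Omega> w (const_poly c * p) = fun_scale c (poly_on \<Omega> w p)"
  by (rule ext; simp add: poly_on_apply fun_scale_def)+

definition shifted_mult :: "complex^('n::finite) \<Rightarrow> 'n \<Rightarrow> (complex^'n \<Rightarrow> complex) \<Rightarrow> complex^'n \<Rightarrow> complex" where
  "shifted_mult w j g = coord_mult j g - fun_scale (w $ j) g"

lemma shifted_mult_apply: "shifted_mult w j g z = (z $ j - w $ j) * g z"
  by (simp add: shifted_mult_def coord_mult_def fun_scale_def left_diff_distrib)

lemma shifted_mult_poly_on: "shifted_mult w j (poly_on \<Omega> w q) = poly_on \<Omega> w (var_poly j * q)"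
  by (rule ext) (simp add: shifted_mult_apply poly_on_apply)

lemma shifted_mult_eq_act: "shifted_mult w j g = poly_act (var_poly j - const_poly (w $ j)) g"
  by (rule ext) (simp add: shifted_mult_apply poly_act_def)

lemma shifted_mult_add: "shifted_mult w j (f + g) = shifted_mult w j f + shifted_mult w j g"
  and shifted_mult_diff: "shifted_mult w j (f - g) = shifted_mult w j f - shifted_mult w j g"
  and shifted_mult_scale: "shifted_mult w j (fun_scale c f) = fun_scale c (shifted_mult w j f)"
  by (rule ext; simp add: shifted_mult_apply fun_scale_def distrib_left right_diff_distrib)+

context analytic_hilbert_module
begin

section \<open>The Hilbert norm and Taylor coefficients at a point\<close>

lemma poly_on_in_H: "poly_on \<Omega> w q \<in> H"
  using poly_in unfolding poly_on_def by blast

lemma shifted_mult_bounded: "\<exists>B. \<forall>g\<in>H. shifted_mult w j g \<in> H \<and> nrm (shifted_mult w j g) \<le> B * nrm g"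
  using act_bounded[of "var_poly j - const_poly (w $ j)"] act_closed unfolding shifted_mult_eq_act by blast

text \<open>The reproducing kernel bounds each evaluation separately. Since every \<open>f\<close>
  is bounded on a closed ball, uniform boundedness of the kernel vectors gives one constant for the
  whole ball.\<close>

lemma local_bound:
  assumes \<Omega>: "open \<Omega>" "w \<in> \<Omega>"
  shows "\<exists>r>0. \<exists>C\<ge>0. \<forall>z. (\<forall>j. cmod (z $ j) \<le> r) \<longrightarrow> z + w \<in> \<Omega> \<and> (\<forall>f\<in>H. cmod (f (z + w)) \<le> C * nrm f)"
proof -
  obtain R where R: "0 < R" "cball w R \<subseteq> \<Omega>" using \<Omega> open_contains_cball by blast
  obtain K where K: "\<And>v. v \<in> \<Omega> \<Longrightarrow> K v \<in> H" "\<And>v f. v \<in> \<Omega> \<Longrightarrow> f \<in> H \<Longrightarrow> ip f (K v) = f v"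
    using reproducing_kernel by metis
  have KH: "K ` cball w R \<subseteq> H" using K(1) R(2) by blast
  have "\<exists>B. \<forall>k\<in>K ` cball w R. cmod (ip f k) \<le> B" if f: "f \<in> H" for f
  proof -
    have "continuous_on (cball w R) f"
      using holomorphic_several_on_imp_continuous_on[OF holomorphic[OF f]] R(2) continuous_on_subset by blast
    then have "bounded (f ` cball w R)"
      by (intro compact_imp_bounded compact_continuous_image) auto
    then obtain B where "\<And>v. v \<in> cball w R \<Longrightarrow> cmod (f v) \<le> B"
      unfolding bounded_iff by (metis imageI)
    then show ?thesis using K(2)[OF _ f] R(2) by (intro exI[of _ B]) (auto simp: subset_iff)
  qed
  then obtain C where C: "\<forall>k\<in>K ` cball w R. nrm k \<le> C"
    using uniform_boundedness[OF KH] by blast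
  define r where "r = R / real CARD('n)"
  have r: "0 < r" using R(1) by (simp add: r_def)
  have "z + w \<in> \<Omega> \<and> (\<forall>f\<in>H. cmod (f (z + w)) \<le> \<bar>C\<bar> * nrm f)" if z: "\<forall>j. cmod (z $ j) \<le> r" for z :: "complex^'n"
  proof -
    have "norm z \<le> (\<Sum>j\<in>UNIV. cmod (z $ j))"
      unfolding norm_vec_def by (rule L2_set_le_sum) simp
    also have "\<dots> \<le> (\<Sum>j\<in>(UNIV :: 'n set). r)" using z by (intro sum_mono) blast
    also have "\<dots> = R" by (simp add: r_def)
    finally have zw: "z + w \<in> cball w R" by (simp add: dist_norm)
    then have z\<Omega>: "z + w \<in> \<Omega>" using R(2) by blast
    have "cmod (f (z + w)) \<le> \<bar>C\<bar> * nrm f" if f: "f \<in> H" for f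
    proof -
      have "cmod (f (z + w)) \<le> nrm f * nrm (K (z + w))"
        using cauchy_schwarz[OF f K(1)[OF z\<Omega>]] K(2)[OF z\<Omega> f] by simp
      also have "\<dots> \<le> nrm f * \<bar>C\<bar>"
      proof (rule mult_left_mono[OF _ nrm_nonneg[OF f]])
        have "nrm (K (z + w)) \<le> C" using C zw by blast
        then show "nrm (K (z + w)) \<le> \<bar>C\<bar>" by linarith
      qed
      finally show ?thesis by (simp only: mult.commute)
    qed
    then show ?thesis using z\<Omega> by blast
  qed
  then show ?thesis using r by (intro exI[of _ r] conjI exI[of _ "\<bar>C\<bar>"]) auto
qed

text \<open>The link from analysis to algebra: the norm of \<open>H\<close> dominates the norm in
  which the division is controlled.\<close>

lemma coeff_norm_bound:
  assumes r: "0 < r" "0 \<le> C"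
    and loc: "\<forall>z. (\<forall>j. cmod (z $ j) \<le> r) \<longrightarrow> z + w \<in> \<Omega> \<and> (\<forall>f\<in>H. cmod (f (z + w)) \<le> C * nrm f)"
    and s: "1 / 2 ^ s \<le> r"
  shows "coeff_norm (s + 2) q \<le> suminf (\<lambda>n. 1 / real (Suc n) ^ 2) * C * nrm (poly_on \<Omega> w q)"
proof -
  have "coeff_norm (s + 2) q \<le> suminf (\<lambda>n. 1 / real (Suc n) ^ 2) * (C * nrm (poly_on \<Omega> w q))"
  proof (rule coeff_norm_le_sup[OF r(1) s])
    fix z :: "complex^'n" assume "\<And>j. cmod (z $ j) = r"
    then have "z + w \<in> \<Omega>" "cmod (poly_on \<Omega> w q (z + w)) \<le> C * nrm (poly_on \<Omega> w q)"
      using loc poly_on_in_H by auto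
    then show "cmod (poly_eval q z) \<le> C * nrm (poly_on \<Omega> w q)"
      by (simp add: poly_on_apply)
  qed
  then show ?thesis by (simp only: mult.assoc)
qed

text \<open>A limit of polynomials in \<open>J\<close> is the sum of a fast converging series of
  increments from \<open>J\<close>, to which \<open>ideal_series_closed\<close> applies.\<close>

lemma closure_in_ocomb:
  assumes \<Omega>: "open \<Omega>" "w \<in> \<Omega>" and J: "poly_ideal J"
    and f: "f \<in> hilbert_topology H ip closure_of (poly_on \<Omega> w ` J)"
  shows "f \<in> ocomb w (poly_at w ` J)"
proof -
  have sub: "poly_on \<Omega> w ` J \<subseteq> H" using poly_on_in_H by blast
  have fH: "f \<in> H" using f closure_subset by blast
  obtain r C where r: "0 < r" "0 \<le> C"
    and loc: "\<forall>z. (\<forall>j. cmod (z $ j) \<le> r) \<longrightarrow> z + w \<in> \<Omega> \<and> (\<forall>f\<in>H. cmod (f (z + w)) \<le> C * nrm f)"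
    using local_bound[OF \<Omega>] by blast
  obtain A g where A: "finite A" "\<And>a. a \<in> A \<Longrightarrow> g a \<in> J"
    and ev: "\<forall>\<^sub>F s in sequentially. \<forall>u F. (\<forall>n. u n \<in> J) \<longrightarrow> summable (\<lambda>n. coeff_norm s (u n)) \<longrightarrow>
      (\<forall>z\<in>polydisc (Suc s). (\<lambda>n. poly_eval (u n) z) sums F z) \<longrightarrow>
      (\<exists>Q. (\<forall>a::'n \<Rightarrow>\<^sub>0 nat. holomorphic_several_on (Q a) (polydisc (Suc s))) \<and>
        (\<forall>z\<in>polydisc (Suc s). F z = (\<Sum>a\<in>A. Q a z * poly_eval (g a) z)))"
    using ideal_series_closed[OF J] by blast
  define good where "good s \<longleftrightarrow> (\<forall>u F. (\<forall>n. u n \<in> J) \<longrightarrow> summable (\<lambda>n. coeff_norm s (u n)) \<longrightarrow>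
      (\<forall>z\<in>polydisc (Suc s). (\<lambda>n. poly_eval (u n) z) sums F z) \<longrightarrow>
      (\<exists>Q. (\<forall>a::'n \<Rightarrow>\<^sub>0 nat. holomorphic_several_on (Q a) (polydisc (Suc s))) \<and>
        (\<forall>z\<in>polydisc (Suc s). F z = (\<Sum>a\<in>A. Q a z * poly_eval (g a) z))))" for s
  have "\<forall>\<^sub>F s in sequentially. good s" unfolding good_def by (rule ev)
  \<comment> \<open>The shift by 2 is the loss in \<open>coeff_norm_le_sup\<close>, which pays for
    summability over all monomials.\<close>
  then have "\<forall>\<^sub>F s in sequentially. good (s + 2)" by (rule sequentially_offset)
  moreover have "(\<lambda>s. 1 / 2 ^ s :: real) \<longlonglongrightarrow> 0" by real_asymp
  then have "\<forall>\<^sub>F s in sequentially. 1 / 2 ^ s < r" by (rule order_tendstoD(2)[OF _ r(1)])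
  ultimately have "\<forall>\<^sub>F s in sequentially. good (s + 2) \<and> 1 / 2 ^ s < r"
    by (rule eventually_conj)
  then obtain s where good: "good (s + 2)" and s: "1 / 2 ^ s < r"
    using eventually_happens'[OF sequentially_bot] by blast
  note closed = good[unfolded good_def, rule_format]
  have small: "\<forall>j. cmod (z $ j) \<le> r" if z: "z \<in> polydisc (Suc (s + 2))" for z :: "complex^'n"
  proof
    fix j
    have "cmod (z $ j) < 1 / real (var_prime j) ^ s"
      using z polydisc_antimono[of s "Suc (s + 2)"] by (auto simp: polydisc_def)
    also have "\<dots> \<le> 1 / 2 ^ s"
      using prime_ge_2_nat[OF prime_var_prime[of j]] by (intro divide_left_mono power_mono) auto
    finally show "cmod (z $ j) \<le> r" using s by linarith
  qed
  have "\<exists>p\<in>J. nrm (f - poly_on \<Omega> w p) < (1/2) ^ n" for n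
  proof -
    have "(0::real) < (1/2) ^ n" by simp
    with f[unfolded in_closure_iff[OF sub]] have "\<exists>x\<in>poly_on \<Omega> w ` J. nrm (f - x) < (1/2) ^ n"
      by (elim conjE allE impE)
    then show ?thesis unfolding bex_simps .
  qed
  then obtain p where p: "\<And>n. p n \<in> J" "\<And>n. nrm (f - poly_on \<Omega> w (p n)) < (1/2) ^ n" by metis
  \<comment> \<open>Increments with the first approximant as initial term, so that
    \<open>Suc n\<close> terms add up to \<open>p n\<close>.\<close>
  define u where "u n = (case n of 0 \<Rightarrow> p 0 | Suc m \<Rightarrow> p (Suc m) - p m)" for n
  have uJ: "\<forall>n. u n \<in> J"
    using p(1) poly_ideal_diff[OF J] by (simp add: u_def split: nat.split)
  have usum: "(\<Sum>i<Suc n. poly_eval (u i) z) = poly_eval (p n) z" for n z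
    by (induction n) (simp_all add: u_def)
  define Z where "Z = suminf (\<lambda>n. 1 / real (Suc n) ^ 2) * C"
  have "0 \<le> suminf (\<lambda>n. 1 / real (Suc n) ^ 2)"
    using inverse_power_summable[of 2, where 'a = real]
    by (intro suminf_nonneg) (simp_all only: summable_Suc_iff[of "\<lambda>n. 1 / real n ^ 2"] inverse_eq_divide zero_le_divide_1_iff zero_le_power of_nat_0_le_iff)
  then have Z: "0 \<le> Z" using r(2) by (simp add: Z_def)
  have "summable (\<lambda>n. coeff_norm (s + 2) (u (Suc n)))"
  proof (rule summable_comparison_test')
    show "summable (\<lambda>n. Z * (2 * (1/2) ^ n))"
      by (intro summable_mult summable_geometric) simp
    fix n
    have h: "poly_on \<Omega> w (p (Suc n)) \<in> H" "poly_on \<Omega> w (p n) \<in> H" by (rule poly_on_in_H)+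
    have "nrm (poly_on \<Omega> w (p (Suc n)) - poly_on \<Omega> w (p n)) \<le> nrm (poly_on \<Omega> w (p (Suc n)) - f) + nrm (f - poly_on \<Omega> w (p n))"
      by (rule nrm_triangle_diff[OF h(1) fH h(2)])
    also have "nrm (poly_on \<Omega> w (p (Suc n)) - f) = nrm (f - poly_on \<Omega> w (p (Suc n)))"
      by (rule nrm_minus_commute[OF h(1) fH])
    also have "nrm (f - poly_on \<Omega> w (p (Suc n))) + nrm (f - poly_on \<Omega> w (p n)) \<le> (1/2) ^ n + (1/2) ^ n"
    proof (rule add_mono)
      have "(1/2) ^ Suc n \<le> (1/2 :: real) ^ n" by (rule power_decreasing) simp_all
      then show "nrm (f - poly_on \<Omega> w (p (Suc n))) \<le> (1/2) ^ n"
        by (rule order_trans[OF less_imp_le[OF p(2)]])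
    qed (rule less_imp_le[OF p(2)])
    finally have n: "nrm (poly_on \<Omega> w (u (Suc n))) \<le> 2 * (1/2) ^ n"
      by (simp only: u_def nat.case poly_on_diff mult_2)
    have "coeff_norm (s + 2) (u (Suc n)) \<le> Z * nrm (poly_on \<Omega> w (u (Suc n)))"
      unfolding Z_def using coeff_norm_bound[OF r loc less_imp_le[OF s]] .
    also have "\<dots> \<le> Z * (2 * (1/2) ^ n)" by (rule mult_left_mono[OF n Z])
    finally show "norm (coeff_norm (s + 2) (u (Suc n))) \<le> Z * (2 * (1/2) ^ n)"
      using coeff_norm_nonneg[of "s + 2" "u (Suc n)"] by simp
  qed
  then have usummable: "summable (\<lambda>n. coeff_norm (s + 2) (u n))"
    by (rule summable_Suc_iff[THEN iffD1])
  have "\<forall>z\<in>polydisc (Suc (s + 2)). (\<lambda>n. poly_eval (u n) z) sums f (z + w)"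
  proof
    fix z :: "complex^'n" assume z: "z \<in> polydisc (Suc (s + 2))"
    then have zw: "z + w \<in> \<Omega>" "\<And>h. h \<in> H \<Longrightarrow> cmod (h (z + w)) \<le> C * nrm h"
      using loc small by blast+
    have "(\<lambda>n. poly_eval (p n) z) \<longlonglongrightarrow> f (z + w)"
    proof (rule LIM_zero_cancel, rule Lim_null_comparison)
      show "\<forall>\<^sub>F n in sequentially. norm (poly_eval (p n) z - f (z + w)) \<le> C * (1/2) ^ n"
      proof (rule always_eventually, rule allI)
        fix n
        have "norm (poly_eval (p n) z - f (z + w)) = cmod ((f - poly_on \<Omega> w (p n)) (z + w))"
          using zw(1) by (simp add: poly_on_apply norm_minus_commute)
        also have "\<dots> \<le> C * nrm (f - poly_on \<Omega> w (p n))"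
          by (rule zw(2)[OF H_diff[OF fH poly_on_in_H]])
        also have "\<dots> \<le> C * (1/2) ^ n"
          by (rule mult_left_mono[OF less_imp_le[OF p(2)] r(2)])
        finally show "norm (poly_eval (p n) z - f (z + w)) \<le> C * (1/2) ^ n" .
      qed
      show "(\<lambda>n. C * (1/2) ^ n) \<longlonglongrightarrow> 0" by (intro tendsto_mult_right_zero LIMSEQ_power_zero) simp
    qed
    then have "(\<lambda>n. \<Sum>i<Suc n. poly_eval (u i) z) \<longlonglongrightarrow> f (z + w)" unfolding usum .
    then show "(\<lambda>n. poly_eval (u n) z) sums f (z + w)"
      unfolding sums_def by (rule LIMSEQ_imp_Suc)
  qed
  from closed[OF uJ[rule_format] usummable this[rule_format]] obtain Q where Q: "\<And>a. holomorphic_several_on (Q a) (polydisc (Suc (s + 2)))"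
    "\<And>z. z \<in> polydisc (Suc (s + 2)) \<Longrightarrow> f (z + w) = (\<Sum>a\<in>A. Q a z * poly_eval (g a) z)"
    by blast
  let ?D = "{z. z - w \<in> polydisc (Suc (s + 2))}"
  have "open ((\<lambda>z. z - w) -` polydisc (Suc (s + 2)))"
    by (rule continuous_open_vimage[OF open_polydisc]) (intro continuous_intros)
  then have D: "open ?D" "w \<in> ?D" by (simp_all add: vimage_def zero_in_polydisc)
  have "hol_at w (\<lambda>z. Q a (z - w))" for a
    unfolding hol_at_def using D holomorphic_several_translate[OF Q(1)] by blast
  then have "(\<lambda>z. \<Sum>a\<in>A. Q a (z - w) * poly_at w (g a) z) \<in> ocomb w (poly_at w ` J)"
    using A(2) by (intro ocomb_sum ocomb_mult ocomb_base) auto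
  moreover have "\<forall>\<^sub>F z in nhds w. z \<in> ?D" using D by (rule eventually_nhds_in_open)
  then have "\<forall>\<^sub>F z in nhds w. f z = (\<Sum>a\<in>A. Q a (z - w) * poly_at w (g a) z)"
  proof eventually_elim
    case (elim z)
    then show ?case using Q(2)[of "z - w"] by (simp add: poly_at_def)
  qed
  ultimately show ?thesis by (rule lcomb_cong)
qed

text \<open>Taking the closure adds functions but no germs outside the ideal generated by
  \<open>J\<close>. Conversely, cutting a polynomial off outside \<Omega> keeps its germ at
  \<open>w\<close>, as \<Omega> is open.\<close>

lemma ocomb_closure:
  assumes \<Omega>: "open \<Omega>" "w \<in> \<Omega>" and J: "poly_ideal J"
  defines "M \<equiv> hilbert_topology H ip closure_of (poly_on \<Omega> w ` J)"
  shows "stalk M w = germ w ` ocomb w (poly_at w ` J)"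
proof -
  have sub: "poly_on \<Omega> w ` J \<subseteq> H" using poly_on_in_H by blast
  have "M \<subseteq> H" unfolding M_def by (rule closure_subset)
  then have "hol_at w f" if "f \<in> M" for f
    using that holomorphic \<Omega> unfolding hol_at_def by blast
  then have "stalk M w = germ w ` ocomb w M"
    unfolding stalk_def by (rule genideal_germs)
  moreover have "ocomb w M = ocomb w (poly_at w ` J)"
  proof
    show "ocomb w M \<subseteq> ocomb w (poly_at w ` J)"
      using closure_in_ocomb[OF \<Omega> J] unfolding M_def by (intro ocomb_trans) blast
    have JM: "poly_on \<Omega> w ` J \<subseteq> M"
      unfolding M_def using sub
      by (intro closure_of_subset) (simp add: hilbert_topology_def metric.topspace_mtopology)
    show "ocomb w (poly_at w ` J) \<subseteq> ocomb w M"
    proof (rule ocomb_trans, rule image_subsetI)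
      fix q assume "q \<in> J"
      then have "poly_on \<Omega> w q \<in> ocomb w M" using JM by (intro ocomb_base) blast
      moreover have "\<forall>\<^sub>F z in nhds w. poly_at w q z = poly_on \<Omega> w q z"
        using eventually_nhds_in_open[OF \<Omega>]
        by eventually_elim (simp add: poly_at_def poly_on_apply)
      ultimately show "poly_at w q \<in> ocomb w M" by (rule lcomb_cong)
    qed
  qed
  ultimately show ?thesis by simp
qed

text \<open>Duality: for \<open>b\<close> and \<open>b'\<close> in \<open>B\<close> the inner
  product of \<open>poly_on \<Omega> w b\<close> with \<open>k b'\<close> is 1 if
  \<open>b' = b\<close> and 0 otherwise. This gives independence, and an element of the joint kernel
  is recovered from its inner products with the basis \<open>B\<close>.\<close>

lemma joint_kernel_dim:
  assumes \<Omega>: "open \<Omega>" "w \<in> \<Omega>" and J: "poly_ideal J"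
    and basis: "fibre_basis J B"
  defines "M \<equiv> hilbert_topology H ip closure_of (poly_on \<Omega> w ` J)"
  shows "has_complex_dim (joint_kernel M ip w) (card B)"
proof -
  note B = fibre_basisD[OF basis]
  let ?W = "max_ideal_times J" and ?\<iota> = "poly_on \<Omega> w"
  note W = max_ideal_times_ideal[OF J]
  have sub: "?\<iota> ` J \<subseteq> H" using poly_on_in_H by blast
  have Jscale: "const_poly c * q \<in> J" if "q \<in> J" for c q using poly_ideal_mult[OF J that] .
  have D: "subspace (?\<iota> ` J)"
  proof (rule subspaceI)
    have "?\<iota> 0 = 0" by (rule ext) (simp add: poly_on_apply)
    then show "0 \<in> ?\<iota> ` J" using poly_ideal_0[OF J] by (metis imageI)
  next
    fix x y assume "x \<in> ?\<iota> ` J" "y \<in> ?\<iota> ` J"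
    then show "x + y \<in> ?\<iota> ` J" using poly_ideal_add[OF J] by (auto simp flip: poly_on_add)
  next
    fix c x assume "x \<in> ?\<iota> ` J"
    then show "fun_scale c x \<in> ?\<iota> ` J" using Jscale by (auto simp flip: poly_on_scale)
  qed
  have M: "subspace M" "M \<subseteq> H" "hilbert_topology H ip closure_of M = M"
    unfolding M_def by (rule subspace_closure[OF D sub], rule closure_subset, rule closure_idem)
  have JM: "?\<iota> q \<in> M" if "q \<in> J" for q
    unfolding M_def using closure_of_subset[of "?\<iota> ` J" "hilbert_topology H ip"] sub that
    by (auto simp: hilbert_topology_def metric.topspace_mtopology)
  have MH: "\<And>g. g \<in> M \<Longrightarrow> g \<in> H" using M(2) by blast
  \<comment> \<open>The kernel of an adjoint is the orthogonal complement of the range; by density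
    it suffices to test on polynomials from \<open>J\<close>.\<close>
  have kernel_iff: "f \<in> joint_kernel M ip w \<longleftrightarrow> f \<in> M \<and> (\<forall>j. \<forall>q\<in>J. ip (?\<iota> (var_poly j * q)) f = 0)" for f
  proof -
    have "adjoint_on M ip (shifted_mult w j) f = 0 \<longleftrightarrow> (\<forall>q\<in>J. ip (?\<iota> (var_poly j * q)) f = 0)" if f: "f \<in> M" for j
    proof -
      obtain C where C: "\<And>g. g \<in> H \<Longrightarrow> shifted_mult w j g \<in> H" "\<And>g. g \<in> H \<Longrightarrow> nrm (shifted_mult w j g) \<le> C * nrm g"
        using shifted_mult_bounded by blast
      have "adjoint_on M ip (shifted_mult w j) f = 0 \<longleftrightarrow> (\<forall>g\<in>M. ip (shifted_mult w j g) f = 0)"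
        using C MH by (intro adjoint_on_eq_0_iff[OF M _ _ _ _ f] shifted_mult_add shifted_mult_scale) auto
      also have "\<dots> \<longleftrightarrow> (\<forall>q\<in>J. ip (?\<iota> (var_poly j * q)) f = 0)"
      proof
        assume "\<forall>g\<in>M. ip (shifted_mult w j g) f = 0"
        then show "\<forall>q\<in>J. ip (?\<iota> (var_poly j * q)) f = 0"
          using JM by (simp flip: shifted_mult_poly_on)
      next
        assume orth: "\<forall>q\<in>J. ip (?\<iota> (var_poly j * q)) f = 0"
        show "\<forall>g\<in>M. ip (shifted_mult w j g) f = 0"
        proof
          fix g assume g: "g \<in> M"
          show "ip (shifted_mult w j g) f = 0"
          proof (rule orthogonal_closure[OF sub MH[OF f] C(1) shifted_mult_diff C(2)])
            show "ip (shifted_mult w j h) f = 0" if "h \<in> ?\<iota> ` J" for h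
              using that orth by (auto simp: shifted_mult_poly_on)
            show "g \<in> hilbert_topology H ip closure_of (?\<iota> ` J)" using g by (simp add: M_def)
          qed
        qed
      qed
      finally show ?thesis .
    qed
    then show ?thesis
      unfolding joint_kernel_def shifted_mult_def[symmetric] by auto
  qed
  define coord where "coord q = (SOME c. q - (\<Sum>b\<in>B. const_poly (c b) * b) \<in> ?W)" for q
  have coord: "q - (\<Sum>b\<in>B. const_poly (coord q b) * b) \<in> ?W" if "q \<in> J" for q
    unfolding coord_def by (rule someI_ex[OF B(3)[OF that]])
  have coord_unique: "coord q b = c b" if q: "q \<in> J" and c: "q - (\<Sum>b\<in>B. const_poly (c b) * b) \<in> ?W" and b: "b \<in> B" for q c b
  proof -
    have "(q - (\<Sum>b\<in>B. const_poly (c b) * b)) - (q - (\<Sum>b\<in>B. const_poly (coord q b) * b)) \<in> ?W"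
      by (rule poly_ideal_diff[OF W c coord[OF q]])
    also have "(q - (\<Sum>b\<in>B. const_poly (c b) * b)) - (q - (\<Sum>b\<in>B. const_poly (coord q b) * b)) =
        (\<Sum>b\<in>B. const_poly (coord q b - c b) * b)"
      by (rule poly_eval_inject) (simp add: left_diff_distrib sum_subtractf)
    finally show ?thesis using B(4)[of "\<lambda>b. coord q b - c b"] b by auto
  qed
  have coord_add: "coord (p + q) b = coord p b + coord q b" if pq: "p \<in> J" "q \<in> J" and b: "b \<in> B" for p q b
  proof (rule coord_unique[OF poly_ideal_add[OF J pq] _ b])
    have "(p - (\<Sum>b\<in>B. const_poly (coord p b) * b)) + (q - (\<Sum>b\<in>B. const_poly (coord q b) * b)) \<in> ?W"
      by (rule poly_ideal_add[OF W coord[OF pq(1)] coord[OF pq(2)]])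
    also have "(p - (\<Sum>b\<in>B. const_poly (coord p b) * b)) + (q - (\<Sum>b\<in>B. const_poly (coord q b) * b)) =
        p + q - (\<Sum>b\<in>B. const_poly (coord p b + coord q b) * b)"
      by (rule poly_eval_inject) (simp add: distrib_right sum.distrib)
    finally show "p + q - (\<Sum>b\<in>B. const_poly (coord p b + coord q b) * b) \<in> ?W" .
  qed
  have coord_scale: "coord (const_poly k * q) b = k * coord q b" if q: "q \<in> J" and b: "b \<in> B" for k q b
  proof (rule coord_unique[OF Jscale[OF q] _ b])
    have "const_poly k * (q - (\<Sum>b\<in>B. const_poly (coord q b) * b)) \<in> ?W"
      by (rule poly_ideal_mult[OF W coord[OF q]])
    also have "const_poly k * (q - (\<Sum>b\<in>B. const_poly (coord q b) * b)) =
        const_poly k * q - (\<Sum>b\<in>B. const_poly (k * coord q b) * b)"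
      by (rule poly_eval_inject) (simp add: right_diff_distrib sum_distrib_left mult.assoc)
    finally show "const_poly k * q - (\<Sum>b\<in>B. const_poly (k * coord q b) * b) \<in> ?W" .
  qed
  have coord_W: "coord q b = 0" if q: "q \<in> ?W" and b: "b \<in> B" for q b
  proof -
    have "q \<in> J" using q max_ideal_times_subset[OF J] by blast
    moreover have "q - (\<Sum>b\<in>B. const_poly 0 * b) \<in> ?W" using q by simp
    ultimately show ?thesis using coord_unique[of q "\<lambda>_. 0"] b by blast
  qed
  have coord_B: "coord b b' = (if b' = b then 1 else 0)" if b: "b \<in> B" "b' \<in> B" for b b'
  proof (rule coord_unique[OF _ _ b(2)])
    show "b \<in> J" using b B(2) by blast
    have "(\<Sum>b'\<in>B. const_poly (if b' = b then 1 else 0) * b') = (\<Sum>b'\<in>B. if b' = b then b else 0)"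
      by (intro sum.cong) auto
    then show "b - (\<Sum>b'\<in>B. const_poly (if b' = b then 1 else 0) * b') \<in> ?W"
      using b(1) B(1) poly_ideal_0[OF W] by simp
  qed
  obtain r C where r: "0 < r" "0 \<le> C"
    and loc: "\<forall>z. (\<forall>j. cmod (z $ j) \<le> r) \<longrightarrow> z + w \<in> \<Omega> \<and> (\<forall>f\<in>H. cmod (f (z + w)) \<le> C * nrm f)"
    using local_bound[OF \<Omega>] by blast
  \<comment> \<open>Coordinates are to become functionals on functions, so a polynomial must be
    recoverable from its values on \<Omega>; a torus around \<open>w\<close> inside \<Omega>
    suffices.\<close>
  have \<iota>_inj: "inj_on ?\<iota> J"
  proof (rule inj_onI)
    fix p q assume "?\<iota> p = ?\<iota> q"
    then have "?\<iota> (p - q) = 0" by (simp add: poly_on_diff)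
    moreover have "z + w \<in> \<Omega>" if "\<And>j. cmod (z $ j) = r" for z :: "complex^'n" using loc that by auto
    ultimately have "p - q = 0"
      by (intro poly_eval_eq_0_imp[OF r(1)]) (metis add_diff_cancel_right' poly_on_apply zero_fun_apply)
    then show "p = q" by simp
  qed
  have "\<exists>k. k \<in> M \<and> (\<forall>q\<in>J. coord q b = ip (?\<iota> q) k)" if b: "b \<in> B" for b
  proof -
    obtain n where n: "\<And>p. p \<in> J \<Longrightarrow> (\<forall>a\<in>keys p. n \<le> mon_degree a) \<Longrightarrow> p \<in> ?W"
      using artin_rees[OF J W max_ideal_times_subset[OF J] var_mult_in_max_ideal_times[OF J]] by blast
    \<comment> \<open>Elements of \<open>J\<close> without terms of degree below \<open>n\<close>
      lie in \<open>?W\<close>, so a coordinate depends only on the finitely many coefficients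
      indexed by \<open>A\<close>, each of which is bounded.\<close>
    define A where "A = {a :: 'n \<Rightarrow>\<^sub>0 nat. mon_degree a < n}"
    have fA: "finite A"
    proof -
      have "\<exists>N. \<forall>a::'n \<Rightarrow>\<^sub>0 nat. mon_degree a < n \<longrightarrow> mon_code a \<le> N"
      proof (intro exI allI impI)
        fix a :: "'n \<Rightarrow>\<^sub>0 nat" assume a: "mon_degree a < n"
        have le: "lookup a j \<le> n" for j
          using member_le_sum[of j UNIV "lookup a"] a by (simp add: mon_degree_def)
        show "mon_code a \<le> (\<Prod>j\<in>(UNIV :: 'n set). var_prime j ^ n)"
          unfolding mon_code_def
        proof (rule prod_mono)
          fix j :: 'n
          have "1 \<le> var_prime j" using prime_gt_0_nat[OF prime_var_prime[of j]] by simp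
          with le show "0 \<le> var_prime j ^ lookup a j \<and>
              var_prime j ^ lookup a j \<le> var_prime j ^ n"
            by (simp add: power_increasing)
        qed
      qed
      then obtain N where "\<And>a::'n \<Rightarrow>\<^sub>0 nat. mon_degree a < n \<Longrightarrow> mon_code a \<le> N" by blast
      then have "A \<subseteq> {a. mon_code a \<le> N}" by (auto simp: A_def)
      then show ?thesis by (rule finite_subset[OF _ finite_mon_code_le])
    qed
    have "\<exists>k. \<forall>q\<in>J. coord q b = (\<Sum>a\<in>A. k a * lookup q a)"
    proof (rule functional_combination[where add = "(+)" and scl = "\<lambda>c p. const_poly c * p" and x = "\<lambda>a q. lookup q a", OF fA])
      fix q assume q: "q \<in> J" "\<And>a. a \<in> A \<Longrightarrow> lookup q a = 0"
      have "q \<in> ?W"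
        using q(2) by (intro n[OF q(1)]) (metis A_def in_keys_iff mem_Collect_eq not_le)
      then show "coord q b = 0" by (rule coord_W[OF _ b])
    next
      fix a c and p :: "'n cpoly"
      show "lookup (const_poly c * p) a = c * lookup p a"
        using lookup_single_mult_add[of 0 c p a] by (simp add: const_poly_def)
    qed (auto simp: lookup_add coord_add[OF _ _ b] coord_scale[OF _ b] poly_ideal_add[OF J] Jscale)
    then obtain k where k: "\<And>q. q \<in> J \<Longrightarrow> coord q b = (\<Sum>a\<in>A. k a * lookup q a)" by blast
    obtain s where s: "1 / 2 ^ s < r"
      using real_arch_pow_inv[OF r(1), of "1/2"] by (auto simp: power_divide)
    define Z where "Z = suminf (\<lambda>n. 1 / real (Suc n) ^ 2) * C"
    have bound: "cmod (coord q b) \<le> (\<Sum>a\<in>A. cmod (k a) * real (mon_code a) ^ (s + 2) * Z) * nrm (?\<iota> q)" if q: "q \<in> J" for q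
    proof -
      have "cmod (lookup q a) \<le> real (mon_code a) ^ (s + 2) * (Z * nrm (?\<iota> q))" for a
      proof -
        have "cmod (lookup q a) / real (mon_code a) ^ (s + 2) \<le> coeff_norm (s + 2) q"
          unfolding coeff_norm_superset[OF finite.insertI[OF finite_keys] subset_insertI[of _ a]]
          by (rule member_le_sum[where f = "\<lambda>a. cmod (lookup q a) / real (mon_code a) ^ (s + 2)"]) simp_all
        also have "\<dots> \<le> Z * nrm (?\<iota> q)"
          unfolding Z_def by (rule coeff_norm_bound[OF r loc less_imp_le[OF s]])
        finally show ?thesis
          using mon_code_pos[of a] by (subst (asm) pos_divide_le_eq) (simp_all add: mult.commute)
      qed
      then have "cmod (coord q b) \<le> (\<Sum>a\<in>A. cmod (k a) * (real (mon_code a) ^ (s + 2) * (Z * nrm (?\<iota> q))))"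
        unfolding k[OF q] by (intro sum_norm_le) (simp only: norm_mult mult_left_mono norm_ge_zero)
      then show ?thesis by (simp only: sum_distrib_right mult.assoc)
    qed
    define \<phi> where "\<phi> f = coord (inv_into J ?\<iota> f) b" for f
    have \<phi>: "\<phi> (?\<iota> q) = coord q b" if "q \<in> J" for q
      unfolding \<phi>_def using inv_into_f_f[OF \<iota>_inj that] by simp
    have "\<exists>k\<in>hilbert_topology H ip closure_of (?\<iota> ` J). \<forall>f\<in>?\<iota> ` J. \<phi> f = ip f k"
    proof (rule riesz[OF D sub])
      fix f g assume "f \<in> ?\<iota> ` J" "g \<in> ?\<iota> ` J"
      then obtain p q where "p \<in> J" "q \<in> J" "f = ?\<iota> p" "g = ?\<iota> q" by blast
      then show "\<phi> (f + g) = \<phi> f + \<phi> g"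
        using \<phi>[of "p + q"] by (simp add: poly_on_add \<phi> poly_ideal_add[OF J] coord_add[OF _ _ b])
    next
      fix c f assume "f \<in> ?\<iota> ` J"
      then obtain p where "p \<in> J" "f = ?\<iota> p" by blast
      then show "\<phi> (fun_scale c f) = c * \<phi> f"
        using \<phi>[of "const_poly c * p"] by (simp add: poly_on_scale \<phi> Jscale coord_scale[OF _ b])
    next
      fix f assume "f \<in> ?\<iota> ` J"
      then show "cmod (\<phi> f) \<le> (\<Sum>a\<in>A. cmod (k a) * real (mon_code a) ^ (s + 2) * Z) * nrm f"
        using bound \<phi> by auto
    qed
    then show ?thesis using \<phi> unfolding M_def by auto
  qed
  then obtain k where k: "\<And>b. b \<in> B \<Longrightarrow> k b \<in> M" "\<And>b q. b \<in> B \<Longrightarrow> q \<in> J \<Longrightarrow> coord q b = ip (?\<iota> q) (k b)"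
    by metis
  have ip_sum_right: "ip h (\<Sum>b\<in>B. fun_scale (c b) (k b)) = (\<Sum>b\<in>B. cnj (c b) * ip h (k b))" if h: "h \<in> H" for h c
  proof -
    have "(\<Sum>b\<in>S. fun_scale (c b) (k b)) \<in> H \<and> ip h (\<Sum>b\<in>S. fun_scale (c b) (k b)) = (\<Sum>b\<in>S. cnj (c b) * ip h (k b))"
      if "finite S" "S \<subseteq> B" for S
      using that
    proof induction
      case empty
      show ?case using H_zero ip_zero_right[OF h] by (simp only: sum.empty simp_thms)
    next
      case (insert b S)
      have kb: "k b \<in> H" using k(1) insert.prems MH by blast
      have IH: "(\<Sum>b\<in>S. fun_scale (c b) (k b)) \<in> H"
        "ip h (\<Sum>b\<in>S. fun_scale (c b) (k b)) = (\<Sum>b\<in>S. cnj (c b) * ip h (k b))"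
        using insert.IH insert.prems by blast+
      show ?case
        unfolding sum.insert[OF insert.hyps] ip_add_right[OF H_scale[OF kb] IH(1) h] ip_scale_right[OF kb h] IH(2)
        by (simp only: H_add[OF H_scale[OF kb] IH(1)] simp_thms)
    qed
    then show ?thesis using B(1) by blast
  qed
  have kK: "k b \<in> joint_kernel M ip w" if b: "b \<in> B" for b
    unfolding kernel_iff
  proof (intro conjI allI ballI k(1) b)
    fix j q assume q: "q \<in> J"
    have "var_poly j * q \<in> J" by (rule poly_ideal_mult[OF J q])
    then have "ip (?\<iota> (var_poly j * q)) (k b) = coord (var_poly j * q) b" using k(2)[OF b] by simp
    also have "\<dots> = 0" by (rule coord_W[OF var_mult_in_max_ideal_times[OF J q] b])
    finally show "ip (?\<iota> (var_poly j * q)) (k b) = 0" .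
  qed
  have scalars: "c b = 0" if c: "(\<Sum>b\<in>B. fun_scale (c b) (k b)) = 0" and b: "b \<in> B" for c b
  proof -
    have bJ: "b \<in> J" using b B(2) by blast
    have "ip (?\<iota> b) 0 = (\<Sum>b'\<in>B. cnj (c b') * ip (?\<iota> b) (k b'))"
      using ip_sum_right[of "?\<iota> b" c, OF poly_on_in_H] c by simp
    also have "\<dots> = (\<Sum>b'\<in>B. if b' = b then cnj (c b) else 0)"
    proof (intro sum.cong refl)
      fix b' assume b': "b' \<in> B"
      show "cnj (c b') * ip (?\<iota> b) (k b') = (if b' = b then cnj (c b) else 0)"
        using k(2)[OF b' bJ] coord_B[OF b b'] by (auto split: if_splits)
    qed
    finally have "cnj (c b) = 0" using B(1) b ip_zero_right[OF poly_on_in_H] by simp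
    then show ?thesis by simp
  qed
  have k_inj: "inj_on k B"
  proof (rule inj_onI, rule ccontr)
    fix b b' assume bb: "b \<in> B" "b' \<in> B" "k b = k b'" "b \<noteq> b'"
    have "coord b b = coord b b'" using k(2) bb B(2) by (metis subsetD)
    then show False using coord_B bb by simp
  qed
  have indep: "independent (k ` B)"
  proof (rule independent_if_scalars_zero)
    fix u x assume u: "(\<Sum>x\<in>k ` B. fun_scale (u x) x) = 0" and x: "x \<in> k ` B"
    obtain b where "b \<in> B" "x = k b" using x by blast
    moreover have "(\<Sum>b\<in>B. fun_scale (u (k b)) (k b)) = 0"
      using u by (simp add: sum.reindex[OF k_inj])
    ultimately show "u x = 0" using scalars[of "\<lambda>b. u (k b)"] by blast
  qed (use B(1) in simp)
  have spn: "joint_kernel M ip w \<subseteq> span (k ` B)"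
  proof
    fix f assume "f \<in> joint_kernel M ip w"
    then have f: "f \<in> M" "\<And>j q. q \<in> J \<Longrightarrow> ip (?\<iota> (var_poly j * q)) f = 0" by (auto simp: kernel_iff)
    have fH: "f \<in> H" using f(1) MH by blast
    have ip_sum_left: "ip (?\<iota> (\<Sum>i\<in>S. p i)) f = (\<Sum>i\<in>S. ip (?\<iota> (p i)) f)" if "finite S" for S :: "'i set" and p
      using that
    proof induction
      case empty
      have "?\<iota> 0 = 0" by (rule ext) (simp add: poly_on_apply)
      then show ?case using ip_zero_left[OF fH] by (simp only: sum.empty)
    next
      case (insert i S)
      then show ?case
        by (simp only: sum.insert[OF insert.hyps] poly_on_add ip_add[OF poly_on_in_H poly_on_in_H fH])
    qed
    have fW: "ip (?\<iota> q) f = 0" if q: "q \<in> ?W" for q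
    proof -
      obtain v where "\<forall>j. v j \<in> J" "q = (\<Sum>j\<in>UNIV. var_poly j * v j)"
        using q unfolding max_ideal_times_def by blast
      then show ?thesis using f(2) by (simp add: ip_sum_left)
    qed
    \<comment> \<open>Conjugates because \<open>ip\<close> is conjugate linear in its second
      argument; \<open>h\<close> is built to have the same inner products as \<open>f\<close> with
      the polynomials from \<open>J\<close>.\<close>
    define h where "h = (\<Sum>b\<in>B. fun_scale (cnj (ip (?\<iota> b) f)) (k b))"
    have hM: "h \<in> M" unfolding h_def using k(1) M(1) by (intro subspace_sum subspace_scale) auto
    have eq: "ip (?\<iota> q) f = ip (?\<iota> q) h" if q: "q \<in> J" for q
    proof -
      have "ip (?\<iota> (q - (\<Sum>b\<in>B. const_poly (coord q b) * b))) f = 0" by (rule fW[OF coord[OF q]])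
      then have "ip (?\<iota> q) f = ip (?\<iota> (\<Sum>b\<in>B. const_poly (coord q b) * b)) f"
        by (simp only: poly_on_diff ip_diff[OF poly_on_in_H poly_on_in_H fH] right_minus_eq)
      also have "\<dots> = (\<Sum>b\<in>B. coord q b * ip (?\<iota> b) f)"
        by (simp only: ip_sum_left[OF B(1)] poly_on_scale ip_scale[OF poly_on_in_H fH])
      also have "\<dots> = ip (?\<iota> q) h"
        unfolding h_def ip_sum_right[OF poly_on_in_H] using k(2)[OF _ q] by (intro sum.cong) (auto simp: mult.commute)
      finally show ?thesis .
    qed
    have d: "f - h \<in> M" "f - h \<in> H" using subspace_diff[OF M(1) f(1) hM] MH by auto
    \<comment> \<open>\<open>f - h\<close> lies in the closure of the polynomials to which it is
      orthogonal.\<close>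
    have "ip (f - h) (f - h) = 0"
    proof (rule orthogonal_closure[of "?\<iota> ` J" "f - h" "\<lambda>g. g" 1])
      show "ip g (f - h) = 0" if "g \<in> ?\<iota> ` J" for g
        using that eq MH[OF f(1)] MH[OF hM] poly_on_in_H by (auto simp: ip_diff_right)
      show "f - h \<in> hilbert_topology H ip closure_of ?\<iota> ` J" using d(1) by (simp add: M_def)
    qed (use sub d in auto)
    then have "f = h" using ip_definite[OF d(2)] by simp
    moreover have "h \<in> span (k ` B)"
      unfolding h_def by (intro span_sum span_scale span_base imageI)
    ultimately show "f \<in> span (k ` B)" by (simp only:)
  qed
  have "card (k ` B) = dim (joint_kernel M ip w)"
    using kK by (intro basis_card_eq_dim indep spn) auto
  then have "dim (joint_kernel M ip w) = card B" using k_inj by (simp add: card_image)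
  then show ?thesis
    unfolding has_complex_dim_def using B(1) spn by (intro conjI exI[of _ "k ` B"]) auto
qed

end

theorem proposition3p6:
  fixes \<Omega> :: "(complex^('n::finite)) set"
    and H M :: "(complex^'n \<Rightarrow> complex) set"
    and ip :: "(complex^'n \<Rightarrow> complex) \<Rightarrow> (complex^'n \<Rightarrow> complex) \<Rightarrow> complex"
    and I :: "'n cpoly set"
    and w0 :: "complex^'n"
  assumes "open \<Omega>" and "connected \<Omega>" and "bounded \<Omega>"
    and "analytic_hilbert_module \<Omega> H ip"
    and "poly_ideal I"
    and "M = ideal_closure \<Omega> H ip I"
    and "w0 \<in> \<Omega>"
  shows "(\<exists>G. minimal_generators (germ_ring w0) (stalk M w0) G) \<and>
         (\<forall>G. minimal_generators (germ_ring w0) (stalk M w0) G \<longrightarrow>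
              finite G \<and> has_complex_dim (joint_kernel M ip w0) (card G))"
proof -
  interpret analytic_hilbert_module \<Omega> H ip by fact
  define J where "J = translate w0 ` I"
  have J: "poly_ideal J" unfolding J_def by (rule poly_ideal_translate) fact
  \<comment> \<open>The two translations cancel, so \<open>I\<close> and \<open>J\<close> have the
    same image in \<open>H\<close>.\<close>
  have "poly_on \<Omega> w0 (translate w0 p) = poly_fun \<Omega> p" for p
    using translate_translate[of "- w0" p] by (simp add: poly_on_def)
  then have "poly_on \<Omega> w0 ` J = poly_fun \<Omega> ` I"
    unfolding J_def image_image by simp
  then have M: "M = hilbert_topology H ip closure_of (poly_on \<Omega> w0 ` J)"
    using assms(6) by (simp add: ideal_closure_def)
  \<comment> \<open>One \<open>B\<close> serves both sides, so the two numbers meet in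
    \<open>card B\<close>.\<close>
  obtain B where B: "fibre_basis J B"
    using ex_fibre_basis[OF J] by blast
  have "stalk M w0 = germ w0 ` ocomb w0 (poly_at w0 ` J)"
    unfolding M by (rule ocomb_closure[OF assms(1,7) J])
  moreover have "has_complex_dim (joint_kernel M ip w0) (card B)"
    unfolding M by (rule joint_kernel_dim[OF assms(1,7) J B])
  ultimately show ?thesis
    using minimal_generators_ideal[OF J B, of w0] by auto
qed

end
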